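(* Let $2\le m_1\le m_2$ be integers, let $A\subseteq\{0,\dots,m_1-1\}\times\{0,\dots,m_2-1\}$ be nonempty, let $K$ be the Bedford–McMullen carpet associated with $A$, and let $T=(T_{m_1},T_{m_2})$ be the map $x\mapsto (m_1x^{(1)} \bmod 1,\ m_2x^{(2)} \bmod 1)$ on $K$. Let $M$ be the number of $a\in\{0,\dots,m_1-1\}$ such that $(a,b)\in A$ for some $b$ (the number of non-empty columns), and suppose there is an integer $N\ge 1$ such that every non-empty column contains exactly $N$ elements of $A$, i.e. $\#\{b:(a,b)\in A\}\in\{0,N\}$ for all $a\in\{0,\dots,m_1-1\}$. Let $\psi:\mathbb N\to(0,\infty)$ be any function (no monotonicity assumed), let $0\le\gamma\le\log_{m_1}m_2$, and put $$\tau_1=\liminf_{n\to\infty}\frac{-\log_{m_1}\psi(n)}{n},\qquad \tau_2=\liminf_{n\to\infty}\frac{-\log_{m_2}\psi(n)^{\gamma}}{n}.$$ Let $W_\gamma(K,T,\psi)$ be the set of $x=(x^{(1)},x^{(2)})\in K$ such that, for infinitely many $n\in\mathbb N$, $$|x^{(1)}-T_{m_1}^n(x^{(1)})|<\psi(n)\quad\text{and}\quad |x^{(2)}-T_{m_2}^n(x^{(2)})|<\psi(n)^\gamma .$$ If $\tau_1\ge 0$, then $\dim_{\mathrm H}W_\gamma(K,T,\psi)=\min\{t_1,t_2\}$, where $$t_1=\begin{cases}\left(1-\dfrac{\tau_1\log_{m_2}m_1}{1+\tau_2}\right)\log_{m_1}M+\dfrac{\log_{m_2}N}{1+\tau_2}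 & \text{if } 1+(1-\gamma)\tau_1\le\log_{m_1}m_2,\\[2mm] \dfrac{\log_{m_2}M+\log_{m_2}N}{1+\tau_2} & \text{if } 1+(1-\gamma)\tau_1>\log_{m_1}m_2,\end{cases}$$ $$t_2=\begin{cases}\dfrac{\log_{m_1}M}{1+\tau_1}+\log_{m_2}N & \text{if } 1+\tau_1\le\log_{m_1}m_2,\\[2mm] \dfrac{\log_{m_1}M+\log_{m_1}N}{1+\tau_1} & \text{if } 1+(1-\gamma)\tau_1\le\log_{m_1}m_2<1+\tau_1,\\[2mm] \dfrac{\log_{m_1}M+(1+(1-\gamma)\tau_1)\log_{m_2}N}{1+\tau_1} & \text{if } 1+(1-\gamma)\tau_1>\log_{m_1}m_2.\end{cases}$$ In particular, if $\gamma=1$: (1) if $\log_{m_1}m_2>1+\tau_1$, then $$\dim_{\mathrm H}W_1(K,T,\psi)=\min\left\{\frac{\log_{m_1}M+\log_{m_2}N}{1+\tau_2},\ \frac{\log_{m_1}M}{1+\tau_1}+\log_{m_2}N\right\};$$ (2) if $\log_{m_1}m_2\le 1+\tau_1$, then $$\dim_{\mathrm H}W_1(K,T,\psi)=\min\left\{\frac{\log_{m_1}M+\log_{m_2}N}{1+\tau_2},\ \frac{\log_{m_1}M+\log_{m_1}N}{1+\tau_1}\right\}.$$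
   Context: The Bedford–McMullen carpet $K\subseteq[0,1]^2$ associated with $A$ is the unique nonempty compact set with $K=\bigcup_{\mathtt a\in A}\phi_{\mathtt a}(K)$, where $\phi_{\mathtt a}(x^{(1)},x^{(2)})=\left(\frac{x^{(1)}+\mathtt a^{(1)}}{m_1},\frac{x^{(2)}+\mathtt a^{(2)}}{m_2}\right)$ for $\mathtt a=(\mathtt a^{(1)},\mathtt a^{(2)})$. Equivalently $K=\pi(A^{\mathbb N})$ with $\pi(\mathtt x)=\left(\sum_{n\ge1}\mathtt x^{(1)}_n m_1^{-n},\ \sum_{n\ge1}\mathtt x^{(2)}_n m_2^{-n}\right)$. $T_{m}(y)=my \bmod 1\in[0,1)$. Convention for the degenerate case: if every $\mathtt a\in A$ has $\mathtt a^{(i)}=m_i-1$ (so that $x^{(i)}=1$ for all $x\in K$), then $T_{m_i}(1)$ is taken to be $1$, so that $T$ maps $K$ to $K$. If $\tau_1=\infty$, the values $t_1,t_2$ and the right-hand sides in (1), (2) are understood as the limits as $\tau_1\to\infty$ of the formulas with $\tau_2=\gamma\tau_1\log_{m_2}m_1$. (In general $\tau_2=\gamma\tau_1\log_{m_2}m_1$ when $\tau_1<\infty$.) $\dim_{\mathrm H}$ denotes Hausdorff dimension with respect to the Euclidean metric. When $m_1<m_2$ the uniform-column hypothesis is equivalent to equality of the Hausdorff and box dimensions of $K$. *)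

theory Defs
  imports "HOL-Analysis.Analysis" "HOL-Real_Asymp.Real_Asymp"
begin

section \<open>Hausdorff dimension\<close>

text \<open>The case distinction fixes the convention that, for exponent 0, every nonempty set has weight 1
  (note that \<open>0 powr 0 = 0\<close>).\<close>

definition hausdorff_weight :: "real \<Rightarrow> 'a::metric_space set \<Rightarrow> real" where
  "hausdorff_weight s U = (if U = {} then 0 else if s = 0 then 1 else diameter U powr s)"

text \<open>Boundedness is required separately because \<^const>\<open>diameter\<close> is unspecified on unbounded sets.\<close>

definition hausdorff_content :: "real \<Rightarrow> real \<Rightarrow> 'a::metric_space set \<Rightarrow> ennreal" where
  "hausdorff_content \<delta> s X =
     (INF U \<in> {U :: nat \<Rightarrow> 'a set. X \<subseteq> (\<Union>i. U i) \<and> (\<forall>i. bounded (U i) \<and> diameter (U i) \<le> \<delta>)}.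
        \<Sum>i. ennreal (hausdorff_weight s (U i)))"

definition hausdorff_measure :: "real \<Rightarrow> 'a::metric_space set \<Rightarrow> ennreal" where
  "hausdorff_measure s X = (SUP \<delta>\<in>{0<..}. hausdorff_content \<delta> s X)"

definition hausdorff_dim :: "'a::metric_space set \<Rightarrow> ereal" where
  "hausdorff_dim X = (INF s \<in> {s. 0 \<le> s \<and> hausdorff_measure s X = 0}. ereal s)"

section \<open>Bedford--McMullen carpets\<close>

text \<open>The distance on \<^typ>\<open>real \<times> real\<close> is the Euclidean one.\<close>

definition carpet_map :: "nat \<Rightarrow> nat \<Rightarrow> nat \<times> nat \<Rightarrow> real \<times> real \<Rightarrow> real \<times> real" where
  "carpet_map m1 m2 a x =
     ((fst x + real (fst a)) / real m1, (snd x + real (snd a)) / real m2)"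

definition is_carpet :: "nat \<Rightarrow> nat \<Rightarrow> (nat \<times> nat) set \<Rightarrow> (real \<times> real) set \<Rightarrow> bool" where
  "is_carpet m1 m2 A K \<longleftrightarrow> compact K \<and> K \<noteq> {} \<and> K = (\<Union>a\<in>A. carpet_map m1 m2 a ` K)"

text \<open>The map \<open>y \<mapsto> m y mod 1\<close>, where \<open>D\<close> is the set of digits occurring in the coordinate in question.
  If the only digit is \<open>m - 1\<close>, that coordinate of the carpet is the single point 1, which is then
  taken to be fixed.\<close>

definition times_mod1 :: "nat \<Rightarrow> nat set \<Rightarrow> real \<Rightarrow> real" where
  "times_mod1 m D y = (if y = 1 \<and> (\<forall>d\<in>D. d = m - 1) then 1 else frac (real m * y))"

definition recurrence_set ::
  "nat \<Rightarrow> nat \<Rightarrow> (nat \<times> nat) set \<Rightarrow> (real \<times> real) set \<Rightarrow> real \<Rightarrow> (nat \<Rightarrow> real) \<Rightarrow> (real \<times> real) set" where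
  "recurrence_set m1 m2 A K \<gamma> \<psi> =
     {x \<in> K. \<exists>\<^sub>\<infinity>n.
        \<bar>fst x - (times_mod1 m1 (fst ` A) ^^ n) (fst x)\<bar> < \<psi> n \<and>
        \<bar>snd x - (times_mod1 m2 (snd ` A) ^^ n) (snd x)\<bar> < \<psi> n powr \<gamma>}"

section \<open>The dimension formulas\<close>

definition t1_formula :: "nat \<Rightarrow> nat \<Rightarrow> nat \<Rightarrow> nat \<Rightarrow> real \<Rightarrow> real \<Rightarrow> real \<Rightarrow> real" where
  "t1_formula m1 m2 M N \<gamma> \<tau>1 \<tau>2 =
     (if 1 + (1 - \<gamma>) * \<tau>1 \<le> log m1 m2
      then (1 - \<tau>1 * log m2 m1 / (1 + \<tau>2)) * log m1 M + log m2 N / (1 + \<tau>2)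
      else (log m2 M + log m2 N) / (1 + \<tau>2))"

definition t2_formula :: "nat \<Rightarrow> nat \<Rightarrow> nat \<Rightarrow> nat \<Rightarrow> real \<Rightarrow> real \<Rightarrow> real \<Rightarrow> real" where
  "t2_formula m1 m2 M N \<gamma> \<tau>1 \<tau>2 =
     (if 1 + \<tau>1 \<le> log m1 m2
      then log m1 M / (1 + \<tau>1) + log m2 N
      else if 1 + (1 - \<gamma>) * \<tau>1 \<le> log m1 m2
      then (log m1 M + log m1 N) / (1 + \<tau>1)
      else (log m1 M + (1 + (1 - \<gamma>) * \<tau>1) * log m2 N) / (1 + \<tau>1))"

text \<open>Value of a formula \<open>F\<close> in the exponents \<open>\<tau>1\<close>, \<open>\<tau>2\<close>; for \<open>\<tau>1 = \<infinity>\<close> it is the limit as \<open>\<tau>1\<close> tends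
  to infinity along \<open>\<tau>2 = \<gamma> \<tau>1 log_m2 m1\<close>, the relation that holds whenever \<open>\<tau>1\<close> is finite.\<close>

definition at_exponents ::
  "nat \<Rightarrow> nat \<Rightarrow> real \<Rightarrow> (real \<Rightarrow> real \<Rightarrow> real) \<Rightarrow> ereal \<Rightarrow> ereal \<Rightarrow> real" where
  "at_exponents m1 m2 \<gamma> F \<tau>1 \<tau>2 =
     (if \<tau>1 = \<infinity> then Lim at_top (\<lambda>s. F s (\<gamma> * s * log m2 m1))
      else F (real_of_ereal \<tau>1) (real_of_ereal \<tau>2))"

text \<open>The limits of the two formulas exist, so the use of \<^const>\<open>Lim\<close> is meaningful.\<close>

lemma eventually_cond:
  fixes c L :: real
  assumes "c = 0 \<longrightarrow> 1 \<le> L"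
  shows "(\<forall>\<^sub>F s in at_top. 1 + c * s \<le> L) \<or> (c > 0 \<and> (\<forall>\<^sub>F s in at_top. \<not> 1 + c * s \<le> L))"
proof -
  consider "c = 0" | "c > 0" | "c < 0" by linarith
  then show ?thesis
  proof cases
    case 1 then show ?thesis using assms by simp
  next
    case 2
    have "filterlim (\<lambda>s::real. 1 + c * s) at_top at_top" using 2 by real_asymp
    then have "\<forall>\<^sub>F s in at_top. L < 1 + c * s" by (rule filterlim_at_top_dense[THEN iffD1, rule_format])
    then have "\<forall>\<^sub>F s in at_top. \<not> 1 + c * s \<le> L" by (rule eventually_mono) simp
    then show ?thesis using 2 by blast
  next
    case 3
    have "filterlim (\<lambda>s::real. 1 + c * s) at_bot at_top" using 3 by real_asymp
    then have "\<forall>\<^sub>F s in at_top. 1 + c * s \<le> L" by (auto simp: filterlim_at_bot)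
    then show ?thesis by auto
  qed
qed

lemma t1_formula_limit_exists:
  assumes "2 \<le> m1" "m1 \<le> m2" "0 \<le> \<gamma>" "\<gamma> \<le> log m1 m2"
  shows "\<exists>l. ((\<lambda>s. t1_formula m1 m2 M N \<gamma> s (\<gamma> * s * log m2 m1)) \<longlongrightarrow> l) at_top"
proof -
  define lm where "lm = log (real m2) (real m1)"
  define L where "L = log (real m1) (real m2)"
  have lm: "lm > 0" using assms by (simp add: lm_def)
  have L: "1 \<le> L" using assms by (simp add: L_def)
  have inv: "\<exists>l. ((\<lambda>s::real. 1 / (1 + \<gamma> * s * lm)) \<longlongrightarrow> l) at_top"
  proof (cases "\<gamma> = 0")
    case False
    define c where "c = \<gamma> * lm"
    have "c > 0" using False assms lm by (simp add: c_def)
    then have "((\<lambda>s::real. 1 / (1 + c * s)) \<longlongrightarrow> 0) at_top" by real_asymp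
    then show ?thesis by (auto simp: c_def ac_simps)
  qed auto
  then obtain l where l: "((\<lambda>s::real. 1 / (1 + \<gamma> * s * lm)) \<longlongrightarrow> l) at_top" by blast
  from eventually_cond[of "1 - \<gamma>" L] L
  consider "\<gamma> > 0" "\<forall>\<^sub>F s in at_top. 1 + (1 - \<gamma>) * s \<le> L"
    | "\<forall>\<^sub>F s in at_top. \<not> 1 + (1 - \<gamma>) * s \<le> L"
  proof (cases "\<gamma> = 0")
    case True
    have "\<forall>\<^sub>F s in at_top. L < 1 + s" by real_asymp
    then have "\<forall>\<^sub>F s in at_top. \<not> 1 + (1 - \<gamma>) * s \<le> L" using True by (auto elim: eventually_mono)
    then show ?thesis using that by blast
  qed (use assms L that in auto)
  then show ?thesis
  proof cases
    case 1
    define c where "c = \<gamma> * lm"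
    have "c > 0" using 1 lm by (simp add: c_def)
    then have "((\<lambda>s::real. s / (1 + c * s)) \<longlongrightarrow> 1 / c) at_top"
      by (real_asymp simp: field_simps)
    then have *: "((\<lambda>s::real. s / (1 + \<gamma> * s * lm)) \<longlongrightarrow> 1 / (\<gamma> * lm)) at_top"
      by (simp add: c_def ac_simps)
    have "((\<lambda>s. (1 - lm * (s / (1 + \<gamma> * s * lm))) * log m1 M
            + log m2 N * (1 / (1 + \<gamma> * s * lm))) \<longlongrightarrow>
          (1 - lm * (1 / (\<gamma> * lm))) * log m1 M + log m2 N * l) at_top"
      by (intro tendsto_intros * l)
    moreover have "\<forall>\<^sub>F s in at_top. (1 - lm * (s / (1 + \<gamma> * s * lm))) * log m1 M
            + log m2 N * (1 / (1 + \<gamma> * s * lm)) = t1_formula m1 m2 M N \<gamma> s (\<gamma> * s * lm)"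
      using 1(2) by eventually_elim (simp add: t1_formula_def L_def[symmetric] lm_def[symmetric] ac_simps)
    ultimately show ?thesis unfolding lm_def[symmetric] by (blast intro: Lim_transform_eventually)
  next
    case 2
    have "((\<lambda>s. (log m2 M + log m2 N) * (1 / (1 + \<gamma> * s * lm))) \<longlongrightarrow>
          (log m2 M + log m2 N) * l) at_top"
      by (intro tendsto_intros l)
    moreover have "\<forall>\<^sub>F s in at_top. (log m2 M + log m2 N) * (1 / (1 + \<gamma> * s * lm))
         = t1_formula m1 m2 M N \<gamma> s (\<gamma> * s * lm)"
      using 2 by eventually_elim (simp add: t1_formula_def L_def[symmetric])
    ultimately show ?thesis unfolding lm_def[symmetric] by (blast intro: Lim_transform_eventually)
  qed
qed

lemma t2_formula_limit_exists:
  assumes "2 \<le> m1" "m1 \<le> m2" "0 \<le> \<gamma>" "\<gamma> \<le> log m1 m2"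
  shows "\<exists>l. ((\<lambda>s. t2_formula m1 m2 M N \<gamma> s (\<gamma> * s * log m2 m1)) \<longlongrightarrow> l) at_top"
proof -
  define L where "L = log (real m1) (real m2)"
  have L: "1 \<le> L" using assms by (simp add: L_def)
  have a: "\<forall>\<^sub>F s in at_top. L < 1 + s" by real_asymp
  from eventually_cond[of "1 - \<gamma>" L] L
  consider "\<forall>\<^sub>F s in at_top. 1 + (1 - \<gamma>) * s \<le> L"
    | "\<forall>\<^sub>F s in at_top. \<not> 1 + (1 - \<gamma>) * s \<le> L" by auto
  then show ?thesis
  proof cases
    case 1
    have "((\<lambda>s. (log m1 M + log m1 N) / (1 + s)) \<longlongrightarrow> 0) at_top" by real_asymp
    moreover have "\<forall>\<^sub>F s in at_top. (log m1 M + log m1 N) / (1 + s)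
         = t2_formula m1 m2 M N \<gamma> s (\<gamma> * s * log m2 m1)"
      using 1 a by eventually_elim (simp add: t2_formula_def L_def[symmetric])
    ultimately show ?thesis by (blast intro: Lim_transform_eventually)
  next
    case 2
    have "((\<lambda>s. log m1 M * (1 / (1 + s)) + (1 / (1 + s) + (1 - \<gamma>) * (s / (1 + s))) * log m2 N)
        \<longlongrightarrow> log m1 M * 0 + (0 + (1 - \<gamma>) * 1) * log m2 N) at_top"
      by (intro tendsto_intros; real_asymp)
    moreover have "\<forall>\<^sub>F s in at_top.
        log m1 M * (1 / (1 + s)) + (1 / (1 + s) + (1 - \<gamma>) * (s / (1 + s))) * log m2 N
         = t2_formula m1 m2 M N \<gamma> s (\<gamma> * s * log m2 m1)"
      using 2 a by eventually_elim
        (simp add: t2_formula_def L_def[symmetric] add_divide_distrib distrib_right)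
    ultimately show ?thesis by (blast intro: Lim_transform_eventually)
  qed
qed

end

theory Submission
  imports Defs "HOL-Probability.Infinite_Product_Measure"
begin

text \<open>
  Write \<open>L = log\<^bsub>m1\<^esub> m2\<close> and code a point of the carpet by the sequence of its digit pairs (column, row).
  A return at time \<open>n\<close> with radii about \<open>m1\<^sup>-\<^sup>\<tau>\<^sup>n\<close> and \<open>m2\<^sup>-\<^sup>\<sigma>\<^sup>n\<close>, where \<open>\<sigma> = \<gamma> \<tau> / L\<close>, means that the \<open>\<tau> n\<close>
  columns and the \<open>\<sigma> n\<close> rows after position \<open>n\<close> repeat the beginning of the sequence, while all other digits are
  free. An approximate square of side \<open>m2\<^sup>-\<^sup>x\<^sup>n\<close> is given by \<open>L x n\<close> columns and \<open>x n\<close> rows. Every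
  non-empty column has \<open>N\<close> rows, so a free column contributes a factor \<open>M\<close> and a free row a factor \<open>N\<close>,
  whatever the other digits are. Hence about \<open>m2\<^sup>x\<^sup>n\<^sup>f\<^sup>(\<^sup>x\<^sup>)\<close> such squares meet the points that return at time
  \<open>n\<close>, where \<open>f\<close> is the function \<open>carpet_rate\<close>.

  For the upper bound any fixed \<open>x\<close> may be used: the squares for all large \<open>n\<close> cover the recurrence set, so its
  dimension is at most \<open>f x\<close> (\<open>hausdorff_dim_le_carpet_rate\<close>). Being close is not the same as having
  equal digits, but the first \<open>n\<close> digits leave only boundedly many choices for a repeated block
  (\<open>recurrent_block_choices\<close>).

  For the lower bound, choose very sparse return times, force exact repetition there, and draw all other digits
  independently and uniformly. The local dimension of the resulting measure is governed by the values of \<open>f\<close>, so the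
  mass distribution principle bounds the dimension below by the infimum of \<open>f\<close>
  (\<open>hausdorff_dim_recurrence_ge\<close>).

  The numerator of \<open>f\<close> is piecewise linear, and its only convex corners are the points \<open>x = (1 + \<tau>) / L\<close> and
  \<open>x = 1 + \<sigma>\<close> where a repeated block ends; so \<open>f\<close> attains its minimum at one of these two points
  (\<open>free_lengths_minimal\<close>), and its values there are the two formulas (\<open>best_rate_eq_formulas\<close>).
  Only the lower limit of \<open>- log\<^bsub>m1\<^esub> \<psi>(n) / n\<close> enters, because the bounds hold for every exponent slightly
  below, respectively above, that limit, and the formulas depend continuously on the exponent.
\<close>


section \<open>Bounding Hausdorff dimension from above and from below\<close>

lemma hausdorff_dim_nonneg: "0 \<le> hausdorff_dim X"
  unfolding hausdorff_dim_def by (rule INF_greatest) auto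

text \<open>The pieces on which \<open>code n\<close> is constant have diameter at most \<open>r n\<close>, and from any starting index on they
  cover \<open>X\<close>; the total weight of these covers is a tail of the convergent series. Codes rather than
  sets are given because in applications it is the number of codes that can be counted.\<close>
lemma hausdorff_dim_le_limsup_cover:
  fixes X :: "'a::metric_space set" and E :: "nat \<Rightarrow> 'a set" and code :: "nat \<Rightarrow> 'a \<Rightarrow> 'c"
  assumes limsup: "\<And>x. x \<in> X \<Longrightarrow> \<exists>\<^sub>\<infinity>n. x \<in> E n"
    and fin: "\<And>n. finite (I n)"
    and code: "\<And>n x. x \<in> E n \<Longrightarrow> code n x \<in> I n"
    and close: "\<And>n x y. x \<in> E n \<Longrightarrow> y \<in> E n \<Longrightarrow> code n x = code n y \<Longrightarrow> dist x y \<le> r n"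
    and r: "r \<longlonglongrightarrow> 0" "\<And>n. 0 \<le> r n"
    and sm: "summable (\<lambda>n. real (card (I n)) * r n powr s)"
    and s: "0 < s"
  shows "hausdorff_dim X \<le> ereal s"
proof -
  define V where "V n i = {x \<in> E n. code n x = i}" for n i
  have V_dist: "dist x y \<le> r n" if "x \<in> V n i" "y \<in> V n i" for x y n i
    using that close unfolding V_def by auto
  have V_bdd: "bounded (V n i)" for n i
  proof (cases "V n i = {}")
    case False
    then obtain x where "x \<in> V n i" by blast
    then show ?thesis using V_dist unfolding bounded_def by blast
  qed simp
  have V_diam: "diameter (V n i) \<le> r n" for n i
    unfolding diameter_def using r(2)[of n] V_dist[of _ n i] by (auto simp: split_beta intro!: cSUP_least)
  have "\<exists>h. bij_betw h {0..<card (I n)} (I n)" for n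
    using ex_bij_betw_nat_finite[OF fin] by blast
  then obtain h where h: "\<And>n. bij_betw (h n) {0..<card (I n)} (I n)" by metis
  have content: "hausdorff_content \<delta> s X = 0" if "\<delta> > 0" for \<delta>
  proof -
    have "hausdorff_content \<delta> s X \<le> ennreal \<epsilon>" if "\<epsilon> > 0" for \<epsilon> :: real
    proof -
      define t where "t n = real (card (I n)) * r n powr s" for n
      have t_nn: "0 \<le> t n" for n by (simp add: t_def)
      have "\<forall>\<^sub>F k in sequentially. r k < \<delta>"
        using order_tendstoD(2)[OF r(1)] \<open>\<delta> > 0\<close> by auto
      then obtain n1 where n1: "\<And>n. n \<ge> n1 \<Longrightarrow> r n < \<delta>"
        unfolding eventually_sequentially by blast
      obtain n2 where n2: "\<And>n. n \<ge> n2 \<Longrightarrow> norm (\<Sum>i. t (i + n)) < \<epsilon>"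
        using suminf_exist_split[OF \<open>\<epsilon> > 0\<close> sm] unfolding t_def by blast
      define n0 where "n0 = max n1 n2"
      define Q where "Q p = (if snd p < card (I (fst p + n0))
          then V (fst p + n0) (h (fst p + n0) (snd p)) else {})" for p
      define U where "U j = Q (prod_decode j)" for j
      have cov: "X \<subseteq> (\<Union>j. U j)"
      proof
        fix x assume "x \<in> X"
        from limsup[OF this] obtain n where n: "n \<ge> n0" "x \<in> E n"
          unfolding INFM_nat_le by blast
        with code have "code n x \<in> I n" by blast
        then obtain j where j: "j < card (I n)" "h n j = code n x"
          using h[of n] unfolding bij_betw_def by force
        have "x \<in> Q (n - n0, j)" using n j by (simp add: Q_def V_def)
        then have "x \<in> U (prod_encode (n - n0, j))" by (simp add: U_def)
        then show "x \<in> (\<Union>j. U j)" by blast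
      qed
      have small: "bounded (U j) \<and> diameter (U j) \<le> \<delta>" for j
      proof (cases "U j = {}")
        case False
        obtain n i where p: "prod_decode j = (n, i)" by (cases "prod_decode j")
        from False have "U j = V (n + n0) (h (n + n0) i)"
          by (auto simp: U_def Q_def p split: if_splits)
        moreover have "r (n + n0) < \<delta>" by (rule n1) (simp add: n0_def)
        ultimately show ?thesis using V_bdd V_diam[of "n + n0" "h (n + n0) i"] by simp
      qed (use \<open>\<delta> > 0\<close> in simp)
      have wQ: "(\<Sum>i. ennreal (hausdorff_weight s (Q (n, i)))) \<le> ennreal (t (n + n0))" for n
      proof -
        have w: "hausdorff_weight s (Q (n, i)) \<le> r (n + n0) powr s" for i
          using s V_diam[of "n + n0"] V_bdd
          by (auto simp: hausdorff_weight_def Q_def intro!: powr_mono2 diameter_ge_0)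
        have "(\<Sum>i. ennreal (hausdorff_weight s (Q (n, i))))
            = (\<Sum>i<card (I (n + n0)). ennreal (hausdorff_weight s (Q (n, i))))"
          by (rule suminf_finite) (auto simp: Q_def hausdorff_weight_def)
        also have "\<dots> \<le> (\<Sum>i<card (I (n + n0)). ennreal (r (n + n0) powr s))"
          by (intro sum_mono ennreal_leI w)
        also have "\<dots> = ennreal (t (n + n0))"
          by (simp add: t_def ennreal_mult ennreal_of_nat_eq_real_of_nat)
        finally show ?thesis .
      qed
      have "hausdorff_content \<delta> s X \<le> (\<Sum>j. ennreal (hausdorff_weight s (U j)))"
        unfolding hausdorff_content_def by (rule INF_lower) (use cov small in auto)
      also have "\<dots> = (\<Sum>n. \<Sum>i. ennreal (hausdorff_weight s (Q (n, i))))"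
        unfolding U_def
        by (rule suminf_ennreal_2dimen[where f = "\<lambda>p. ennreal (hausdorff_weight s (Q p))"]) simp
      also have "\<dots> \<le> (\<Sum>n. ennreal (t (n + n0)))"
        by (intro suminf_le wQ) auto
      also have "\<dots> = ennreal (\<Sum>n. t (n + n0))"
        by (rule suminf_ennreal2) (use sm t_nn in \<open>auto simp: t_def intro: summable_ignore_initial_segment\<close>)
      also have "\<dots> \<le> ennreal \<epsilon>"
        using n2[of n0] by (intro ennreal_leI) (auto simp: n0_def)
      finally show ?thesis .
    qed
    note small = this
    have "hausdorff_content \<delta> s X \<le> 0"
    proof (rule ennreal_le_epsilon)
      fix \<epsilon> :: real assume "0 < \<epsilon>"
      from small[OF this] show "hausdorff_content \<delta> s X \<le> 0 + ennreal \<epsilon>" by simp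
    qed
    then show ?thesis by simp
  qed
  have "hausdorff_measure s X = 0"
    unfolding hausdorff_measure_def
    by (rule antisym[OF SUP_least]) (use content in auto)
  then show ?thesis unfolding hausdorff_dim_def by (intro INF_lower) (use s in auto)
qed

text \<open>The mass distribution principle. The preimage of a set of a cover can fail to be measurable; countable
  subadditivity is therefore applied to measurable sets \<open>B\<close> above these preimages.\<close>
lemma (in prob_space) mass_distribution_hausdorff_dim:
  fixes x :: "'a \<Rightarrow> 'b::metric_space"
  assumes x: "\<And>\<omega>. \<omega> \<in> space M \<Longrightarrow> x \<omega> \<in> X" and \<delta>: "0 < \<delta>" and C: "0 < C" and s: "0 < s"
    and B: "\<And>U. bounded U \<Longrightarrow> diameter U \<le> \<delta> \<Longrightarrow>
      \<exists>B\<in>sets M. {\<omega>\<in>space M. x \<omega> \<in> U} \<subseteq> B \<and> prob B \<le> C * diameter U powr s"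
  shows "ereal s \<le> hausdorff_dim X"
  unfolding hausdorff_dim_def
proof (rule INF_greatest, clarsimp, rule ccontr)
  fix s' assume s': "0 \<le> s'" "hausdorff_measure s' X = 0" "\<not> s \<le> s'"
  define d where "d = min \<delta> 1"
  have "hausdorff_content d s' X \<le> hausdorff_measure s' X"
    unfolding hausdorff_measure_def by (rule SUP_upper) (use \<delta> in \<open>auto simp: d_def\<close>)
  then have "hausdorff_content d s' X < ennreal (1 / C)" using s' C by simp
  then obtain U where U: "X \<subseteq> (\<Union>i. U i)" "\<And>i. bounded (U i)" "\<And>i. diameter (U i) \<le> d"
    and sum: "(\<Sum>i. ennreal (hausdorff_weight s' (U i))) < ennreal (1 / C)"
    unfolding hausdorff_content_def INF_less_iff by blast
  have "\<forall>i. \<exists>B\<in>sets M. {\<omega>\<in>space M. x \<omega> \<in> U i} \<subseteq> B \<and> prob B \<le> C * diameter (U i) powr s"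
    using B U by (auto simp: d_def)
  then obtain D where D: "\<And>i. D i \<in> sets M" "\<And>i. {\<omega>\<in>space M. x \<omega> \<in> U i} \<subseteq> D i"
    "\<And>i. prob (D i) \<le> C * diameter (U i) powr s" by metis
  \<comment> \<open>The diameters are at most 1, so a smaller exponent only increases the weights.\<close>
  have w: "diameter (U i) powr s \<le> hausdorff_weight s' (U i)" for i
  proof (cases "U i = {}")
    case False
    have d01: "0 \<le> diameter (U i)" "diameter (U i) \<le> 1"
      using U(2,3)[of i] by (auto simp: d_def diameter_ge_0)
    have "diameter (U i) powr s \<le> diameter (U i) powr s'" if "diameter (U i) \<noteq> 0"
      using that d01 s'(3) by (intro powr_mono') auto
    moreover have "diameter (U i) powr s \<le> 1" using d01 s by (simp add: powr_le1)
    ultimately show ?thesis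
      using False by (cases "diameter (U i) = 0") (auto simp: hausdorff_weight_def)
  qed (simp add: hausdorff_weight_def)
  have "space M \<subseteq> (\<Union>i. D i)"
  proof
    fix \<omega> assume \<omega>: "\<omega> \<in> space M"
    then obtain i where "x \<omega> \<in> U i" using x U(1) by blast
    with \<omega> D(2)[of i] show "\<omega> \<in> (\<Union>i. D i)" by blast
  qed
  then have "1 \<le> emeasure M (\<Union>i. D i)"
    using emeasure_mono[of "space M" "\<Union>i. D i" M] D(1) by (auto simp: emeasure_space_1)
  also have "\<dots> \<le> (\<Sum>i. emeasure M (D i))"
    by (rule emeasure_subadditive_countably) (use D(1) in auto)
  also have "\<dots> \<le> (\<Sum>i. ennreal C * ennreal (hausdorff_weight s' (U i)))"
  proof (intro suminf_le)
    fix i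
    have "prob (D i) \<le> C * hausdorff_weight s' (U i)"
      using D(3)[of i] w[of i] C by (meson less_imp_le mult_left_mono order_trans)
    then show "emeasure M (D i) \<le> ennreal C * ennreal (hausdorff_weight s' (U i))"
      using C by (simp add: emeasure_eq_measure ennreal_mult[symmetric] hausdorff_weight_def)
  qed auto
  also have "\<dots> = ennreal C * (\<Sum>i. ennreal (hausdorff_weight s' (U i)))" by simp
  also have "\<dots> < ennreal C * ennreal (1 / C)"
    using sum C by (intro ennreal_mult_strict_left_mono) auto
  also have "\<dots> = 1" using C by (simp add: ennreal_mult[symmetric])
  finally show False by simp
qed

section \<open>Expansions in an integer base\<close>

definition digit_val :: "nat \<Rightarrow> (nat \<Rightarrow> nat) \<Rightarrow> real" where
  "digit_val m d = (\<Sum>j. real (d j) / real m ^ Suc j)"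

primrec digit_prefix :: "nat \<Rightarrow> (nat \<Rightarrow> nat) \<Rightarrow> nat \<Rightarrow> nat" where
  "digit_prefix m d 0 = 0"
| "digit_prefix m d (Suc n) = m * digit_prefix m d n + d n"

locale base =
  fixes m :: nat
  assumes base_ge_2: "2 \<le> m"
begin

lemma geometric_top_digit: "(\<lambda>j. real (m - 1) / real m ^ Suc j) sums 1"
proof -
  have "(\<lambda>j. (1 / real m) ^ j) sums (1 / (1 - 1 / real m))"
    using base_ge_2 by (intro geometric_sums) auto
  from sums_mult[OF this, of "real (m - 1) / real m"]
  show ?thesis using base_ge_2 by (simp add: field_simps power_divide of_nat_diff)
qed

lemma digit_summable:
  assumes "\<And>j. d j < m"
  shows "summable (\<lambda>j. real (d j) / real m ^ Suc j)"
proof (rule summable_comparison_test'[OF sums_summable[OF geometric_top_digit]])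
  fix n :: nat
  have "d n \<le> m - 1" using assms[of n] by linarith
  then show "norm (real (d n) / real m ^ Suc n) \<le> real (m - 1) / real m ^ Suc n"
    by (simp add: divide_right_mono del: power_Suc)
qed

lemma digit_val_nonneg: "(\<And>j. d j < m) \<Longrightarrow> 0 \<le> digit_val m d"
  unfolding digit_val_def by (intro suminf_nonneg digit_summable) auto

lemma digit_val_le_1: assumes "\<And>j. d j < m" shows "digit_val m d \<le> 1"
proof -
  have "d n \<le> m - 1" for n using assms[of n] by linarith
  then have "digit_val m d \<le> (\<Sum>j. real (m - 1) / real m ^ Suc j)"
    unfolding digit_val_def
    by (intro suminf_le digit_summable assms sums_summable[OF geometric_top_digit])
      (simp add: divide_right_mono del: power_Suc)
  then show ?thesis using sums_unique[OF geometric_top_digit] by simp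
qed

lemma digit_val_shift:
  assumes "\<And>j. d j < m"
  shows "real m * digit_val m d = real (d 0) + digit_val m (\<lambda>j. d (Suc j))"
proof -
  have m0: "real m \<noteq> 0" using base_ge_2 by simp
  have "digit_val m d = (\<Sum>j. real (d (Suc j)) / real m ^ Suc (Suc j)) + real (d 0) / real m"
    unfolding digit_val_def using suminf_split_head[OF digit_summable[of d]] assms by simp
  also have "(\<Sum>j. real (d (Suc j)) / real m ^ Suc (Suc j))
      = (\<Sum>j. (real (d (Suc j)) / real m ^ Suc j) / real m)"
    by (simp add: field_simps)
  also have "\<dots> = digit_val m (\<lambda>j. d (Suc j)) / real m"
    unfolding digit_val_def
    by (rule suminf_divide[OF digit_summable]) (rule assms)
  finally show ?thesis using m0 by (simp add: field_simps)
qed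

lemma digit_val_prefix:
  assumes "\<And>j. d j < m"
  shows "real m ^ n * digit_val m d = real (digit_prefix m d n) + digit_val m (\<lambda>j. d (j + n))"
proof (induction n)
  case (Suc n)
  have "real m ^ Suc n * digit_val m d
      = real m * real (digit_prefix m d n) + real m * digit_val m (\<lambda>j. d (j + n))"
    using Suc by (simp add: algebra_simps)
  also have "real m * digit_val m (\<lambda>j. d (j + n)) = real (d n) + digit_val m (\<lambda>j. d (j + Suc n))"
    using digit_val_shift[of "\<lambda>j. d (j + n)"] assms by simp
  finally show ?case by simp
qed simp

lemma digit_val_first_digit_less:
  assumes "\<And>j. d j < m" "d 0 \<noteq> m - 1"
  shows "digit_val m d < 1"
proof -
  have "d 0 + 2 \<le> m" using assms(1)[of 0] assms(2) by linarith
  then have "real (d 0) + 2 \<le> real m" by linarith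
  moreover have "digit_val m (\<lambda>j. d (Suc j)) \<le> 1" by (rule digit_val_le_1) (rule assms(1))
  ultimately have "real m * digit_val m d < real m * 1"
    using digit_val_shift[of d] assms(1) by simp
  then show ?thesis using base_ge_2 by simp
qed

lemma digit_val_less_1:
  assumes d: "\<And>j. d j < m" and "d i \<noteq> m - 1"
  shows "digit_val m d < 1"
  using assms
proof (induction i arbitrary: d)
  case 0 then show ?case by (intro digit_val_first_digit_less)
next
  case (Suc i)
  have "digit_val m (\<lambda>j. d (Suc j)) < 1" by (rule Suc.IH) (use Suc.prems in auto)
  moreover have "real (d 0) + 1 \<le> real m" using Suc.prems(1)[of 0] by linarith
  ultimately have "real m * digit_val m d < real m * 1"
    using digit_val_shift[of d] Suc.prems(1) by simp
  then show ?case using base_ge_2 by simp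
qed

lemma digit_val_top: "digit_val m (\<lambda>j. m - 1) = 1"
  unfolding digit_val_def using geometric_top_digit by (rule sums_unique[symmetric])

lemma digit_prefix_inj:
  assumes "\<And>j. d j < m" "\<And>j. e j < m" "digit_prefix m d n = digit_prefix m e n" "j < n"
  shows "d j = e j"
  using assms(3,4)
proof (induction n)
  case (Suc n)
  have "d n = digit_prefix m d (Suc n) mod m" using assms(1)[of n] by simp
  also have "\<dots> = e n" unfolding Suc.prems(1) using assms(2)[of n] by simp
  finally have n: "d n = e n" .
  then have "digit_prefix m d n = digit_prefix m e n" using Suc.prems(1) base_ge_2 by simp
  then show ?case using Suc n by (cases "j = n") auto
qed simp

lemma digit_prefix_cong: "(\<And>j. j < n \<Longrightarrow> d j = e j) \<Longrightarrow> digit_prefix m d n = digit_prefix m e n"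
  by (induction n) auto

lemma digit_prefix_bounds:
  assumes "\<And>j. d j < m"
  shows "real (digit_prefix m d n) \<le> real m ^ n * digit_val m d"
    and "real m ^ n * digit_val m d \<le> real (digit_prefix m d n) + 1"
  using digit_val_prefix[of d n] digit_val_nonneg[of "\<lambda>j. d (j + n)"]
    digit_val_le_1[of "\<lambda>j. d (j + n)"] assms by auto

lemma digit_val_close:
  assumes "\<And>j. d j < m" "\<And>j. e j < m" "\<And>j. j < n \<Longrightarrow> d j = e j"
  shows "\<bar>digit_val m d - digit_val m e\<bar> \<le> 1 / real m ^ n"
proof -
  have "digit_prefix m d n = digit_prefix m e n" by (rule digit_prefix_cong) (rule assms(3))
  then have "\<bar>real m ^ n * digit_val m d - real m ^ n * digit_val m e\<bar> \<le> 1"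
    using digit_prefix_bounds[of d n] digit_prefix_bounds[of e n] assms(1,2) by auto
  then have "real m ^ n * \<bar>digit_val m d - digit_val m e\<bar> \<le> 1"
    by (simp add: abs_mult right_diff_distrib[symmetric])
  then show ?thesis using base_ge_2 by (simp add: field_simps)
qed

text \<open>The integer \<open>digit_prefix m d n\<close> is \<open>m\<^sup>n digit_val m d\<close> up to an error in \<open>[0, 1]\<close>; the upper end
  occurs for expansions ending in the top digit, which is why the bound is 2 and not 1.\<close>
lemma digit_prefix_close:
  assumes "\<And>j. d j < m" "\<And>j. e j < m" "\<bar>digit_val m d - digit_val m e\<bar> \<le> 1 / real m ^ n"
  shows "\<bar>int (digit_prefix m d n) - int (digit_prefix m e n)\<bar> \<le> 2"
proof -
  have "real m ^ n * \<bar>digit_val m d - digit_val m e\<bar> \<le> 1"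
    using assms(3) base_ge_2 by (simp add: field_simps)
  then have "\<bar>real m ^ n * digit_val m d - real m ^ n * digit_val m e\<bar> \<le> 1"
    by (simp add: abs_mult right_diff_distrib[symmetric])
  then have "\<bar>real (digit_prefix m d n) - real (digit_prefix m e n)\<bar> \<le> 2"
    using digit_prefix_bounds[of d n] digit_prefix_bounds[of e n] assms(1,2) by auto
  then show ?thesis by linarith
qed

lemma frac_mult_frac: "frac (real m * frac y) = frac (real m * y)"
proof -
  have "real m * frac y = real m * y + of_int (- (int m * \<lfloor>y\<rfloor>))"
    by (simp add: frac_def algebra_simps)
  then show ?thesis by (simp only: frac_add_of_int_right)
qed

lemma times_mod1_iterate:
  assumes "d \<in> D" "d \<noteq> m - 1"
  shows "(times_mod1 m D ^^ Suc n) y = frac (real m ^ Suc n * y)"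
proof -
  have T: "times_mod1 m D = (\<lambda>y. frac (real m * y))"
    using assms by (auto simp: times_mod1_def fun_eq_iff simp del: One_nat_def)
  show ?thesis
  proof (induction n)
    case (Suc n)
    have "(times_mod1 m D ^^ Suc (Suc n)) y = frac (real m * frac (real m ^ Suc n * y))"
      using Suc.IH T by simp
    also have "\<dots> = frac (real m ^ Suc (Suc n) * y)"
      by (simp add: frac_mult_frac mult.assoc)
    finally show ?case .
  qed (simp add: T)
qed

text \<open>The tails have values in \<open>[0, 1]\<close>, and the fractional part fixes them unless the value is 1, that is, unless
  all remaining digits are \<open>m - 1\<close>.\<close>
lemma times_mod1_shift:
  assumes d: "\<And>j. d j \<in> D" "\<And>j. d j < m"
    and inf: "(\<forall>e\<in>D. e = m - 1) \<or> (\<exists>\<^sub>\<infinity>j. d j \<noteq> m - 1)"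
  shows "(times_mod1 m D ^^ n) (digit_val m d) = digit_val m (\<lambda>j. d (j + n))"
proof (cases "\<forall>e\<in>D. e = m - 1")
  case True
  then have dd: "d = (\<lambda>j. m - 1)" using d(1) by auto
  have "(times_mod1 m D ^^ n) 1 = 1"
    by (induction n) (use True in \<open>simp_all add: times_mod1_def del: One_nat_def\<close>)
  then show ?thesis by (simp only: dd digit_val_top)
next
  case False
  then obtain e where e: "e \<in> D" "e \<noteq> m - 1" by blast
  show ?thesis
  proof (cases n)
    case (Suc k)
    from inf False obtain j where j: "j \<ge> n" "d j \<noteq> m - 1" unfolding INFM_nat_le by blast
    have "digit_val m (\<lambda>j. d (j + n)) < 1"
      by (rule digit_val_less_1[where i = "j - n"]) (use j d in auto)
    moreover have "0 \<le> digit_val m (\<lambda>j. d (j + n))" by (rule digit_val_nonneg) (rule d)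
    moreover have "(times_mod1 m D ^^ n) (digit_val m d) = frac (real m ^ n * digit_val m d)"
      unfolding Suc by (rule times_mod1_iterate[OF e])
    moreover have "\<dots> = frac (digit_val m (\<lambda>j. d (j + n)))"
      using digit_val_prefix[of d n] d(2)
        frac_add_of_int_right[of "digit_val m (\<lambda>j. d (j + n))" "int (digit_prefix m d n)"]
      by (simp add: add.commute)
    ultimately show ?thesis by (simp add: frac_eq)
  qed simp
qed

lemma times_mod1_top_tail:
  assumes d: "\<And>j. d j < m" and e: "e \<in> D" "e \<noteq> m - 1" and top: "\<And>j. j \<ge> i \<Longrightarrow> d j = m - 1"
    and n: "i < n"
  shows "(times_mod1 m D ^^ n) (digit_val m d) = 0" and "0 < digit_val m d"
proof -
  have one: "digit_val m (\<lambda>j. d (j + n)) = 1" using top n by (simp add: digit_val_top del: One_nat_def)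
  obtain k where k: "n = Suc k" using n by (cases n) auto
  have *: "real m ^ n * digit_val m d = of_int (int (digit_prefix m d n) + 1)"
    using digit_val_prefix[of d n] d one by simp
  show "(times_mod1 m D ^^ n) (digit_val m d) = 0"
    using times_mod1_iterate[OF e, of k "digit_val m d"] unfolding k[symmetric] * by simp
  have "0 < real m ^ n * digit_val m d" using * by simp
  then show "0 < digit_val m d" using base_ge_2 by (simp add: zero_less_mult_iff)
qed

text \<open>An orbit of the expanding map that stays bounded is determined by its itinerary.\<close>

lemma digit_val_unique:
  assumes d: "\<And>j. d j < m" and y: "\<And>n. real m * y n = real (d n) + y (Suc n)"
    and bdd: "\<And>n. \<bar>y n\<bar> \<le> B"
  shows "y 0 = digit_val m d"
proof (rule ccontr)
  assume ne: "y 0 \<noteq> digit_val m d"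
  define e where "e n = y n - digit_val m (\<lambda>j. d (j + n))" for n
  have e_Suc: "real m * e n = e (Suc n)" for n
    using y[of n] digit_val_shift[of "\<lambda>j. d (j + n)"] d by (simp add: e_def algebra_simps)
  have e_pow: "real m ^ n * e 0 = e n" for n
  proof (induction n)
    case (Suc n)
    have "real m ^ Suc n * e 0 = real m * (real m ^ n * e 0)" by simp
    then show ?case using Suc e_Suc[of n] by simp
  qed simp
  have e_bdd: "\<bar>e n\<bar> \<le> B + 1" for n
    using bdd[of n] digit_val_nonneg[of "\<lambda>j. d (j + n)"] digit_val_le_1[of "\<lambda>j. d (j + n)"] d
    by (auto simp: e_def)
  have e0: "\<bar>e 0\<bar> > 0" using ne by (simp add: e_def)
  obtain n where "(B + 1) / \<bar>e 0\<bar> < real m ^ n"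
    using real_arch_pow[of "real m" "(B + 1) / \<bar>e 0\<bar>"] base_ge_2 by auto
  then have "B + 1 < \<bar>real m ^ n * e 0\<bar>" using e0 by (simp add: field_simps abs_mult)
  then show False using e_pow[of n] e_bdd[of n] by simp
qed

text \<open>If the tail after \<open>n\<close> digits returns to within \<open>m\<^sup>-\<^sup>l\<close> of the point itself, then \<open>y \<mapsto> (P + y) / m\<^sup>n\<close>
  nearly fixes that tail, where \<open>P\<close> is the integer formed by the first \<open>n\<close> digits; hence the tail is near
  \<open>P / (m\<^sup>n - 1)\<close> and the first \<open>n\<close> digits leave a bounded number of choices for the next \<open>l\<close>.\<close>

lemma recurrent_block_choices:
  assumes d: "\<And>j. d j < m" and n: "0 < n"
    and close: "\<bar>digit_val m d - digit_val m (\<lambda>j. d (j + n))\<bar> \<le> 1 / real m ^ l"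
  shows "int (digit_prefix m (\<lambda>j. d (j + n)) l)
      - \<lfloor>real (digit_prefix m d n) * real m ^ l / (real m ^ n - 1)\<rfloor> \<in> {-3..3}"
proof -
  define v y P c where "v = digit_val m d" and "y = digit_val m (\<lambda>j. d (j + n))"
    and "P = real (digit_prefix m d n)" and "c = P * real m ^ l / (real m ^ n - 1)"
  have "real m ^ 1 \<le> real m ^ n" using n base_ge_2 by (intro power_increasing) auto
  moreover have "2 \<le> real m" using base_ge_2 by simp
  ultimately have mn: "2 \<le> real m ^ n" unfolding power_one_right by linarith
  have ml: "0 < real m ^ l" using base_ge_2 by simp
  have v: "real m ^ n * v = P + y" unfolding v_def y_def P_def by (rule digit_val_prefix) (rule d)
  have "\<bar>v - y\<bar> * real m ^ l \<le> 1"
    using close ml by (simp add: v_def y_def field_simps)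
  then have "real m ^ n * (\<bar>v - y\<bar> * real m ^ l) \<le> real m ^ n"
    using mn by (simp add: mult_left_le)
  moreover have "real m ^ n * (\<bar>v - y\<bar> * real m ^ l) = \<bar>real m ^ n * v - real m ^ n * y\<bar> * real m ^ l"
    by (simp add: right_diff_distrib[symmetric] abs_mult)
  moreover have "real m ^ n * v - real m ^ n * y = P - (real m ^ n - 1) * y"
    using v by (simp add: algebra_simps)
  ultimately have "\<bar>P - (real m ^ n - 1) * y\<bar> * real m ^ l \<le> real m ^ n" by simp
  moreover have "P - (real m ^ n - 1) * y = (real m ^ n - 1) * (c / real m ^ l - y)"
    using mn ml by (simp add: c_def field_simps)
  ultimately have "(real m ^ n - 1) * \<bar>c / real m ^ l - y\<bar> * real m ^ l \<le> real m ^ n"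
    using mn by (simp add: abs_mult)
  moreover have "\<bar>c / real m ^ l - y\<bar> * real m ^ l = \<bar>c - real m ^ l * y\<bar>"
  proof -
    have "\<bar>c / real m ^ l - y\<bar> * real m ^ l = \<bar>(c / real m ^ l - y) * real m ^ l\<bar>"
      using ml by (simp add: abs_mult)
    moreover have "m \<noteq> 0" using base_ge_2 by simp
    ultimately show ?thesis by (simp add: algebra_simps)
  qed
  ultimately have "(real m ^ n - 1) * \<bar>c - real m ^ l * y\<bar> \<le> real m ^ n" by (simp add: mult.assoc)
  also have "\<dots> \<le> (real m ^ n - 1) * 2" using mn by simp
  finally have "\<bar>c - real m ^ l * y\<bar> \<le> 2"
    by (rule mult_left_le_imp_le) (use mn in simp)
  moreover have "real (digit_prefix m (\<lambda>j. d (j + n)) l) \<le> real m ^ l * y"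
    "real m ^ l * y \<le> real (digit_prefix m (\<lambda>j. d (j + n)) l) + 1"
    using digit_prefix_bounds[of "\<lambda>j. d (j + n)" l] d by (auto simp: y_def)
  ultimately show ?thesis unfolding P_def[symmetric] c_def[symmetric] by (simp; linarith)
qed

text \<open>The map on the circle and the shift on digits can differ only if the digits end in \<open>m - 1\<close> forever;
  then the orbit ends up at \<open>0\<close>, away from its starting point.\<close>

lemma recurrent_digits:
  assumes d: "\<And>j. d j \<in> D" "\<And>j. d j < m"
    and l: "(\<forall>n. l n = 0) \<or> (r \<longlonglongrightarrow> 0 \<and> (\<forall>\<^sub>F n in sequentially. r n \<le> 1 / real m ^ l n))"
  shows "\<forall>\<^sub>F n in sequentially. \<bar>digit_val m d - (times_mod1 m D ^^ n) (digit_val m d)\<bar> < r n \<longrightarrow>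
      \<bar>digit_val m d - digit_val m (\<lambda>j. d (j + n))\<bar> \<le> 1 / real m ^ l n"
  using l
proof
  assume "\<forall>n. l n = 0"
  moreover have "\<bar>digit_val m d - digit_val m (\<lambda>j. d (j + n))\<bar> \<le> 1" for n
    using digit_val_nonneg[of "\<lambda>j. d (j + n)"] digit_val_le_1[of "\<lambda>j. d (j + n)"] d
      digit_val_nonneg[of d] digit_val_le_1[of d] by (auto simp: abs_le_iff)
  ultimately show ?thesis by simp
next
  assume r: "r \<longlonglongrightarrow> 0 \<and> (\<forall>\<^sub>F n in sequentially. r n \<le> 1 / real m ^ l n)"
  show ?thesis
  proof (cases "(\<forall>e\<in>D. e = m - 1) \<or> (\<exists>\<^sub>\<infinity>j. d j \<noteq> m - 1)")
    case True
    from r have "\<forall>\<^sub>F n in sequentially. r n \<le> 1 / real m ^ l n" by blast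
    then show ?thesis
      by eventually_elim (use times_mod1_shift[OF d True] in auto)
  next
    case False
    then obtain e where e: "e \<in> D" "e \<noteq> m - 1" by blast
    from False have "\<forall>\<^sub>\<infinity>j. d j = m - 1" by (simp add: not_INFM)
    then obtain i where i: "\<And>j. j \<ge> i \<Longrightarrow> d j = m - 1" unfolding MOST_nat_le by blast
    have tail: "(times_mod1 m D ^^ n) (digit_val m d) = 0" "0 < digit_val m d" if "i < n" for n
      using times_mod1_top_tail[where d = d, OF d(2) e i that] by blast+
    have "0 < digit_val m d" using tail(2)[of "Suc i"] by simp
    then have "\<forall>\<^sub>F n in sequentially. r n < digit_val m d" using r order_tendstoD(2) by blast
    then show ?thesis using eventually_gt_at_top[of i]
      by eventually_elim (use tail in auto)
  qed
qed

end

section \<open>Symbolic coding of the carpet\<close>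

definition carpet_point :: "nat \<Rightarrow> nat \<Rightarrow> (nat \<Rightarrow> nat \<times> nat) \<Rightarrow> real \<times> real" where
  "carpet_point m1 m2 z = (digit_val m1 (\<lambda>j. fst (z j)), digit_val m2 (\<lambda>j. snd (z j)))"

locale carpet =
  fixes m1 m2 :: nat and A :: "(nat \<times> nat) set"
  assumes m1_ge_2: "2 \<le> m1" and m1_le_m2: "m1 \<le> m2"
    and digits: "A \<subseteq> {0..<m1} \<times> {0..<m2}" and A_nonempty: "A \<noteq> {}"
begin

sublocale b1: base m1 by unfold_locales (rule m1_ge_2)
sublocale b2: base m2 by unfold_locales (use m1_ge_2 m1_le_m2 in linarith)

lemma fst_digit: "p \<in> A \<Longrightarrow> fst p < m1" and snd_digit: "p \<in> A \<Longrightarrow> snd p < m2"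
  using digits by auto

text \<open>Following one preimage after another under the contractions gives the digits; the expanded orbit stays
  in the bounded set \<open>K\<close>.\<close>
lemma carpet_subset_points:
  assumes K: "is_carpet m1 m2 A K"
  shows "K \<subseteq> carpet_point m1 m2 ` {z. \<forall>j. z j \<in> A}"
proof
  fix x assume x: "x \<in> K"
  have "\<forall>x. \<exists>a y. x \<in> K \<longrightarrow> a \<in> A \<and> y \<in> K \<and> x = carpet_map m1 m2 a y"
    using K unfolding is_carpet_def by blast
  then obtain fa fy where f: "\<And>x. x \<in> K \<Longrightarrow> fa x \<in> A \<and> fy x \<in> K \<and> x = carpet_map m1 m2 (fa x) (fy x)"
    by metis
  define X where "X n = (fy ^^ n) x" for n
  define z where "z n = fa (X n)" for n
  have XK: "X n \<in> K" for n by (induction n) (use x f in \<open>auto simp: X_def\<close>)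
  have X_Suc: "X n = carpet_map m1 m2 (z n) (X (Suc n))" for n
    using f[OF XK[of n]] by (simp add: z_def X_def)
  have zA: "z n \<in> A" for n using f[OF XK[of n]] by (simp add: z_def)
  have "bounded K" using K by (auto simp: is_carpet_def compact_imp_bounded)
  then obtain B where B: "\<And>x. x \<in> K \<Longrightarrow> norm x \<le> B" unfolding bounded_iff by blast
  have fstB: "\<bar>fst (X n)\<bar> \<le> B" and sndB: "\<bar>snd (X n)\<bar> \<le> B" for n
    using B[OF XK[of n]] norm_fst_le[of "fst (X n)" "snd (X n)"] norm_snd_le[of "snd (X n)" "fst (X n)"]
    by auto
  have m: "real m1 \<noteq> 0" "real m2 \<noteq> 0" using m1_ge_2 m1_le_m2 by auto
  have fst_step: "real m1 * fst (X n) = real (fst (z n)) + fst (X (Suc n))"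
    and snd_step: "real m2 * snd (X n) = real (snd (z n)) + snd (X (Suc n))" for n
    using arg_cong[OF X_Suc[of n], of fst] arg_cong[OF X_Suc[of n], of snd] m
    by (simp_all add: carpet_map_def)
  have "fst (X 0) = digit_val m1 (\<lambda>j. fst (z j))"
    by (rule b1.digit_val_unique[where y = "\<lambda>n. fst (X n)"])
      (use fst_digit[OF zA] fstB fst_step in auto)
  moreover have "snd (X 0) = digit_val m2 (\<lambda>j. snd (z j))"
    by (rule b2.digit_val_unique[where y = "\<lambda>n. snd (X n)"])
      (use snd_digit[OF zA] sndB snd_step in auto)
  ultimately have "x = carpet_point m1 m2 z" by (simp add: carpet_point_def X_def prod_eq_iff)
  then show "x \<in> carpet_point m1 m2 ` {z. \<forall>j. z j \<in> A}" using zA by blast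
qed

primrec carpet_approx :: "real \<times> real \<Rightarrow> nat \<Rightarrow> (nat \<Rightarrow> nat \<times> nat) \<Rightarrow> real \<times> real" where
  "carpet_approx x0 0 z = x0"
| "carpet_approx x0 (Suc n) z = carpet_map m1 m2 (z 0) (carpet_approx x0 n (\<lambda>j. z (Suc j)))"

text \<open>The contractions for the first \<open>n\<close> digits map a point of \<open>K\<close> into \<open>K\<close>, and these images converge to the
  coded point.\<close>
lemma carpet_points_subset:
  assumes K: "is_carpet m1 m2 A K" and z: "\<And>j. z j \<in> A"
  shows "carpet_point m1 m2 z \<in> K"
proof -
  from K have KU: "K = (\<Union>a\<in>A. carpet_map m1 m2 a ` K)" unfolding is_carpet_def by (elim conjE)
  obtain x0 where x0: "x0 \<in> K" using K by (auto simp: is_carpet_def)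
  have in_K: "carpet_approx x0 n z \<in> K" if "\<And>j. z j \<in> A" for n z
    using that
  proof (induction n arbitrary: z)
    case (Suc n)
    have "carpet_approx x0 n (\<lambda>j. z (Suc j)) \<in> K" by (intro Suc.IH Suc.prems)
    then have "carpet_approx x0 (Suc n) z \<in> (\<Union>a\<in>A. carpet_map m1 m2 a ` K)"
      unfolding carpet_approx.simps by (intro UN_I[of "z 0"] imageI Suc.prems)
    then show ?case by (simp only: KU[symmetric])
  qed (simp add: x0)
  have m: "real m1 > 0" "real m2 > 0" using m1_ge_2 m1_le_m2 by auto
  have fst_eq: "fst (carpet_approx x0 n z) - digit_val m1 (\<lambda>j. fst (z j))
      = (fst x0 - digit_val m1 (\<lambda>j. fst (z (j + n)))) / real m1 ^ n" if "\<And>j. z j \<in> A" for n z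
    using that
  proof (induction n arbitrary: z)
    case (Suc n)
    have "fst (carpet_approx x0 (Suc n) z) - digit_val m1 (\<lambda>j. fst (z j))
       = (fst (carpet_approx x0 n (\<lambda>j. z (Suc j))) - digit_val m1 (\<lambda>j. fst (z (Suc j)))) / real m1"
      using b1.digit_val_shift[of "\<lambda>j. fst (z j)"] fst_digit Suc.prems m
      by (simp add: carpet_map_def field_simps)
    then show ?case using Suc.IH[of "\<lambda>j. z (Suc j)"] Suc.prems by simp
  qed simp
  have snd_eq: "snd (carpet_approx x0 n z) - digit_val m2 (\<lambda>j. snd (z j))
      = (snd x0 - digit_val m2 (\<lambda>j. snd (z (j + n)))) / real m2 ^ n" if "\<And>j. z j \<in> A" for n z
    using that
  proof (induction n arbitrary: z)
    case (Suc n)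
    have "snd (carpet_approx x0 (Suc n) z) - digit_val m2 (\<lambda>j. snd (z j))
       = (snd (carpet_approx x0 n (\<lambda>j. z (Suc j))) - digit_val m2 (\<lambda>j. snd (z (Suc j)))) / real m2"
      using b2.digit_val_shift[of "\<lambda>j. snd (z j)"] snd_digit Suc.prems m
      by (simp add: carpet_map_def field_simps)
    then show ?case using Suc.IH[of "\<lambda>j. z (Suc j)"] Suc.prems by simp
  qed simp
  have dec: "(\<lambda>n. (\<bar>c\<bar> + 1) / real m ^ n) \<longlonglongrightarrow> 0" if "2 \<le> m" for c :: real and m :: nat
    using that by real_asymp
  have "(\<lambda>n. fst (carpet_approx x0 n z) - digit_val m1 (\<lambda>j. fst (z j))) \<longlonglongrightarrow> 0"
  proof (rule Lim_null_comparison[OF always_eventually dec[of m1 "fst x0"]], rule allI)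
    fix n
    have "\<bar>fst x0 - digit_val m1 (\<lambda>j. fst (z (j + n)))\<bar> \<le> \<bar>fst x0\<bar> + 1"
      using b1.digit_val_nonneg[of "\<lambda>j. fst (z (j + n))"] b1.digit_val_le_1[of "\<lambda>j. fst (z (j + n))"]
        fst_digit[OF z] by auto
    then show "norm (fst (carpet_approx x0 n z) - digit_val m1 (\<lambda>j. fst (z j)))
        \<le> (\<bar>fst x0\<bar> + 1) / real m1 ^ n"
      by (simp add: fst_eq[OF z] divide_right_mono)
  qed (rule m1_ge_2)
  then have lim1: "(\<lambda>n. fst (carpet_approx x0 n z)) \<longlonglongrightarrow> digit_val m1 (\<lambda>j. fst (z j))"
    by (simp add: LIM_zero_iff)
  have "(\<lambda>n. snd (carpet_approx x0 n z) - digit_val m2 (\<lambda>j. snd (z j))) \<longlonglongrightarrow> 0"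
  proof (rule Lim_null_comparison[OF always_eventually dec[of m2 "snd x0"]], rule allI)
    fix n
    have "\<bar>snd x0 - digit_val m2 (\<lambda>j. snd (z (j + n)))\<bar> \<le> \<bar>snd x0\<bar> + 1"
      using b2.digit_val_nonneg[of "\<lambda>j. snd (z (j + n))"] b2.digit_val_le_1[of "\<lambda>j. snd (z (j + n))"]
        snd_digit[OF z] by auto
    then show "norm (snd (carpet_approx x0 n z) - digit_val m2 (\<lambda>j. snd (z j)))
        \<le> (\<bar>snd x0\<bar> + 1) / real m2 ^ n"
      by (simp add: snd_eq[OF z] divide_right_mono)
  qed (use b2.base_ge_2 in simp)
  then have lim2: "(\<lambda>n. snd (carpet_approx x0 n z)) \<longlonglongrightarrow> digit_val m2 (\<lambda>j. snd (z j))"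
    by (simp add: LIM_zero_iff)
  have lim: "(\<lambda>n. carpet_approx x0 n z) \<longlonglongrightarrow> carpet_point m1 m2 z"
    using tendsto_Pair[OF lim1 lim2] by (simp add: carpet_point_def)
  have "closed K" using K by (auto simp: is_carpet_def compact_imp_closed)
  moreover have "carpet_approx x0 n z \<in> K" for n by (rule in_K) (rule z)
  ultimately show ?thesis using lim by (rule closed_sequentially)
qed

lemma carpet_point_dist:
  assumes z: "\<And>j. z j \<in> A" "\<And>j. w j \<in> A"
    and agree: "\<And>j. j < l \<Longrightarrow> fst (z j) = fst (w j)" "\<And>j. j < k \<Longrightarrow> snd (z j) = snd (w j)"
  shows "dist (carpet_point m1 m2 z) (carpet_point m1 m2 w) \<le> 1 / real m1 ^ l + 1 / real m2 ^ k"
proof -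
  have "\<bar>digit_val m1 (\<lambda>j. fst (z j)) - digit_val m1 (\<lambda>j. fst (w j))\<bar> \<le> 1 / real m1 ^ l"
    by (rule b1.digit_val_close) (use fst_digit z agree in auto)
  moreover have "\<bar>digit_val m2 (\<lambda>j. snd (z j)) - digit_val m2 (\<lambda>j. snd (w j))\<bar> \<le> 1 / real m2 ^ k"
    by (rule b2.digit_val_close) (use snd_digit z agree in auto)
  moreover have "dist (carpet_point m1 m2 z) (carpet_point m1 m2 w)
      \<le> \<bar>digit_val m1 (\<lambda>j. fst (z j)) - digit_val m1 (\<lambda>j. fst (w j))\<bar>
       + \<bar>digit_val m2 (\<lambda>j. snd (z j)) - digit_val m2 (\<lambda>j. snd (w j))\<bar>"
    unfolding carpet_point_def dist_Pair_Pair dist_real_def power2_abs by (rule sqrt_sum_squares_le_sum_abs)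
  ultimately show ?thesis by linarith
qed

definition near_return :: "nat \<Rightarrow> nat \<Rightarrow> nat \<Rightarrow> (nat \<Rightarrow> nat \<times> nat) \<Rightarrow> bool" where
  "near_return l1 l2 n z \<longleftrightarrow>
     \<bar>digit_val m1 (\<lambda>j. fst (z j)) - digit_val m1 (\<lambda>j. fst (z (j + n)))\<bar> \<le> 1 / real m1 ^ l1 \<and>
     \<bar>digit_val m2 (\<lambda>j. snd (z j)) - digit_val m2 (\<lambda>j. snd (z (j + n)))\<bar> \<le> 1 / real m2 ^ l2"

text \<open>A block of length 0 is no condition at all. This alternative covers radii that do not tend to 0, which
  happens for exponent 0 and, in the second coordinate, for \<open>\<gamma> = 0\<close>.\<close>
lemma recurrence_set_codes:
  assumes K: "is_carpet m1 m2 A K" and x: "x \<in> recurrence_set m1 m2 A K \<gamma> \<psi>"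
    and l1: "(\<forall>n. l1 n = 0) \<or> (\<psi> \<longlonglongrightarrow> 0 \<and> (\<forall>\<^sub>F n in sequentially. \<psi> n \<le> 1 / real m1 ^ l1 n))"
    and l2: "(\<forall>n. l2 n = 0) \<or> ((\<lambda>n. \<psi> n powr \<gamma>) \<longlonglongrightarrow> 0 \<and>
        (\<forall>\<^sub>F n in sequentially. \<psi> n powr \<gamma> \<le> 1 / real m2 ^ l2 n))"
  shows "\<exists>z. (\<forall>j. z j \<in> A) \<and> x = carpet_point m1 m2 z \<and> (\<exists>\<^sub>\<infinity>n. near_return (l1 n) (l2 n) n z)"
proof -
  from x have "x \<in> K" by (simp add: recurrence_set_def)
  with carpet_subset_points[OF K] obtain z where z: "\<And>j. z j \<in> A" "x = carpet_point m1 m2 z" by auto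
  have rec: "\<exists>\<^sub>\<infinity>n. \<bar>fst x - (times_mod1 m1 (fst ` A) ^^ n) (fst x)\<bar> < \<psi> n \<and>
        \<bar>snd x - (times_mod1 m2 (snd ` A) ^^ n) (snd x)\<bar> < \<psi> n powr \<gamma>"
    using x by (simp add: recurrence_set_def)
  have imp1: "\<forall>\<^sub>\<infinity>n. \<bar>fst x - (times_mod1 m1 (fst ` A) ^^ n) (fst x)\<bar> < \<psi> n \<longrightarrow>
      \<bar>digit_val m1 (\<lambda>j. fst (z j)) - digit_val m1 (\<lambda>j. fst (z (j + n)))\<bar> \<le> 1 / real m1 ^ l1 n"
    using b1.recurrent_digits[of "\<lambda>j. fst (z j)" "fst ` A", OF _ _ l1] z(1) fst_digit
    by (simp add: z(2) carpet_point_def cofinite_eq_sequentially)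
  have imp2: "\<forall>\<^sub>\<infinity>n. \<bar>snd x - (times_mod1 m2 (snd ` A) ^^ n) (snd x)\<bar> < \<psi> n powr \<gamma> \<longrightarrow>
      \<bar>digit_val m2 (\<lambda>j. snd (z j)) - digit_val m2 (\<lambda>j. snd (z (j + n)))\<bar> \<le> 1 / real m2 ^ l2 n"
    using b2.recurrent_digits[of "\<lambda>j. snd (z j)" "snd ` A", OF _ _ l2] z(1) snd_digit
    by (simp add: z(2) carpet_point_def cofinite_eq_sequentially)
  have "\<forall>\<^sub>\<infinity>n. (\<bar>fst x - (times_mod1 m1 (fst ` A) ^^ n) (fst x)\<bar> < \<psi> n \<and>
        \<bar>snd x - (times_mod1 m2 (snd ` A) ^^ n) (snd x)\<bar> < \<psi> n powr \<gamma>) \<longrightarrow>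
      near_return (l1 n) (l2 n) n z"
    using imp1 imp2 by eventually_elim (simp add: near_return_def)
  with rec have "\<exists>\<^sub>\<infinity>n. near_return (l1 n) (l2 n) n z" by (rule frequently_rev_mp)
  then show ?thesis using z by blast
qed

end

section \<open>The local dimension along one return, and the upper bound\<close>

text \<open>The part of an interval \<open>[0, y]\<close> that remains after removing \<open>[1, 1 + \<tau>]\<close>: the amount of free
  digits among the first \<open>y n\<close> when a block of \<open>\<tau> n\<close> digits after the first \<open>n\<close> is forced.\<close>

definition free_length :: "real \<Rightarrow> real \<Rightarrow> real" where
  "free_length \<tau> y = y - min \<tau> (max 0 (y - 1))"

text \<open>The exponent \<open>log (number of pieces) / log (1 / side)\<close> for approximate squares of side \<open>m2\<^sup>-\<^sup>x\<^sup>n\<close>,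
  whose first \<open>log\<^bsub>m1\<^esub> m2 * x * n\<close> columns and \<open>x * n\<close> rows are prescribed.\<close>

definition carpet_rate :: "nat \<Rightarrow> nat \<Rightarrow> nat \<Rightarrow> nat \<Rightarrow> real \<Rightarrow> real \<Rightarrow> real \<Rightarrow> real" where
  "carpet_rate m1 m2 M N \<tau>1 \<tau>2 x =
     (ln M * free_length \<tau>1 (log m1 m2 * x) + ln N * free_length \<tau>2 x) / (x * ln m2)"

lemma free_length_nonneg: "0 \<le> y \<Longrightarrow> 0 \<le> free_length \<tau> y"
  by (auto simp: free_length_def)

lemma free_length_scale:
  "real n * free_length \<tau> y = y * n - min (\<tau> * n) (max 0 (y * n - n))"
proof -
  have "real n * min \<tau> (max 0 (y - 1)) = min (\<tau> * n) (max 0 (y * n - n))"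
    by (simp add: min_mult_distrib_left max_mult_distrib_left algebra_simps)
  then show ?thesis by (simp add: free_length_def algebra_simps)
qed

lemma free_digit_count:
  "real (card ({..<l} - {n..<n + p})) = real l - min (real p) (max 0 (real l - real n))"
proof -
  have "{..<l} \<inter> {n..<n + p} = {n..<min l (n + p)}" by auto
  then have "card ({..<l} - {n..<n + p}) = l - (min l (n + p) - n)"
    by (simp add: card_Diff_subset_Int)
  then show ?thesis by (auto simp: min_def max_def)
qed

lemma free_digit_count_le:
  fixes l n p :: nat and y \<tau> c :: real
  assumes "real l \<le> y * n" "y * n - c \<le> real l" "\<tau> * n - 1 \<le> real p" "0 \<le> c"
  shows "real (card ({..<l} - {n..<n + p})) \<le> n * free_length \<tau> y + c + 1"
proof -
  define Y T where "Y = y * n" and "T = \<tau> * n"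
  show ?thesis
    using assms unfolding free_digit_count free_length_scale Y_def[symmetric] T_def[symmetric]
    by (auto simp: min_def max_def)
qed

context carpet
begin

lemma log_ratio_ge_1: "1 \<le> log m1 m2"
  using m1_ge_2 m1_le_m2 by simp

text \<open>A side \<open>m2\<^sup>-\<^sup>k\<close> is reached by the columns after \<open>k log\<^bsub>m1\<^esub> m2\<close> digits.\<close>

lemma column_level:
  fixes k :: nat
  defines "l \<equiv> nat \<lfloor>log m1 m2 * k\<rfloor>"
  shows "k \<le> l" and "log m1 m2 * k - 1 \<le> l" and "real l \<le> log m1 m2 * k"
    and "m1 ^ l \<le> m2 ^ k" and "m2 ^ k \<le> m1 * m1 ^ l"
proof -
  have m: "1 < real m1" "0 < real m2" using m1_ge_2 m1_le_m2 by auto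
  have L0: "0 \<le> log m1 m2 * k" using log_ratio_ge_1 by simp
  show lo: "log m1 m2 * k - 1 \<le> l" and up: "real l \<le> log m1 m2 * k"
    using L0 by (auto simp: l_def)
  have "int k \<le> \<lfloor>log m1 m2 * k\<rfloor>"
    using log_ratio_ge_1 mult_right_mono[of 1 "log m1 m2" "real k"] by (simp add: le_floor_iff)
  then show "k \<le> l" by (simp add: l_def)
  have m2k: "real m2 ^ k = real m1 powr (log m1 m2 * k)"
    using m by (simp add: powr_powr[symmetric] powr_realpow)
  have "real m1 ^ l = real m1 powr l" using m by (simp add: powr_realpow)
  also have "\<dots> \<le> real m2 ^ k" unfolding m2k using m up by simp
  finally show "m1 ^ l \<le> m2 ^ k" by (metis of_nat_le_iff of_nat_power)
  have "real m2 ^ k \<le> real m1 powr (real (Suc l))" unfolding m2k using m lo by simp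
  also have "\<dots> = real m1 ^ Suc l" using m by (subst powr_realpow) auto
  finally show "m2 ^ k \<le> m1 * m1 ^ l" by (metis of_nat_le_iff of_nat_power power_Suc)
qed

end

locale uniform_carpet = carpet +
  fixes M N :: nat
  assumes card_columns: "card (fst ` A) = M"
    and card_column: "a \<in> fst ` A \<Longrightarrow> card {b. (a, b) \<in> A} = N"
    and N_pos: "1 \<le> N"
begin

lemma finite_columns: "finite (fst ` A)"
  using finite_subset[OF digits] by simp

lemma M_pos: "1 \<le> M"
  using finite_columns A_nonempty card_columns[symmetric] by (simp add: Suc_le_eq card_gt_0_iff)

text \<open>The rows of a column are numbered by \<open>{..<N}\<close>, so that a digit pair is given by a column and a
  number whose range is the same for all columns.\<close>
definition row :: "nat \<Rightarrow> nat \<Rightarrow> nat" where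
  "row a = (SOME h. bij_betw h {..<N} {b. (a, b) \<in> A})"

definition rank :: "nat \<Rightarrow> nat \<Rightarrow> nat" where
  "rank a = inv_into {..<N} (row a)"

lemma row_bij: assumes "a \<in> fst ` A" shows "bij_betw (row a) {..<N} {b. (a, b) \<in> A}"
proof -
  have "finite {b. (a, b) \<in> A}"
    using card_column[OF assms] N_pos by (metis card.infinite not_one_le_zero)
  then have "\<exists>h. bij_betw h {..<N} {b. (a, b) \<in> A}"
    using card_column[OF assms] by (intro finite_same_card_bij) auto
  then show ?thesis unfolding row_def by (rule someI_ex)
qed

lemma row_digit: "a \<in> fst ` A \<Longrightarrow> i < N \<Longrightarrow> (a, row a i) \<in> A"
  using bij_betwE[OF row_bij] by blast

lemma row_inj: "a \<in> fst ` A \<Longrightarrow> i < N \<Longrightarrow> j < N \<Longrightarrow> row a i = row a j \<Longrightarrow> i = j"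
  using row_bij[of a] by (auto simp: bij_betw_def inj_on_def)

lemma column_of: "p \<in> A \<Longrightarrow> fst p \<in> fst ` A"
  by blast

lemma row_image: "p \<in> A \<Longrightarrow> snd p \<in> row (fst p) ` {..<N}"
  using bij_betw_imp_surj_on[OF row_bij[OF column_of]] by (metis mem_Collect_eq prod.collapse)

lemma rank_less: "p \<in> A \<Longrightarrow> rank (fst p) (snd p) < N"
  unfolding rank_def using inv_into_into[OF row_image] by blast

lemma row_rank: "p \<in> A \<Longrightarrow> row (fst p) (rank (fst p) (snd p)) = snd p"
  unfolding rank_def by (rule f_inv_into_f[OF row_image])

text \<open>All data needed to recover the first \<open>l\<close> columns and the first \<open>k\<close> rows of a sequence that nearly
  returns at time \<open>n\<close>: the digits outside the blocks of length \<open>l1\<close> and \<open>l2\<close> after \<open>n\<close>, and one of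
  finitely many possibilities for either block.\<close>

definition return_code :: "nat \<Rightarrow> nat \<Rightarrow> nat \<Rightarrow> nat \<Rightarrow> nat \<Rightarrow> (nat \<Rightarrow> nat \<times> nat) \<Rightarrow>
    (nat \<Rightarrow> nat) \<times> (nat \<Rightarrow> nat) \<times> int \<times> int" where
  "return_code l1 l2 l k n z =
    (restrict (\<lambda>j. fst (z j)) ({..<l} - {n..<n + l1}),
     restrict (\<lambda>j. rank (fst (z j)) (snd (z j))) ({..<k} - {n..<n + l2}),
     int (digit_prefix m1 (\<lambda>j. fst (z (j + n))) l1)
       - \<lfloor>real (digit_prefix m1 (\<lambda>j. fst (z j)) n) * real m1 ^ l1 / (real m1 ^ n - 1)\<rfloor>,
     int (digit_prefix m2 (\<lambda>j. snd (z (j + n))) l2)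
       - \<lfloor>real (digit_prefix m2 (\<lambda>j. snd (z j)) n) * real m2 ^ l2 / (real m2 ^ n - 1)\<rfloor>)"

definition return_codes :: "nat \<Rightarrow> nat \<Rightarrow> nat \<Rightarrow> nat \<Rightarrow> nat \<Rightarrow>
    ((nat \<Rightarrow> nat) \<times> (nat \<Rightarrow> nat) \<times> int \<times> int) set" where
  "return_codes l1 l2 l k n =
     (({..<l} - {n..<n + l1}) \<rightarrow>\<^sub>E fst ` A) \<times> (({..<k} - {n..<n + l2}) \<rightarrow>\<^sub>E {..<N}) \<times> {-3..3} \<times> {-3..3}"

lemma return_code_mem:
  assumes "\<And>j. z j \<in> A" "0 < n" "near_return l1 l2 n z"
  shows "return_code l1 l2 l k n z \<in> return_codes l1 l2 l k n"
  unfolding return_code_def return_codes_def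
  using assms(3) unfolding near_return_def
  by (intro SigmaI restrict_PiE_iff[THEN iffD2] ballI b1.recurrent_block_choices b2.recurrent_block_choices assms(2))
    (auto intro: fst_digit snd_digit rank_less column_of assms(1) simp: lessThan_iff)

lemma card_return_codes:
  "finite (return_codes l1 l2 l k n)"
  "card (return_codes l1 l2 l k n)
    = 49 * M ^ card ({..<l} - {n..<n + l1}) * N ^ card ({..<k} - {n..<n + l2})"
  unfolding return_codes_def
  by (auto simp: finite_columns card_cartesian_product card_PiE card_columns finite_PiE)

text \<open>The first \<open>n\<close> columns are among the free ones, so they give the base point of the column block and then all
  columns up to \<open>l\<close>. As \<open>k \<le> l\<close>, the ranks can then be turned into rows, first up to \<open>n\<close> and then, with the
  base point of the row block, up to \<open>k\<close>.\<close>
lemma return_code_determines: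
  assumes z: "\<And>j. z j \<in> A" and w: "\<And>j. w j \<in> A" and kl: "k \<le> l"
    and eq: "return_code l1 l2 l k n z = return_code l1 l2 l k n w"
  shows "j < l \<Longrightarrow> fst (z j) = fst (w j)" and "j < k \<Longrightarrow> snd (z j) = snd (w j)"
proof -
  from eq have eqs: "restrict (\<lambda>j. fst (z j)) ({..<l} - {n..<n + l1}) = restrict (\<lambda>j. fst (w j)) ({..<l} - {n..<n + l1})"
    "restrict (\<lambda>j. rank (fst (z j)) (snd (z j))) ({..<k} - {n..<n + l2})
      = restrict (\<lambda>j. rank (fst (w j)) (snd (w j))) ({..<k} - {n..<n + l2})"
    "int (digit_prefix m1 (\<lambda>j. fst (z (j + n))) l1)
       - \<lfloor>real (digit_prefix m1 (\<lambda>j. fst (z j)) n) * real m1 ^ l1 / (real m1 ^ n - 1)\<rfloor>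
     = int (digit_prefix m1 (\<lambda>j. fst (w (j + n))) l1)
       - \<lfloor>real (digit_prefix m1 (\<lambda>j. fst (w j)) n) * real m1 ^ l1 / (real m1 ^ n - 1)\<rfloor>"
    "int (digit_prefix m2 (\<lambda>j. snd (z (j + n))) l2)
       - \<lfloor>real (digit_prefix m2 (\<lambda>j. snd (z j)) n) * real m2 ^ l2 / (real m2 ^ n - 1)\<rfloor>
     = int (digit_prefix m2 (\<lambda>j. snd (w (j + n))) l2)
       - \<lfloor>real (digit_prefix m2 (\<lambda>j. snd (w j)) n) * real m2 ^ l2 / (real m2 ^ n - 1)\<rfloor>"
    unfolding return_code_def by auto
  have a_free: "fst (z j) = fst (w j)" if "j < l" "j \<notin> {n..<n + l1}" for j
    using fun_cong[OF eqs(1), of j] that by simp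
  have a: "fst (z j) = fst (w j)" if "j < l" for j
  proof (cases "j \<in> {n..<n + l1}")
    case True
    then have "digit_prefix m1 (\<lambda>j. fst (z j)) n = digit_prefix m1 (\<lambda>j. fst (w j)) n"
      using that by (intro b1.digit_prefix_cong a_free) auto
    then have "digit_prefix m1 (\<lambda>j. fst (z (j + n))) l1 = digit_prefix m1 (\<lambda>j. fst (w (j + n))) l1"
      using eqs(3) by simp
    from b1.digit_prefix_inj[OF fst_digit[OF z] fst_digit[OF w] this, of "j - n"]
    show ?thesis using True by auto
  qed (rule a_free[OF that])
  have b_free: "snd (z j) = snd (w j)" if "j < k" "j \<notin> {n..<n + l2}" for j
  proof -
    have "rank (fst (z j)) (snd (z j)) = rank (fst (w j)) (snd (w j))"
      using fun_cong[OF eqs(2), of j] that by simp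
    moreover have "fst (z j) = fst (w j)" using a that kl by simp
    ultimately show ?thesis using row_rank[OF z[of j]] row_rank[OF w[of j]] by metis
  qed
  have b: "snd (z j) = snd (w j)" if "j < k" for j
  proof (cases "j \<in> {n..<n + l2}")
    case True
    then have "digit_prefix m2 (\<lambda>j. snd (z j)) n = digit_prefix m2 (\<lambda>j. snd (w j)) n"
      using that by (intro b2.digit_prefix_cong b_free) auto
    then have "digit_prefix m2 (\<lambda>j. snd (z (j + n))) l2 = digit_prefix m2 (\<lambda>j. snd (w (j + n))) l2"
      using eqs(4) by simp
    from b2.digit_prefix_inj[OF snd_digit[OF z] snd_digit[OF w] this, of "j - n"]
    show ?thesis using True by auto
  qed (rule b_free[OF that])
  show "j < l \<Longrightarrow> fst (z j) = fst (w j)" "j < k \<Longrightarrow> snd (z j) = snd (w j)" by (fact a, fact b)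
qed

lemma carpet_rate_nonneg: "0 < x \<Longrightarrow> 0 \<le> carpet_rate m1 m2 M N \<tau>1 \<tau>2 x"
  unfolding carpet_rate_def using M_pos N_pos log_ratio_ge_1 b2.base_ge_2
  by (intro divide_nonneg_nonneg add_nonneg_nonneg mult_nonneg_nonneg free_length_nonneg ln_ge_zero) auto

text \<open>For \<open>x n\<close> rows and \<open>log\<^bsub>m1\<^esub> m2 * x * n\<close> columns there are at most a constant times \<open>m2\<^sup>x\<^sup>n\<^sup>R\<close>
  codes, where \<open>R\<close> is the rate at \<open>x\<close>. With exponent \<open>R + e\<close> the weights decay like
  \<open>m2\<^sup>-\<^sup>e\<^sup>x\<^sup>n\<close> and can be summed over \<open>n\<close>.\<close>
lemma hausdorff_dim_le_carpet_rate:
  fixes \<tau>1 \<tau>2 :: real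
  assumes K: "is_carpet m1 m2 A K" and x: "0 < x" and \<tau>: "0 \<le> \<tau>1" "0 \<le> \<tau>2"
    and c1: "\<tau>1 = 0 \<or> (\<psi> \<longlonglongrightarrow> 0 \<and> (\<forall>\<^sub>F n in sequentially. \<psi> n \<le> 1 / real m1 ^ nat \<lfloor>\<tau>1 * n\<rfloor>))"
    and c2: "\<tau>2 = 0 \<or> ((\<lambda>n. \<psi> n powr \<gamma>) \<longlonglongrightarrow> 0 \<and>
        (\<forall>\<^sub>F n in sequentially. \<psi> n powr \<gamma> \<le> 1 / real m2 ^ nat \<lfloor>\<tau>2 * n\<rfloor>))"
  shows "hausdorff_dim (recurrence_set m1 m2 A K \<gamma> \<psi>) \<le> ereal (carpet_rate m1 m2 M N \<tau>1 \<tau>2 x)"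
proof (rule ereal_le_epsilon2)
  fix e :: real assume e: "0 < e"
  define R where "R = carpet_rate m1 m2 M N \<tau>1 \<tau>2 x"
  define s where "s = R + e"
  define W where "W = recurrence_set m1 m2 A K \<gamma> \<psi>"
  define L where "L = log m1 m2"
  have L: "1 \<le> L" using log_ratio_ge_1 by (simp add: L_def)
  have s: "0 < s" using carpet_rate_nonneg[OF x] e by (auto simp: s_def R_def intro: add_nonneg_pos)
  define l1 l2 k l where "l1 n = nat \<lfloor>\<tau>1 * n\<rfloor>" and "l2 n = nat \<lfloor>\<tau>2 * n\<rfloor>"
    and "k n = nat \<lfloor>x * n\<rfloor>" and "l n = nat \<lfloor>L * k n\<rfloor>" for n :: nat
  note level = column_level[of "k n" for n, folded L_def, folded l_def]
  define F where "F n = card ({..<l n} - {n..<n + l1 n})" for n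
  define G where "G n = card ({..<k n} - {n..<n + l2 n})" for n
  define is_code where "is_code y z \<longleftrightarrow>
      (\<forall>j. z j \<in> A) \<and> y = carpet_point m1 m2 z \<and> (\<exists>\<^sub>\<infinity>n. near_return (l1 n) (l2 n) n z)" for y z
  define Z where "Z y = (SOME z. is_code y z)" for y
  have ex_code: "\<exists>z. is_code y z" if "y \<in> W" for y
    unfolding is_code_def
    by (rule recurrence_set_codes[OF K that[unfolded W_def]])
      (use c1 c2 in \<open>auto simp: l1_def l2_def\<close>)
  have code: "is_code y (Z y)" if "y \<in> W" for y
    using someI_ex[OF ex_code[OF that]] unfolding Z_def .
  note code = code[unfolded is_code_def]
  note Z = code[THEN conjunct1] code[THEN conjunct2, THEN conjunct1, symmetric]
    code[THEN conjunct2, THEN conjunct2]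
  define E where "E n = {y \<in> W. 0 < n \<and> near_return (l1 n) (l2 n) n (Z y)}" for n
  define r where "r n = (real m1 + 1) / real m2 ^ k n" for n
  have m: "0 < real m1" "1 < real m2" using m1_ge_2 m1_le_m2 by auto
  have k_bounds: "real (k n) \<le> x * n" "x * n - 1 \<le> real (k n)" for n
    using x by (auto simp: k_def)
  have r_le: "1 / real m1 ^ l n + 1 / real m2 ^ k n \<le> r n" for n
  proof -
    have "real m2 ^ k n \<le> real m1 * real m1 ^ l n"
      using level(5)[of n] by (metis of_nat_le_iff of_nat_mult of_nat_power)
    then have "1 / real m1 ^ l n \<le> real m1 / real m2 ^ k n" using m by (simp add: field_simps)
    then show ?thesis by (simp add: r_def add_divide_distrib)
  qed
  \<comment> \<open>The constant collects what rounding to integer lengths costs in the exponent, and the factor in \<open>r\<close>.\<close>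
  define c where "c = (L + 2) * ln M + 2 * ln N + s * ln (m1 + 1) + s * ln m2"
  have term_bound: "real (card (return_codes (l1 n) (l2 n) (l n) (k n) n)) * r n powr s
      \<le> 49 * exp c * exp (- (x * ln m2 * e)) ^ n" for n
  proof -
    have "L * real (k n) \<le> L * (x * n)" "L * (x * n - 1) \<le> L * real (k n)"
      using k_bounds[of n] L by (auto intro!: mult_left_mono)
    then have lb: "real (l n) \<le> (L * x) * n" "(L * x) * n - (L + 1) \<le> real (l n)"
      using level(2,3)[of n] by (auto simp: algebra_simps)
    have p1: "\<tau>1 * n - 1 \<le> real (l1 n)" and p2: "\<tau>2 * n - 1 \<le> real (l2 n)"
      unfolding l1_def l2_def by linarith+
    have F: "real (F n) \<le> n * free_length \<tau>1 (L * x) + (L + 1) + 1"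
      unfolding F_def by (rule free_digit_count_le) (use lb p1 L in auto)
    have G: "real (G n) \<le> n * free_length \<tau>2 x + 1 + 1"
      unfolding G_def by (rule free_digit_count_le) (use k_bounds p2 in auto)
    have "real (F n) * ln M \<le> (n * free_length \<tau>1 (L * x) + (L + 1) + 1) * ln M"
      using F M_pos by (intro mult_right_mono) auto
    moreover have "real (G n) * ln N \<le> (n * free_length \<tau>2 x + 1 + 1) * ln N"
      using G N_pos by (intro mult_right_mono) auto
    moreover have "(x * n - 1) * (s * ln m2) \<le> real (k n) * (s * ln m2)"
      using k_bounds s m by (intro mult_right_mono) auto
    moreover have "ln M * free_length \<tau>1 (L * x) + ln N * free_length \<tau>2 x = R * (x * ln m2)"
      using x m by (simp add: R_def carpet_rate_def L_def)
    then have "n * (ln M * free_length \<tau>1 (L * x) + ln N * free_length \<tau>2 x) = n * (R * (x * ln m2))" by simp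
    ultimately have ex: "real (F n) * ln M + real (G n) * ln N + s * ln (m1 + 1) - real (k n) * (s * ln m2)
        \<le> c + n * (- (x * ln m2 * e))"
      unfolding c_def s_def by (simp add: algebra_simps)
    have "r n powr s = exp (s * ln (m1 + 1) - real (k n) * (s * ln m2))"
      using m by (simp add: r_def powr_def ln_div ln_realpow algebra_simps)
    moreover have "real M ^ F n = exp (real (F n) * ln M)" "real N ^ G n = exp (real (G n) * ln N)"
      using M_pos N_pos by (simp_all add: exp_of_nat_mult)
    ultimately have "real (card (return_codes (l1 n) (l2 n) (l n) (k n) n)) * r n powr s
      = 49 * exp (real (F n) * ln M + real (G n) * ln N + s * ln (m1 + 1) - real (k n) * (s * ln m2))"
      unfolding card_return_codes(2) F_def[symmetric] G_def[symmetric]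
      by (simp add: exp_add exp_diff)
    also have "\<dots> \<le> 49 * exp (c + n * (- (x * ln m2 * e)))" using ex by simp
    also have "\<dots> = 49 * exp c * exp (- (x * ln m2 * e)) ^ n"
      by (simp only: exp_add exp_of_nat_mult mult.assoc)
    finally show ?thesis .
  qed
  have "hausdorff_dim W \<le> ereal s"
  proof (rule hausdorff_dim_le_limsup_cover[where E = E and r = r
        and I = "\<lambda>n. return_codes (l1 n) (l2 n) (l n) (k n) n"
        and code = "\<lambda>n y. return_code (l1 n) (l2 n) (l n) (k n) n (Z y)"])
    fix y assume y: "y \<in> W"
    have "\<exists>\<^sub>\<infinity>n. 0 < n \<and> near_return (l1 n) (l2 n) n (Z y)"
      using Z(3)[OF y] by (rule frequently_rev_mp)
        (simp add: cofinite_eq_sequentially eventually_sequentially, rule exI[of _ 1], simp)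
    then show "\<exists>\<^sub>\<infinity>n. y \<in> E n" using y by (simp add: E_def)
  next
    fix n show "finite (return_codes (l1 n) (l2 n) (l n) (k n) n)" by (rule card_return_codes)
  next
    fix n y assume "y \<in> E n"
    then show "return_code (l1 n) (l2 n) (l n) (k n) n (Z y) \<in> return_codes (l1 n) (l2 n) (l n) (k n) n"
      by (intro return_code_mem) (auto simp: E_def dest: Z(1))
  next
    fix n y y'
    assume y: "y \<in> E n" "y' \<in> E n" and
      eq: "return_code (l1 n) (l2 n) (l n) (k n) n (Z y) = return_code (l1 n) (l2 n) (l n) (k n) n (Z y')"
    have W: "y \<in> W" "y' \<in> W" using y by (auto simp: E_def)
    note agree = return_code_determines[OF Z(1)[OF W(1), rule_format] Z(1)[OF W(2), rule_format] level(1) eq]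
    have "dist (carpet_point m1 m2 (Z y)) (carpet_point m1 m2 (Z y')) \<le> 1 / real m1 ^ l n + 1 / real m2 ^ k n"
      by (rule carpet_point_dist[OF Z(1)[OF W(1), rule_format] Z(1)[OF W(2), rule_format]]) (use agree in auto)
    then show "dist y y' \<le> r n" using r_le[of n] Z(2)[OF W(1)] Z(2)[OF W(2)] by simp
  next
    have k_top: "filterlim k at_top sequentially"
      unfolding k_def using x by real_asymp
    have "(\<lambda>j. (real m1 + 1) / real m2 ^ j) \<longlonglongrightarrow> 0" using m(2) by real_asymp
    from filterlim_compose[OF this k_top] show "r \<longlonglongrightarrow> 0" unfolding r_def[abs_def] .
  next
    fix n show "0 \<le> r n" using m by (simp add: r_def)
  next
    have "0 < x * ln m2 * e" using x m e by simp
    then have "summable (\<lambda>n. 49 * exp c * exp (- (x * ln m2 * e)) ^ n)"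
      by (intro summable_mult summable_geometric) simp
    then show "summable (\<lambda>n. real (card (return_codes (l1 n) (l2 n) (l n) (k n) n)) * r n powr s)"
      by (rule summable_comparison_test'[where N = 0]) (use term_bound in auto)
  qed (rule s)
  then show "hausdorff_dim (recurrence_set m1 m2 A K \<gamma> \<psi>)
      \<le> ereal (carpet_rate m1 m2 M N \<tau>1 \<tau>2 x) + ereal e"
    by (simp add: W_def s_def R_def)
qed

end

section \<open>A random point with prescribed returns\<close>

text \<open>Position \<open>j\<close> of block \<open>i\<close>, which has length \<open>p i\<close> and starts at \<open>t i\<close>, repeats the
  digit \<open>t i\<close> places earlier. Following these references backwards ends outside all blocks.\<close>

definition in_block :: "(nat \<Rightarrow> nat) \<Rightarrow> (nat \<Rightarrow> nat) \<Rightarrow> nat \<Rightarrow> nat \<Rightarrow> bool" where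
  "in_block t p i j \<longleftrightarrow> t i \<le> j \<and> j < t i + p i"

definition copy_source :: "(nat \<Rightarrow> nat) \<Rightarrow> (nat \<Rightarrow> nat) \<Rightarrow> nat \<Rightarrow> nat" where
  "copy_source t p j = (if \<exists>i. in_block t p i j then j - t (SOME i. in_block t p i j) else j)"

function copy_root :: "(nat \<Rightarrow> nat) \<Rightarrow> nat \<Rightarrow> nat" where
  "copy_root s j = (if s j < j then copy_root s (s j) else j)"
  by auto
termination by (relation "Wellfounded.measure snd") auto

declare copy_root.simps [simp del]

text \<open>Positions 0 and 1 are excluded because their digits will be fixed.\<close>

definition free_positions :: "(nat \<Rightarrow> nat) \<Rightarrow> (nat \<Rightarrow> nat) \<Rightarrow> nat set" where
  "free_positions t p = {j. 2 \<le> j \<and> (\<forall>i. \<not> in_block t p i j)}"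

lemma copy_root_free: "j \<in> free_positions t p \<Longrightarrow> copy_root (copy_source t p) j = j"
  by (subst copy_root.simps) (simp add: free_positions_def copy_source_def)

text \<open>Return times so sparse that everything up to the end of one block is negligible
  when the next block starts.\<close>

locale sparse_blocks =
  fixes t p q :: "nat \<Rightarrow> nat"
  assumes start: "2 \<le> t 0" and lengths: "\<And>i. 2 \<le> q i" "\<And>i. q i \<le> p i"
    and sparse: "\<And>i. Suc i * (t i + p i + 2) \<le> t (Suc i)"
begin

lemma block_end: "t i + p i + 2 \<le> t (Suc i)"
  using sparse[of i] by (simp add: add_leE)

lemma t_less: "i < i' \<Longrightarrow> t i + p i + 2 \<le> t i'"
proof (induction i')
  case (Suc i')
  then show ?case using block_end[of i'] by (cases "i = i'") auto
qed simp

lemma t_ge_2: "2 \<le> t i"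
  using start t_less[of 0 i] by (cases "i = 0") auto

lemma t_strict_mono: "strict_mono t"
proof (rule strict_mono_Suc_iff[THEN iffD2], rule allI)
  fix i show "t i < t (Suc i)" using block_end[of i] by simp
qed

lemma block_unique:
  assumes "in_block t r i j" "in_block t r i' j" "\<And>i. r i \<le> p i"
  shows "i = i'"
  using assms(1,2) t_less[of i i'] t_less[of i' i] assms(3)[of i] assms(3)[of i']
  unfolding in_block_def by (metis add_leD1 add_le_cancel_left leD le_trans less_le_trans linorder_neqE_nat)

lemma copy_root_block:
  assumes "j < r i" "\<And>i. r i \<le> p i"
  shows "copy_root (copy_source t r) (j + t i) = copy_root (copy_source t r) j"
proof -
  have blk: "in_block t r i (j + t i)" using assms(1) by (simp add: in_block_def)
  then have "(SOME i'. in_block t r i' (j + t i)) = i"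
    by (rule some_equality) (use block_unique[OF blk _ assms(2)] in auto)
  then have "copy_source t r (j + t i) = j" using blk by (auto simp: copy_source_def)
  then show ?thesis using t_ge_2[of i] by (subst copy_root.simps) simp
qed

lemma copy_root_01:
  assumes "j < 2"
  shows "copy_root (copy_source t r) j = j"
proof -
  have "\<not> in_block t r i j" for i using t_ge_2[of i] assms by (simp add: in_block_def)
  then have "copy_source t r j = j" by (simp add: copy_source_def)
  then show ?thesis by (subst copy_root.simps) simp
qed

text \<open>Below the start of the next block, a position that is not free lies in the current block or before the end of
  the previous one.\<close>
lemma free_count_ge:
  fixes l :: nat
  assumes "l \<le> t (Suc (Suc i))" "\<And>i. r i \<le> p i"
  shows "real l - min (real (r (Suc i))) (max 0 (real l - real (t (Suc i)))) - real (t i + p i + 2)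
    \<le> real (card (free_positions t r \<inter> {..<l}))"
proof -
  have "{..<l} \<subseteq> (free_positions t r \<inter> {..<l}) \<union> {..<t i + p i + 2}
      \<union> {t (Suc i)..<min l (t (Suc i) + r (Suc i))}"
  proof (intro subsetI, rule ccontr)
    fix j assume j: "j \<in> {..<l}" and nj: "j \<notin> (free_positions t r \<inter> {..<l}) \<union> {..<t i + p i + 2}
      \<union> {t (Suc i)..<min l (t (Suc i) + r (Suc i))}"
    then obtain i' where i': "in_block t r i' j" by (auto simp: free_positions_def)
    have "i' \<noteq> Suc i" using i' nj j by (auto simp: in_block_def)
    moreover have False if "i' \<le> i"
    proof -
      have "t i' + p i' \<le> t i + p i" using that t_less[of i' i] by (cases "i' = i") auto
      then show False using i' nj assms(2)[of i'] by (auto simp: in_block_def)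
    qed
    moreover have False if "Suc (Suc i) \<le> i'"
    proof -
      have "t (Suc (Suc i)) \<le> t i'" using t_less[of "Suc (Suc i)" i'] that by (cases "i' = Suc (Suc i)") auto
      then show False using i' j assms(1) by (auto simp: in_block_def)
    qed
    ultimately show False by linarith
  qed
  then have "card {..<l} \<le> card ((free_positions t r \<inter> {..<l}) \<union> {..<t i + p i + 2}
      \<union> {t (Suc i)..<min l (t (Suc i) + r (Suc i))})"
    by (intro card_mono) auto
  also have "\<dots> \<le> card (free_positions t r \<inter> {..<l}) + card {..<t i + p i + 2}
      + card {t (Suc i)..<min l (t (Suc i) + r (Suc i))}"
    by (meson add_le_mono1 card_Un_le le_trans)
  finally have "l \<le> card (free_positions t r \<inter> {..<l}) + (t i + p i + 2)
      + (min l (t (Suc i) + r (Suc i)) - t (Suc i))" by simp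
  then show ?thesis by (auto simp: min_def max_def split: if_splits)
qed

end

context uniform_carpet
begin

definition choices :: "(nat \<times> nat) set" where
  "choices = fst ` A \<times> {..<N}"

text \<open>Columns and rows have separate references because the row block may be shorter than the column block: behind
  the row block, a repeated column is combined with a new row. Inside the row block both references go back by the same
  amount, so whole digit pairs are repeated. The choices at positions 0 and 1 are the constants \<open>c\<close>.\<close>
definition random_word :: "(nat \<Rightarrow> nat) \<Rightarrow> (nat \<Rightarrow> nat) \<Rightarrow> (nat \<Rightarrow> nat) \<Rightarrow> (nat \<Rightarrow> nat \<times> nat) \<Rightarrow>
    (nat \<Rightarrow> nat \<times> nat) \<Rightarrow> nat \<Rightarrow> nat \<times> nat" where
  "random_word t p q c \<omega> j =
    (let \<omega>' = (\<lambda>i. if i < 2 then c i else \<omega> i);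
         a = fst (\<omega>' (copy_root (copy_source t p) j))
     in (a, row a (snd (\<omega>' (copy_root (copy_source t q) j)))))"

lemma random_word_digit:
  assumes "\<And>j. c j \<in> choices" "\<And>j. \<omega> j \<in> choices"
  shows "random_word t p q c \<omega> j \<in> A"
proof -
  define \<omega>' where "\<omega>' = (\<lambda>i::nat. if i < 2 then c i else \<omega> i)"
  have "\<omega>' i \<in> choices" for i using assms by (simp add: \<omega>'_def)
  then have "fst (\<omega>' i) \<in> fst ` A" "snd (\<omega>' i) < N" for i by (auto simp: choices_def mem_Times_iff)
  then show ?thesis unfolding random_word_def Let_def \<omega>'_def[symmetric] by (intro row_digit)
qed

lemma random_word_fixed:
  assumes "sparse_blocks t p q" "j < 2"
  shows "random_word t p q c \<omega> j = (fst (c j), row (fst (c j)) (snd (c j)))"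
  using sparse_blocks.copy_root_01[OF assms] assms(2) by (simp add: random_word_def Let_def)

lemma random_word_copy:
  assumes b: "sparse_blocks t p q"
  shows "j < p i \<Longrightarrow> fst (random_word t p q c \<omega> (j + t i)) = fst (random_word t p q c \<omega> j)"
    and "j < q i \<Longrightarrow> random_word t p q c \<omega> (j + t i) = random_word t p q c \<omega> j"
proof -
  note r = sparse_blocks.copy_root_block[OF b]
  have qp: "\<And>i. q i \<le> p i" using b by (simp add: sparse_blocks_def)
  have p: "copy_root (copy_source t p) (j + t i) = copy_root (copy_source t p) j" if "j < p i"
    by (rule r) (use that in auto)
  have q: "copy_root (copy_source t q) (j + t i) = copy_root (copy_source t q) j" if "j < q i"
    by (rule r) (use that qp in auto)
  show "j < p i \<Longrightarrow> fst (random_word t p q c \<omega> (j + t i)) = fst (random_word t p q c \<omega> j)"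
    using p by (simp add: random_word_def Let_def)
  show "j < q i \<Longrightarrow> random_word t p q c \<omega> (j + t i) = random_word t p q c \<omega> j"
    using p q less_le_trans[OF _ qp] by (simp add: random_word_def Let_def)
qed

lemma random_word_free:
  assumes c: "\<And>j. c j \<in> choices" and \<omega>: "\<And>j. \<omega> j \<in> choices" "\<And>j. \<omega>' j \<in> choices"
    and col: "fst (random_word t p q c \<omega> j) = fst (random_word t p q c \<omega>' j)"
  shows "j \<in> free_positions t p \<Longrightarrow> fst (\<omega> j) = fst (\<omega>' j)"
    and "j \<in> free_positions t q \<Longrightarrow> snd (random_word t p q c \<omega> j) = snd (random_word t p q c \<omega>' j)
      \<Longrightarrow> snd (\<omega> j) = snd (\<omega>' j)"
proof -
  assume j: "j \<in> free_positions t p"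
  then have "2 \<le> j" by (simp add: free_positions_def)
  then show "fst (\<omega> j) = fst (\<omega>' j)" using col copy_root_free[OF j] by (simp add: random_word_def Let_def)
next
  assume j: "j \<in> free_positions t q"
    and row: "snd (random_word t p q c \<omega> j) = snd (random_word t p q c \<omega>' j)"
  have "2 \<le> j" using j by (simp add: free_positions_def)
  define a where "a = fst (random_word t p q c \<omega>' j)"
  have a: "a \<in> fst ` A" unfolding a_def by (intro column_of random_word_digit c \<omega>)
  have "row a (snd (\<omega> j)) = row a (snd (\<omega>' j))"
    using row col copy_root_free[OF j] \<open>2 \<le> j\<close> unfolding a_def by (simp add: random_word_def Let_def)
  moreover have "snd (\<omega> j) < N" "snd (\<omega>' j) < N" using \<omega>[of j] by (auto simp: choices_def mem_Times_iff)
  ultimately show "snd (\<omega> j) = snd (\<omega>' j)" using row_inj[OF a] by blast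
qed

definition choice_measure :: "(nat \<Rightarrow> nat \<times> nat) measure" where
  "choice_measure = (\<Pi>\<^sub>M j\<in>UNIV. uniform_count_measure choices)"

lemma finite_choices: "finite choices" and choices_nonempty: "choices \<noteq> {}"
  and card_choices: "card choices = M * N"
  using finite_columns A_nonempty N_pos card_columns
  by (auto simp: choices_def card_cartesian_product lessThan_empty_iff)

lemma product_choices: "product_prob_space (\<lambda>j::nat. uniform_count_measure choices)"
  by (intro product_prob_spaceI prob_space_uniform_count_measure finite_choices choices_nonempty)

lemma prob_choices: "prob_space choice_measure"
  unfolding choice_measure_def
  by (intro prob_space_PiM prob_space_uniform_count_measure finite_choices choices_nonempty)

lemma space_choices: "space choice_measure = {\<omega>. \<forall>j. \<omega> j \<in> choices}"
  by (auto simp: choice_measure_def space_PiM space_uniform_count_measure)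

text \<open>Fixing the columns at the positions in \<open>F\<close> and the row numbers at the positions in \<open>G\<close> are independent
  events of probability \<open>1 / M\<close> and \<open>1 / N\<close> each.\<close>
lemma choice_cylinder:
  assumes "\<omega>0 \<in> space choice_measure" and "k \<le> l"
  shows "\<exists>B\<in>sets choice_measure.
      {\<omega>\<in>space choice_measure. (\<forall>j\<in>F. j < l \<longrightarrow> fst (\<omega> j) = fst (\<omega>0 j)) \<and>
          (\<forall>j\<in>G. j < k \<longrightarrow> snd (\<omega> j) = snd (\<omega>0 j))} \<subseteq> B \<and>
      measure choice_measure B = 1 / (M ^ card (F \<inter> {..<l}) * N ^ card (G \<inter> {..<k}))"
proof -
  interpret product_prob_space "\<lambda>j::nat. uniform_count_measure choices" UNIV
    by (rule product_choices)
  define X where "X j = (if j \<in> F then {fst (\<omega>0 j)} else fst ` A) \<times>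
      (if j \<in> G \<inter> {..<k} then {snd (\<omega>0 j)} else {..<N})" for j
  have \<omega>0: "fst (\<omega>0 j) \<in> fst ` A" "snd (\<omega>0 j) < N" for j
    using assms(1) by (auto simp: space_choices choices_def mem_Times_iff)
  have X: "X j \<subseteq> choices" for j
    using \<omega>0[of j] unfolding X_def choices_def by (intro Sigma_mono) auto
  define B where "B = prod_emb UNIV (\<lambda>j::nat. uniform_count_measure choices) {..<l} (\<Pi>\<^sub>E j\<in>{..<l}. X j)"
  have "B \<in> sets choice_measure"
    unfolding B_def choice_measure_def by (rule sets_PiM_I) (use X in \<open>auto simp: sets_uniform_count_measure\<close>)
  moreover have "{\<omega>\<in>space choice_measure. (\<forall>j\<in>F. j < l \<longrightarrow> fst (\<omega> j) = fst (\<omega>0 j)) \<and>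
          (\<forall>j\<in>G. j < k \<longrightarrow> snd (\<omega> j) = snd (\<omega>0 j))} \<subseteq> B"
  proof
    fix \<omega> assume "\<omega> \<in> {\<omega>\<in>space choice_measure. (\<forall>j\<in>F. j < l \<longrightarrow> fst (\<omega> j) = fst (\<omega>0 j)) \<and>
          (\<forall>j\<in>G. j < k \<longrightarrow> snd (\<omega> j) = snd (\<omega>0 j))}"
    then have \<omega>: "\<And>j. \<omega> j \<in> choices" "\<And>j. j \<in> F \<Longrightarrow> j < l \<Longrightarrow> fst (\<omega> j) = fst (\<omega>0 j)"
      "\<And>j. j \<in> G \<Longrightarrow> j < k \<Longrightarrow> snd (\<omega> j) = snd (\<omega>0 j)" by (auto simp: space_choices)
    have "\<omega> j \<in> X j" if "j < l" for j
      using \<omega>(1)[of j] \<omega>(2)[OF _ that] \<omega>(3)[of j] by (auto simp: X_def choices_def mem_Times_iff)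
    then show "\<omega> \<in> B"
      using \<omega>(1) by (auto simp: B_def prod_emb_iff space_uniform_count_measure PiE_iff)
  qed
  moreover have "measure choice_measure B = (\<Prod>j<l. measure (uniform_count_measure choices) (X j))"
    unfolding B_def choice_measure_def by (rule measure_PiM_emb) (use X in \<open>auto simp: sets_uniform_count_measure\<close>)
  moreover have "measure (uniform_count_measure choices) (X j)
      = (if j \<in> F then 1 / M else 1) * (if j \<in> G \<inter> {..<k} then 1 / N else 1)" for j
  proof -
    have "measure (uniform_count_measure choices) (X j) = card (X j) / card choices"
      by (rule measure_uniform_count_measure) (use X finite_choices in auto)
    then show ?thesis using M_pos N_pos
      by (auto simp: X_def card_choices card_cartesian_product card_columns)
  qed
  moreover have "(\<Prod>j<l. (if j \<in> F then 1 / real M else 1) * (if j \<in> G \<inter> {..<k} then 1 / real N else 1))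
      = 1 / (M ^ card (F \<inter> {..<l}) * N ^ card (G \<inter> {..<k}))"
  proof -
    have "{..<l} \<inter> (G \<inter> {..<k}) = G \<inter> {..<k}" using assms(2) by auto
    moreover have "(\<Prod>j<l. if j \<in> F then 1 / real M else 1) = (1 / real M) ^ card ({..<l} \<inter> F)"
      by (subst prod.inter_restrict[symmetric]) auto
    moreover have "(\<Prod>j<l. if j \<in> G \<inter> {..<k} then 1 / real N else 1) = (1 / real N) ^ card ({..<l} \<inter> (G \<inter> {..<k}))"
      by (subst prod.inter_restrict[symmetric]) auto
    ultimately show ?thesis by (simp add: prod.distrib power_one_over Int_commute)
  qed
  ultimately show ?thesis by (intro bexI[of _ B]) auto
qed

end

section \<open>The lower bound\<close>

context uniform_carpet
begin

text \<open>Points at distance at most \<open>m2\<^sup>-\<^sup>k\<close> have prefixes of \<open>l\<close> columns and of \<open>k\<close> rows that differ, as integers, by at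
  most 2. So a set of this diameter meets at most 25 approximate squares, and each of them determines the choices at
  the free positions.\<close>
lemma random_point_ball:
  assumes b: "sparse_blocks t p q" and c: "\<And>j. c j \<in> choices"
    and U: "\<And>x y. x \<in> U \<Longrightarrow> y \<in> U \<Longrightarrow> dist x y \<le> 1 / real m2 ^ k"
  defines "l \<equiv> nat \<lfloor>log m1 m2 * k\<rfloor>"
  shows "\<exists>B\<in>sets choice_measure.
      {\<omega>\<in>space choice_measure. carpet_point m1 m2 (random_word t p q c \<omega>) \<in> U} \<subseteq> B \<and>
      measure choice_measure B
        \<le> 25 / (M ^ card (free_positions t p \<inter> {..<l}) * N ^ card (free_positions t q \<inter> {..<k}))"
proof (cases "\<exists>\<omega>\<in>space choice_measure. carpet_point m1 m2 (random_word t p q c \<omega>) \<in> U")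
  case False
  then show ?thesis by (intro bexI[of _ "{}"]) auto
next
  case True
  then obtain \<omega>0 where \<omega>0: "\<omega>0 \<in> space choice_measure"
    "carpet_point m1 m2 (random_word t p q c \<omega>0) \<in> U" by blast
  interpret prob_space choice_measure by (rule prob_choices)
  define w where "w = random_word t p q c"
  define v where "v = 1 / (real M ^ card (free_positions t p \<inter> {..<l}) * real N ^ card (free_positions t q \<inter> {..<k}))"
  have v: "0 \<le> v" by (simp add: v_def)
  define IA where "IA \<omega> = int (digit_prefix m1 (\<lambda>j. fst (w \<omega> j)) l)" for \<omega>
  define IB where "IB \<omega> = int (digit_prefix m2 (\<lambda>j. snd (w \<omega> j)) k)" for \<omega>
  define S where "S i = {\<omega>\<in>space choice_measure. carpet_point m1 m2 (w \<omega>) \<in> U \<and>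
      IA \<omega> - IA \<omega>0 = fst i \<and> IB \<omega> - IB \<omega>0 = snd i}" for i
  have wA: "w \<omega> j \<in> A" if "\<omega> \<in> space choice_measure" for \<omega> j
    unfolding w_def by (rule random_word_digit) (use c that in \<open>auto simp: space_choices\<close>)
  have level: "k \<le> l" "m1 ^ l \<le> m2 ^ k" unfolding l_def by (rule column_level)+
  have near: "IA \<omega> - IA \<omega>0 \<in> {-2..2}" "IB \<omega> - IB \<omega>0 \<in> {-2..2}"
    if \<omega>: "\<omega> \<in> space choice_measure" "carpet_point m1 m2 (w \<omega>) \<in> U" for \<omega>
  proof -
    have d: "dist (carpet_point m1 m2 (w \<omega>)) (carpet_point m1 m2 (w \<omega>0)) \<le> 1 / real m2 ^ k"
      by (rule U) (use \<omega> \<omega>0 in \<open>auto simp: w_def\<close>)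
    have "real m1 ^ l \<le> real m2 ^ k" using level(2) by (metis of_nat_le_iff of_nat_power)
    then have "1 / real m2 ^ k \<le> 1 / real m1 ^ l"
      using b1.base_ge_2 b2.base_ge_2 by (intro divide_left_mono) auto
    then have d1: "\<bar>digit_val m1 (\<lambda>j. fst (w \<omega> j)) - digit_val m1 (\<lambda>j. fst (w \<omega>0 j))\<bar> \<le> 1 / real m1 ^ l"
      using d dist_fst_le[of "carpet_point m1 m2 (w \<omega>)" "carpet_point m1 m2 (w \<omega>0)"]
      by (simp add: carpet_point_def dist_real_def)
    have d2: "\<bar>digit_val m2 (\<lambda>j. snd (w \<omega> j)) - digit_val m2 (\<lambda>j. snd (w \<omega>0 j))\<bar> \<le> 1 / real m2 ^ k"
      using d dist_snd_le[of "carpet_point m1 m2 (w \<omega>)" "carpet_point m1 m2 (w \<omega>0)"]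
      by (simp add: carpet_point_def dist_real_def)
    have "\<bar>IA \<omega> - IA \<omega>0\<bar> \<le> 2" unfolding IA_def
      by (rule b1.digit_prefix_close[OF fst_digit[OF wA[OF \<omega>(1)]] fst_digit[OF wA[OF \<omega>0(1)]] d1])
    moreover have "\<bar>IB \<omega> - IB \<omega>0\<bar> \<le> 2" unfolding IB_def
      by (rule b2.digit_prefix_close[OF snd_digit[OF wA[OF \<omega>(1)]] snd_digit[OF wA[OF \<omega>0(1)]] d2])
    ultimately show "IA \<omega> - IA \<omega>0 \<in> {-2..2}" "IB \<omega> - IB \<omega>0 \<in> {-2..2}" by auto
  qed
  have "\<exists>B. B \<in> sets choice_measure \<and> S i \<subseteq> B \<and> prob B \<le> v" for i
  proof (cases "S i = {}")
    case True
    then show ?thesis using v by (intro exI[of _ "{}"]) auto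
  next
    case False
    then obtain \<omega>1 where \<omega>1: "\<omega>1 \<in> S i" by blast
    then have sp1: "\<omega>1 \<in> space choice_measure" by (simp add: S_def)
    from choice_cylinder[OF sp1 level(1), of "free_positions t p" "free_positions t q"]
    obtain B where B: "B \<in> sets choice_measure"
      "{\<omega>\<in>space choice_measure. (\<forall>j\<in>free_positions t p. j < l \<longrightarrow> fst (\<omega> j) = fst (\<omega>1 j)) \<and>
          (\<forall>j\<in>free_positions t q. j < k \<longrightarrow> snd (\<omega> j) = snd (\<omega>1 j))} \<subseteq> B"
      "prob B = v" unfolding v_def by (auto simp: of_nat_power of_nat_mult)
    have "S i \<subseteq> B"
    proof
      fix \<omega> assume \<omega>: "\<omega> \<in> S i"
      then have sp: "\<omega> \<in> space choice_measure" by (simp add: S_def)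
      have "digit_prefix m1 (\<lambda>j. fst (w \<omega> j)) l = digit_prefix m1 (\<lambda>j. fst (w \<omega>1 j)) l"
        using \<omega> \<omega>1 unfolding S_def IA_def by simp
      from b1.digit_prefix_inj[OF fst_digit[OF wA[OF sp]] fst_digit[OF wA[OF sp1]] this]
      have fsts: "fst (w \<omega> j) = fst (w \<omega>1 j)" if "j < l" for j using that by blast
      have "digit_prefix m2 (\<lambda>j. snd (w \<omega> j)) k = digit_prefix m2 (\<lambda>j. snd (w \<omega>1 j)) k"
        using \<omega> \<omega>1 unfolding S_def IB_def by simp
      from b2.digit_prefix_inj[OF snd_digit[OF wA[OF sp]] snd_digit[OF wA[OF sp1]] this]
      have snds: "snd (w \<omega> j) = snd (w \<omega>1 j)" if "j < k" for j using that by blast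
      have ch: "\<And>j. \<omega> j \<in> choices" "\<And>j. \<omega>1 j \<in> choices" using sp sp1 by (auto simp: space_choices)
      have "fst (\<omega> j) = fst (\<omega>1 j)" if "j \<in> free_positions t p" "j < l" for j
        by (rule random_word_free(1)[OF c ch fsts[OF that(2), unfolded w_def] that(1)])
      moreover have "snd (\<omega> j) = snd (\<omega>1 j)" if "j \<in> free_positions t q" "j < k" for j
        by (rule random_word_free(2)[OF c ch fsts[unfolded w_def] that(1) snds[OF that(2), unfolded w_def]])
          (use that level(1) in simp)
      ultimately show "\<omega> \<in> B" using B(2) sp by blast
    qed
    then show ?thesis using B(1,3) by auto
  qed
  then obtain BB where BB: "\<And>i. BB i \<in> sets choice_measure" "\<And>i. S i \<subseteq> BB i" "\<And>i. prob (BB i) \<le> v"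
    by metis
  define I where "I = {-2..2::int} \<times> {-2..2::int}"
  have I: "finite I" "card I = 25" by (simp_all add: I_def card_cartesian_product)
  have "{\<omega>\<in>space choice_measure. carpet_point m1 m2 (w \<omega>) \<in> U} \<subseteq> (\<Union>i\<in>I. BB i)"
  proof
    fix \<omega> assume \<omega>: "\<omega> \<in> {\<omega>\<in>space choice_measure. carpet_point m1 m2 (w \<omega>) \<in> U}"
    then have "(IA \<omega> - IA \<omega>0, IB \<omega> - IB \<omega>0) \<in> I" using near[of \<omega>] by (simp add: I_def)
    moreover have "\<omega> \<in> S (IA \<omega> - IA \<omega>0, IB \<omega> - IB \<omega>0)" using \<omega> by (simp add: S_def)
    ultimately show "\<omega> \<in> (\<Union>i\<in>I. BB i)" using BB(2) by blast
  qed
  moreover have "prob (\<Union>i\<in>I. BB i) \<le> 25 * v"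
  proof -
    have "prob (\<Union>i\<in>I. BB i) \<le> (\<Sum>i\<in>I. prob (BB i))"
      by (rule finite_measure_subadditive_finite) (use I BB in auto)
    also have "\<dots> \<le> (\<Sum>i\<in>I. v)" by (intro sum_mono BB)
    finally show ?thesis by (simp add: I)
  qed
  moreover have "(\<Union>i\<in>I. BB i) \<in> sets choice_measure" using BB I by auto
  ultimately show ?thesis unfolding w_def[symmetric] v_def
    by (intro bexI[of _ "\<Union>i\<in>I. BB i"]) (auto simp: v_def)
qed

text \<open>If the measure of an approximate square of side \<open>m2\<^sup>-\<^sup>k\<close> is at most a constant times \<open>m2\<^sup>-\<^sup>k\<^sup>s\<close>, then the same
  holds for every set in terms of its diameter. A set of diameter 0 is treated at all scales at once
  and has measure 0.\<close>
lemma hausdorff_dim_random_points: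
  assumes b: "sparse_blocks t p q" and c: "\<And>j. c j \<in> choices"
    and X: "\<And>\<omega>. \<omega> \<in> space choice_measure \<Longrightarrow> carpet_point m1 m2 (random_word t p q c \<omega>) \<in> X"
    and s: "0 < s" and D: "0 < D"
    and count: "\<And>k. real m2 powr (k * s) \<le> D * (real M ^ card (free_positions t p \<inter> {..<nat \<lfloor>log m1 m2 * k\<rfloor>})
        * real N ^ card (free_positions t q \<inter> {..<k}))"
  shows "ereal s \<le> hausdorff_dim X"
proof -
  interpret prob_space choice_measure by (rule prob_choices)
  have m2: "1 < real m2" using b2.base_ge_2 by simp
  have ball: "\<exists>B\<in>sets choice_measure.
      {\<omega>\<in>space choice_measure. carpet_point m1 m2 (random_word t p q c \<omega>) \<in> U} \<subseteq> B \<and>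
      prob B \<le> 25 * D / real m2 powr (k * s)"
    if U: "bounded U" "diameter U \<le> 1 / real m2 ^ k" for U k
  proof -
    have close: "dist x y \<le> 1 / real m2 ^ k" if "x \<in> U" "y \<in> U" for x y
      using diameter_bounded_bound[OF U(1) that] U(2) by linarith
    from random_point_ball[where U = U and c = c, OF b c close] obtain B where B: "B \<in> sets choice_measure"
      "{\<omega>\<in>space choice_measure. carpet_point m1 m2 (random_word t p q c \<omega>) \<in> U} \<subseteq> B"
      "prob B \<le> 25 / (real M ^ card (free_positions t p \<inter> {..<nat \<lfloor>log m1 m2 * k\<rfloor>})
        * real N ^ card (free_positions t q \<inter> {..<k}))" by auto
    note B(3)
    also have "25 / (real M ^ card (free_positions t p \<inter> {..<nat \<lfloor>log m1 m2 * k\<rfloor>})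
        * real N ^ card (free_positions t q \<inter> {..<k})) \<le> 25 * D / real m2 powr (k * s)"
      using count[of k] M_pos N_pos m2 by (simp add: field_simps)
    finally show ?thesis using B by blast
  qed
  show ?thesis
  proof (rule mass_distribution_hausdorff_dim[OF X, where \<delta> = 1 and C = "25 * D * real m2 powr s"])
    show "0 < 25 * D * real m2 powr s" using D m2 by simp
    fix U :: "(real \<times> real) set" assume U: "bounded U" "diameter U \<le> 1"
    show "\<exists>B\<in>sets choice_measure.
        {\<omega>\<in>space choice_measure. carpet_point m1 m2 (random_word t p q c \<omega>) \<in> U} \<subseteq> B \<and>
        prob B \<le> 25 * D * real m2 powr s * diameter U powr s"
    proof (cases "diameter U = 0")
      case True
      have "\<forall>k::nat. \<exists>B. B \<in> sets choice_measure \<and>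
          {\<omega>\<in>space choice_measure. carpet_point m1 m2 (random_word t p q c \<omega>) \<in> U} \<subseteq> B \<and>
          prob B \<le> 25 * D / real m2 powr (k * s)"
      proof
        fix k :: nat
        have "diameter U \<le> 1 / real m2 ^ k" using True by simp
        from ball[OF U(1) this] show "\<exists>B. B \<in> sets choice_measure \<and>
          {\<omega>\<in>space choice_measure. carpet_point m1 m2 (random_word t p q c \<omega>) \<in> U} \<subseteq> B \<and>
          prob B \<le> 25 * D / real m2 powr (k * s)" by (simp only: Bex_def)
      qed
      from choice[OF this] obtain B :: "nat \<Rightarrow> (nat \<Rightarrow> nat \<times> nat) set"
        where B: "\<forall>k. B k \<in> sets choice_measure \<and>
          {\<omega>\<in>space choice_measure. carpet_point m1 m2 (random_word t p q c \<omega>) \<in> U} \<subseteq> B k \<and>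
          prob (B k) \<le> 25 * D / real m2 powr (k * s)" ..
      note B = B[rule_format, THEN conjunct1] B[rule_format, THEN conjunct2, THEN conjunct1]
        B[rule_format, THEN conjunct2, THEN conjunct2]
      have "(\<lambda>k. 25 * D / real m2 powr (real k * s)) \<longlonglongrightarrow> 0" using m2 s by real_asymp
      moreover have "prob (\<Inter>k. B k) \<le> 25 * D / real m2 powr (k * s)" for k :: nat
      proof -
        have "prob (\<Inter>k. B k) \<le> prob (B k)" using B(1) by (intro finite_measure_mono) auto
        then show ?thesis using B(3)[of k] by linarith
      qed
      ultimately have "prob (\<Inter>k. B k) \<le> 0" by (intro LIMSEQ_le_const) auto
      then show ?thesis using B True
        by (intro bexI[of _ "\<Inter>k. B k"]) (auto intro!: sets.countable_INT)
    next
      case False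
      then have d: "0 < diameter U" using diameter_ge_0[OF U(1)] by linarith
      define k where "k = nat \<lfloor>- log m2 (diameter U)\<rfloor>"
      have "log m2 (diameter U) \<le> 0" using d U(2) m2 by simp
      then have k: "real k \<le> - log m2 (diameter U)" "- log m2 (diameter U) < real k + 1"
        by (auto simp: k_def)
      have "diameter U = real m2 powr (log m2 (diameter U))" using d m2 by simp
      also have "\<dots> \<le> real m2 powr (- real k)" using k m2 by simp
      also have "\<dots> = 1 / real m2 ^ k" using m2 by (simp add: powr_minus_divide powr_realpow)
      finally obtain B where B: "B \<in> sets choice_measure"
        "{\<omega>\<in>space choice_measure. carpet_point m1 m2 (random_word t p q c \<omega>) \<in> U} \<subseteq> B"
        "prob B \<le> 25 * D / real m2 powr (k * s)" using ball[OF U(1)] by blast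
      have "1 / real m2 powr (k * s) = real m2 powr s * real m2 powr (- ((k + 1) * s))"
        using m2 by (simp add: powr_minus_divide powr_add[symmetric] field_simps)
      also have "real m2 powr (- ((k + 1) * s)) \<le> real m2 powr (log m2 (diameter U) * s)"
      proof -
        have "(- (real k + 1)) * s \<le> log m2 (diameter U) * s"
          using k s by (intro mult_right_mono) auto
        then show ?thesis using m2 by (simp add: algebra_simps)
      qed
      also have "\<dots> = diameter U powr s" using d m2 by (simp add: powr_powr[symmetric])
      finally have "25 * D * (1 / real m2 powr (k * s)) \<le> 25 * D * (real m2 powr s * diameter U powr s)"
        using D m2 by (intro mult_left_mono) auto
      then show ?thesis using B by (intro bexI[of _ B]) (auto simp: mult.assoc)
    qed
  qed (use s in auto)
qed

text \<open>The digits at positions 0 and 1 are repeated at the beginning of each block. If one of them is not the top column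
  and the other not the top row, then neither coordinate can end in top digits forever, so the map acts on these points
  as the shift. A coordinate in which only top digits occur is fixed by the map.\<close>
lemma random_word_recurrent:
  assumes K: "is_carpet m1 m2 A K" and b: "sparse_blocks t p q"
    and ret: "\<And>i. 1 / real m1 ^ p i < \<psi> (t i)" "\<And>i. 1 / real m2 ^ q i < \<psi> (t i) powr \<gamma>"
    and c: "\<And>j. c j \<in> choices"
    and c0: "fst (c 0) \<noteq> m1 - 1 \<or> (\<forall>e\<in>fst ` A. e = m1 - 1)"
    and c1: "row (fst (c 1)) (snd (c 1)) \<noteq> m2 - 1 \<or> (\<forall>e\<in>snd ` A. e = m2 - 1)"
    and \<omega>: "\<omega> \<in> space choice_measure"
  shows "carpet_point m1 m2 (random_word t p q c \<omega>) \<in> recurrence_set m1 m2 A K \<gamma> \<psi>"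
proof -
  interpret sparse_blocks t p q by (rule b)
  define w where "w = random_word t p q c \<omega>"
  have wA: "w j \<in> A" for j
    unfolding w_def by (rule random_word_digit) (use c \<omega> in \<open>auto simp: space_choices\<close>)
  have copy1: "fst (w (j + t i)) = fst (w j)" if "j < p i" for i j
    unfolding w_def using random_word_copy(1)[OF b that] .
  have copy2: "w (j + t i) = w j" if "j < q i" for i j
    unfolding w_def using random_word_copy(2)[OF b that] .
  have w01: "w j = (fst (c j), row (fst (c j)) (snd (c j)))" if "j < 2" for j
    unfolding w_def by (rule random_word_fixed[OF b that])
  have t_ge: "i \<le> t i" for i by (rule strict_mono_imp_increasing[OF t_strict_mono])
  have inf: "\<exists>\<^sub>\<infinity>j. Q (w j)" if "Q (w j0)" "j0 < 2" for Q j0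
    unfolding INFM_nat_le
  proof
    fix n
    have "w (j0 + t n) = w j0" by (rule copy2) (use that lengths(1)[of n] in auto)
    then show "\<exists>j\<ge>n. Q (w j)" using that t_ge[of n] by (intro exI[of _ "j0 + t n"]) auto
  qed
  have inf1: "(\<forall>e\<in>fst ` A. e = m1 - 1) \<or> (\<exists>\<^sub>\<infinity>j. fst (w j) \<noteq> m1 - 1)"
    using c0 inf[of "\<lambda>x. fst x \<noteq> m1 - 1" 0] w01[of 0] by auto
  have inf2: "(\<forall>e\<in>snd ` A. e = m2 - 1) \<or> (\<exists>\<^sub>\<infinity>j. snd (w j) \<noteq> m2 - 1)"
    using c1 inf[of "\<lambda>x. snd x \<noteq> m2 - 1" 1] w01[of 1] by auto
  have T1: "(times_mod1 m1 (fst ` A) ^^ n) (digit_val m1 (\<lambda>j. fst (w j))) = digit_val m1 (\<lambda>j. fst (w (j + n)))" for n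
    by (rule b1.times_mod1_shift[OF _ fst_digit[OF wA] inf1]) (rule column_of[OF wA])
  have T2: "(times_mod1 m2 (snd ` A) ^^ n) (digit_val m2 (\<lambda>j. snd (w j))) = digit_val m2 (\<lambda>j. snd (w (j + n)))" for n
    by (rule b2.times_mod1_shift[OF _ snd_digit[OF wA] inf2]) (use wA in auto)
  have close1: "\<bar>digit_val m1 (\<lambda>j. fst (w j)) - digit_val m1 (\<lambda>j. fst (w (j + t i)))\<bar> < \<psi> (t i)" for i
  proof -
    have "\<bar>digit_val m1 (\<lambda>j. fst (w j)) - digit_val m1 (\<lambda>j. fst (w (j + t i)))\<bar> \<le> 1 / real m1 ^ p i"
      by (rule b1.digit_val_close) (use fst_digit[OF wA] copy1 in auto)
    then show ?thesis using ret(1)[of i] by linarith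
  qed
  have close2: "\<bar>digit_val m2 (\<lambda>j. snd (w j)) - digit_val m2 (\<lambda>j. snd (w (j + t i)))\<bar> < \<psi> (t i) powr \<gamma>" for i
  proof -
    have "\<bar>digit_val m2 (\<lambda>j. snd (w j)) - digit_val m2 (\<lambda>j. snd (w (j + t i)))\<bar> \<le> 1 / real m2 ^ q i"
      by (rule b2.digit_val_close) (use snd_digit[OF wA] copy2 in auto)
    then show ?thesis using ret(2)[of i] by linarith
  qed
  have "\<exists>\<^sub>\<infinity>n. \<bar>digit_val m1 (\<lambda>j. fst (w j)) - digit_val m1 (\<lambda>j. fst (w (j + n)))\<bar> < \<psi> n \<and>
      \<bar>digit_val m2 (\<lambda>j. snd (w j)) - digit_val m2 (\<lambda>j. snd (w (j + n)))\<bar> < \<psi> n powr \<gamma>"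
    unfolding INFM_nat_le using close1 close2 t_ge by blast
  moreover have "carpet_point m1 m2 w \<in> K" by (rule carpet_points_subset[OF K wA])
  ultimately show ?thesis
    unfolding recurrence_set_def w_def[symmetric] by (simp add: carpet_point_def T1 T2)
qed

lemma digit_choice:
  "e \<in> A \<Longrightarrow> (fst e, rank (fst e) (snd e)) \<in> choices"
  unfolding choices_def by (auto intro: rank_less[of e, simplified] column_of)

text \<open>The hypothesis \<open>rate\<close> says that a single block starting at \<open>n\<close> leaves enough free digits at every
  scale \<open>k\<close>. For sparse return times only one block matters at each scale, and all earlier ones together cost an
  arbitrarily small part of the exponent, which is the reason for the loss \<open>e\<close> in the proof.\<close>
lemma hausdorff_dim_recurrence_ge:
  assumes K: "is_carpet m1 m2 A K" and S: "\<exists>\<^sub>\<infinity>n. n \<in> S"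
    and PQ: "\<And>n. 2 \<le> Q n" "\<And>n. Q n \<le> P n"
    and ret: "\<And>n. n \<in> S \<Longrightarrow> 1 / real m1 ^ P n < \<psi> n" "\<And>n. n \<in> S \<Longrightarrow> 1 / real m2 ^ Q n < \<psi> n powr \<gamma>"
    and rate: "\<And>n k. n \<in> S \<Longrightarrow> s0 * (k * ln m2) - D
      \<le> ln M * (real (nat \<lfloor>log m1 m2 * k\<rfloor>)
            - min (real (P n)) (max 0 (real (nat \<lfloor>log m1 m2 * k\<rfloor>) - real n)))
        + ln N * (real k - min (real (Q n)) (max 0 (real k - real n)))"
  shows "ereal s0 \<le> hausdorff_dim (recurrence_set m1 m2 A K \<gamma> \<psi>)"
proof (rule ereal_le_epsilon2)
  fix e :: real assume e: "0 < e"
  define W where "W = recurrence_set m1 m2 A K \<gamma> \<psi>"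
  define s where "s = s0 - e"
  define L where "L = log m1 m2"
  have "ereal s \<le> hausdorff_dim W"
  proof (cases "s \<le> 0")
    case True
    then have "ereal s \<le> 0" by simp
    then show ?thesis using hausdorff_dim_nonneg[of W] by (rule order_trans)
  next
    case False
    have L: "1 \<le> L" using log_ratio_ge_1 by (simp add: L_def)
    have m2: "0 < ln (real m2)" using b2.base_ge_2 by simp
    have "\<exists>n\<ge>m. n \<in> S" for m using S unfolding INFM_nat_le by blast
    then obtain g where g: "\<And>m. m \<le> g m" "\<And>m. g m \<in> S" by metis
    define t where "t = rec_nat (g 2) (\<lambda>i ti. g (Suc i * (ti + P ti + 2)))"
    have t0: "t 0 = g 2" and tSuc: "t (Suc i) = g (Suc i * (t i + P (t i) + 2))" for i
      by (simp_all add: t_def)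
    have tS: "t i \<in> S" for i using g(2) by (cases i) (simp_all only: t0 tSuc)
    define p q where "p i = P (t i)" and "q i = Q (t i)" for i
    have blocks: "sparse_blocks t p q"
      by unfold_locales (use PQ g(1) in \<open>auto simp: p_def q_def t0 tSuc simp del: mult_Suc\<close>)
    interpret sparse_blocks t p q by (rule blocks)
    obtain e0 where e0: "e0 \<in> A" "fst e0 \<noteq> m1 - 1 \<or> (\<forall>e\<in>fst ` A. e = m1 - 1)"
      using A_nonempty by (cases "\<exists>e\<in>A. fst e \<noteq> m1 - 1") auto
    obtain e1 where e1: "e1 \<in> A" "snd e1 \<noteq> m2 - 1 \<or> (\<forall>e\<in>snd ` A. e = m2 - 1)"
      using A_nonempty by (cases "\<exists>e\<in>A. snd e \<noteq> m2 - 1") auto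
    define c where "c j = (let e = if j = 0 then e0 else e1 in (fst e, rank (fst e) (snd e)))" for j :: nat
    have c: "c j \<in> choices" for j using e0(1) e1(1) by (simp add: c_def Let_def digit_choice)
    have rec: "carpet_point m1 m2 (random_word t p q c \<omega>) \<in> W" if "\<omega> \<in> space choice_measure" for \<omega>
      unfolding W_def
    proof (rule random_word_recurrent[OF K blocks _ _ c _ _ that])
      show "1 / real m1 ^ p i < \<psi> (t i)" "1 / real m2 ^ q i < \<psi> (t i) powr \<gamma>" for i
        using ret[OF tS] by (simp_all add: p_def q_def)
      show "fst (c 0) \<noteq> m1 - 1 \<or> (\<forall>e\<in>fst ` A. e = m1 - 1)" using e0 by (simp add: c_def)
      show "row (fst (c 1)) (snd (c 1)) \<noteq> m2 - 1 \<or> (\<forall>e\<in>snd ` A. e = m2 - 1)"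
        using e1 row_rank[OF e1(1)] by (simp add: c_def)
    qed
    define F G where "F k = card (free_positions t p \<inter> {..<nat \<lfloor>L * k\<rfloor>})"
      and "G k = card (free_positions t q \<inter> {..<k})" for k :: nat
    have lnMN: "0 \<le> ln M" "0 \<le> ln N" using M_pos N_pos by auto
    \<comment> \<open>From block \<open>i0\<close> on, the digits lost before the current block cost less than \<open>e\<close> in the exponent.
      The finitely many scales below are absorbed by the constant \<open>D'\<close>.\<close>
    obtain i0 :: nat where i0: "(ln M + ln N) * L / (e * ln m2) < real i0" using reals_Archimedean2 by blast
    define D' where "D' = max D (s * (t (Suc i0) * ln m2))"
    have count: "s * (k * ln m2) - D' \<le> ln M * F k + ln N * G k" for k
    proof (cases "nat \<lfloor>L * k\<rfloor> < t (Suc i0)")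
      case True
      have "k \<le> nat \<lfloor>L * k\<rfloor>" unfolding L_def by (rule column_level)
      then have "real k \<le> real (t (Suc i0))" using True by simp
      then have "s * (k * ln m2) \<le> s * (t (Suc i0) * ln m2)"
        using False m2 by (intro mult_left_mono mult_right_mono) auto
      moreover have "0 \<le> ln M * F k + ln N * G k" using lnMN by simp
      ultimately show ?thesis by (simp add: D'_def)
    next
      case l_ge: False
      define l where "l = nat \<lfloor>L * k\<rfloor>"
      have lL: "real l \<le> L * k" and kl: "k \<le> l" unfolding l_def L_def by (rule column_level)+
      have "\<exists>i. l < t (Suc (Suc i))"
        using strict_mono_imp_increasing[OF t_strict_mono, of "Suc (Suc l)"] by (intro exI[of _ l]) simp
      then obtain i where i: "l < t (Suc (Suc i))" "\<And>i'. i' < i \<Longrightarrow> \<not> l < t (Suc (Suc i'))"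
        using exists_least_iff[of "\<lambda>i. l < t (Suc (Suc i))"] by blast
      have "t (Suc i0) < t (Suc (Suc i))" using l_ge i(1) by (simp add: l_def)
      then have i0i: "i0 \<le> i" using strict_mono_less[OF t_strict_mono] by simp
      have ti: "t (Suc i) \<le> l"
      proof (cases i)
        case 0 then show ?thesis using i0i l_ge by (simp add: l_def)
      next
        case (Suc i') then show ?thesis using i(2)[of i'] by simp
      qed
      \<comment> \<open>Here \<open>Suc i\<close> is the last block that has started when \<open>l\<close> columns are prescribed, and \<open>E\<close> bounds everything that was
        lost before it.\<close>
      define E where "E = real (t i + p i + 2)"
      have "Suc i * (t i + p i + 2) \<le> l" using sparse[of i] ti by linarith
      then have "real (Suc i) * E \<le> real l" unfolding E_def by (metis of_nat_le_iff of_nat_mult)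
      then have "real (Suc i) * E \<le> L * k" using lL by linarith
      then have "(ln M + ln N) * (real (Suc i) * E) \<le> (ln M + ln N) * (L * k)"
        using lnMN by (intro mult_left_mono) auto
      also have "\<dots> = ((ln M + ln N) * L) * k" by simp
      also have "(ln M + ln N) * L \<le> real (Suc i) * (e * ln m2)"
      proof -
        have "(ln M + ln N) * L \<le> real i0 * (e * ln m2)" using i0 e m2 by (simp add: field_simps)
        also have "\<dots> \<le> real (Suc i) * (e * ln m2)" using i0i e m2 by (intro mult_right_mono) auto
        finally show ?thesis .
      qed
      then have "((ln M + ln N) * L) * k \<le> (real (Suc i) * (e * ln m2)) * k" by (intro mult_right_mono) auto
      finally have "real (Suc i) * ((ln M + ln N) * E) \<le> real (Suc i) * (e * ln m2 * k)" by (simp add: ac_simps)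
      then have err: "(ln M + ln N) * E \<le> e * (k * ln m2)" by (simp add: ac_simps del: of_nat_Suc)
      have Fk: "real l - min (real (p (Suc i))) (max 0 (real l - real (t (Suc i)))) - E \<le> F k"
        unfolding F_def l_def[symmetric] E_def by (rule free_count_ge) (use i(1) in auto)
      have Gk: "real k - min (real (q (Suc i))) (max 0 (real k - real (t (Suc i)))) - E \<le> G k"
        unfolding G_def E_def by (rule free_count_ge) (use i(1) kl lengths(2) in auto)
      have "ln M * (real l - min (real (p (Suc i))) (max 0 (real l - real (t (Suc i)))) - E) \<le> ln M * F k"
        "ln N * (real k - min (real (q (Suc i))) (max 0 (real k - real (t (Suc i)))) - E) \<le> ln N * G k"
        using Fk Gk lnMN by (auto intro!: mult_left_mono)
      moreover have "s0 * (k * ln m2) - D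
        \<le> ln M * (real l - min (real (p (Suc i))) (max 0 (real l - real (t (Suc i)))))
         + ln N * (real k - min (real (q (Suc i))) (max 0 (real k - real (t (Suc i)))))"
        using rate[OF tS[of "Suc i"], of k] unfolding p_def q_def l_def L_def .
      ultimately have "s0 * (k * ln m2) - e * (k * ln m2) - D \<le> ln M * F k + ln N * G k"
        using err by (simp add: algebra_simps)
      then show ?thesis by (simp add: D'_def s_def algebra_simps)
    qed
    show ?thesis
    proof (rule hausdorff_dim_random_points[OF blocks c rec, where D = "exp D'"])
      fix k :: nat
      have "real m2 powr (k * s) = exp (s * (k * ln m2))" using b2.base_ge_2 by (simp add: powr_def ac_simps)
      also have "\<dots> \<le> exp (D' + (F k * ln M + G k * ln N))" using count[of k] by (simp add: ac_simps)
      also have "\<dots> = exp D' * (real M ^ F k * real N ^ G k)"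
        using M_pos N_pos by (simp add: exp_add exp_of_nat_mult)
      finally show "real m2 powr (k * s) \<le> exp D' * (real M ^ card (free_positions t p \<inter> {..<nat \<lfloor>log m1 m2 * k\<rfloor>})
          * real N ^ card (free_positions t q \<inter> {..<k}))" by (simp add: F_def G_def L_def)
    qed (use False in auto)
  qed
  then have "ereal s + ereal e \<le> hausdorff_dim W + ereal e" by (rule add_right_mono)
  then show "ereal s0 \<le> hausdorff_dim (recurrence_set m1 m2 A K \<gamma> \<psi>) + ereal e"
    by (simp add: s_def W_def)
qed

end

section \<open>The scales that minimise the local dimension\<close>

text \<open>As a function of \<open>y\<close>, \<open>free_length \<tau>\<close> grows with slope 1 up to \<open>1\<close>, is constant up to \<open>1 + \<tau>\<close>, and
  then grows with slope 1 again. The only convex corner is at \<open>1 + \<tau>\<close>.\<close>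
lemma free_length_concave:
  assumes "0 \<le> \<theta>" "\<theta> \<le> 1" "0 \<le> \<tau>"
    and "(y \<le> 1 + \<tau> \<and> y' \<le> 1 + \<tau>) \<or> (1 + \<tau> \<le> y \<and> 1 + \<tau> \<le> y')"
  shows "(1 - \<theta>) * free_length \<tau> y + \<theta> * free_length \<tau> y' \<le> free_length \<tau> ((1 - \<theta>) * y + \<theta> * y')"
  using assms(4)
proof
  assume y: "y \<le> 1 + \<tau> \<and> y' \<le> 1 + \<tau>"
  have f: "free_length \<tau> x = min x 1" if "x \<le> 1 + \<tau>" for x
    using that assms(3) by (auto simp: free_length_def)
  have le: "(1 - \<theta>) * y + \<theta> * y' \<le> 1 + \<tau>"
    using y assms by (intro convex_bound_le) auto
  have "(1 - \<theta>) * min y 1 + \<theta> * min y' 1 \<le> (1 - \<theta>) * y + \<theta> * y'"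
    "(1 - \<theta>) * min y 1 + \<theta> * min y' 1 \<le> (1 - \<theta>) * 1 + \<theta> * 1"
    using assms by (intro add_mono mult_left_mono; simp)+
  then show ?thesis using y le by (simp add: f)
next
  assume y: "1 + \<tau> \<le> y \<and> 1 + \<tau> \<le> y'"
  have f: "free_length \<tau> x = x - \<tau>" if "1 + \<tau> \<le> x" for x
    using that assms(3) by (auto simp: free_length_def)
  have "(1 - \<theta>) * (1 + \<tau>) + \<theta> * (1 + \<tau>) \<le> (1 - \<theta>) * y + \<theta> * y'"
    using y assms by (intro add_mono mult_left_mono) auto
  then have "1 + \<tau> \<le> (1 - \<theta>) * y + \<theta> * y'" by (simp add: algebra_simps)
  then show ?thesis using y by (simp add: f algebra_simps)
qed

text \<open>The function \<open>g\<close> vanishes at \<open>0\<close>, is concave on each of the intervals between \<open>0\<close> and the two corners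
  \<open>(1 + \<tau>1) / L\<close> and \<open>1 + \<tau>2\<close>, and is affine beyond them. A concave function that is nonnegative at the ends of
  an interval is nonnegative on it. On the last piece the constant term is nonpositive, so \<open>0 \<le> g\<close> at its left end
  forces the slope to be nonnegative.\<close>
lemma free_lengths_minimal:
  fixes u v L \<tau>1 \<tau>2 \<sigma> x :: real
  defines "g \<equiv> \<lambda>x. u * free_length \<tau>1 (L * x) + v * free_length \<tau>2 x - \<sigma> * x"
  assumes uv: "0 \<le> u" "0 \<le> v" and L: "0 < L" and \<tau>: "0 \<le> \<tau>1" "0 \<le> \<tau>2"
    and g: "0 \<le> g (1 + \<tau>2)" "0 \<le> g ((1 + \<tau>1) / L)" and x: "0 \<le> x"
  shows "0 \<le> g x"
proof -
  have between: "0 \<le> g x" if p: "0 \<le> g p" "0 \<le> g p'" "p \<le> x" "x \<le> p'"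
    and side: "(p' \<le> 1 + \<tau>2) \<or> (1 + \<tau>2 \<le> p)" "(L * p' \<le> 1 + \<tau>1) \<or> (1 + \<tau>1 \<le> L * p)" for p p'
  proof (cases "p = p'")
    case True then show ?thesis using p by (metis antisym)
  next
    case False
    define \<theta> where "\<theta> = (x - p) / (p' - p)"
    have l: "0 \<le> \<theta>" "\<theta> \<le> 1" using p False by (auto simp: \<theta>_def field_simps)
    have "\<theta> * (p' - p) = x - p" using False by (simp add: \<theta>_def)
    then have x_eq: "x = (1 - \<theta>) * p + \<theta> * p'" by (simp add: algebra_simps)
    have Lp: "L * p \<le> L * p'" using p L by simp
    have "(1 - \<theta>) * free_length \<tau>1 (L * p) + \<theta> * free_length \<tau>1 (L * p')
        \<le> free_length \<tau>1 ((1 - \<theta>) * (L * p) + \<theta> * (L * p'))"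
      by (rule free_length_concave) (use l \<tau> side Lp in auto)
    also have "(1 - \<theta>) * (L * p) + \<theta> * (L * p') = L * x" by (simp add: x_eq algebra_simps)
    finally have 1: "u * ((1 - \<theta>) * free_length \<tau>1 (L * p) + \<theta> * free_length \<tau>1 (L * p'))
        \<le> u * free_length \<tau>1 (L * x)" using uv by (intro mult_left_mono) auto
    have "(1 - \<theta>) * free_length \<tau>2 p + \<theta> * free_length \<tau>2 p' \<le> free_length \<tau>2 x"
      unfolding x_eq by (rule free_length_concave) (use l \<tau> side p in auto)
    then have 2: "v * ((1 - \<theta>) * free_length \<tau>2 p + \<theta> * free_length \<tau>2 p') \<le> v * free_length \<tau>2 x"
      using uv by (intro mult_left_mono) auto
    have "0 \<le> (1 - \<theta>) * g p + \<theta> * g p'" using l p by simp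
    also have "\<dots> = u * ((1 - \<theta>) * free_length \<tau>1 (L * p) + \<theta> * free_length \<tau>1 (L * p'))
        + v * ((1 - \<theta>) * free_length \<tau>2 p + \<theta> * free_length \<tau>2 p') - \<sigma> * x"
    proof -
      have "\<sigma> * x = (1 - \<theta>) * (\<sigma> * p) + \<theta> * (\<sigma> * p')" by (simp add: x_eq algebra_simps)
      then show ?thesis by (simp add: g_def algebra_simps)
    qed
    also have "\<dots> \<le> g x" unfolding g_def using 1 2 by simp
    finally show ?thesis .
  qed
  define a b where "a = (1 + \<tau>1) / L" and "b = 1 + \<tau>2"
  have La: "L * a = 1 + \<tau>1" using L by (simp add: a_def)
  have pos: "0 < a" "0 < b" using \<tau> L by (auto simp: a_def b_def)
  have mono: "L * c \<le> 1 + \<tau>1 \<longleftrightarrow> c \<le> a" "1 + \<tau>1 \<le> L * c \<longleftrightarrow> a \<le> c" for c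
    using L by (simp_all add: a_def field_simps)
  have ga: "0 \<le> g a" "0 \<le> g b" using g by (simp_all add: a_def b_def)
  have g0: "0 \<le> g 0" using \<tau> by (simp add: g_def free_length_def)
  have gmin: "0 \<le> g (min a b)" and gmax: "0 \<le> g (max a b)" using ga by (simp_all add: min_def max_def)
  consider "x \<le> min a b" | "min a b \<le> x" "x \<le> max a b" | "max a b \<le> x" by linarith
  then show ?thesis
  proof cases
    case 1
    show ?thesis by (rule between[OF g0 gmin x 1]) (unfold mono, auto simp: b_def)
  next
    case 2
    show ?thesis by (rule between[OF gmin gmax 2]) (unfold mono, auto simp: b_def)
  next
    case 3
    define c where "c = max a b"
    have c: "0 < c" "c \<le> x" using pos 3 by (auto simp: c_def)
    have lin: "free_length \<tau>1 (L * y) = L * y - \<tau>1" "free_length \<tau>2 y = y - \<tau>2" if "c \<le> y" for y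
      using that \<tau> mono(2)[of y] by (auto simp: free_length_def c_def b_def)
    have gy: "g y = (u * L + v - \<sigma>) * y - (u * \<tau>1 + v * \<tau>2)" if "c \<le> y" for y
      unfolding g_def lin[OF that] by (simp add: algebra_simps)
    have "0 \<le> (u * L + v - \<sigma>) * c - (u * \<tau>1 + v * \<tau>2)" using gmax gy[of c] by (simp add: c_def)
    moreover have "0 \<le> u * \<tau>1 + v * \<tau>2" using uv \<tau> by simp
    ultimately have "0 \<le> (u * L + v - \<sigma>) * c" by linarith
    then have "0 \<le> u * L + v - \<sigma>" using c by (simp add: zero_le_mult_iff)
    then have "(u * L + v - \<sigma>) * c \<le> (u * L + v - \<sigma>) * x" using c by (intro mult_left_mono) auto
    then have "g c \<le> g x" using gy[of c] gy[of x] c by simp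
    then show ?thesis using gmax by (simp add: c_def)
  qed
qed

context uniform_carpet
begin

text \<open>The rates at the two scales where a repeated block ends: the rows at \<open>1 + \<tau>2\<close> and the columns at
  \<open>(1 + \<tau>) / L\<close>, with \<open>\<tau>2 = \<gamma> \<tau> log\<^bsub>m2\<^esub> m1\<close>. Unlike the case distinctions in the formulas for
  \<open>t1\<close> and \<open>t2\<close>, this is visibly continuous in \<open>\<tau>\<close>.\<close>
definition best_rate :: "real \<Rightarrow> real \<Rightarrow> real" where
  "best_rate \<gamma> \<tau> = min
     (carpet_rate m1 m2 M N \<tau> (\<gamma> * \<tau> * log m2 m1) (1 + \<gamma> * \<tau> * log m2 m1))
     (carpet_rate m1 m2 M N \<tau> (\<gamma> * \<tau> * log m2 m1) ((1 + \<tau>) / log m1 m2))"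

lemma ln_m_pos: "0 < ln (real m1)" "0 < ln (real m2)"
  using b1.base_ge_2 b2.base_ge_2 by auto

text \<open>The conditions in the formulas say on which side of a corner of \<open>free_length\<close> the scale falls: at the first
  scale \<open>1 + (1 - \<gamma>) \<tau> \<le> L\<close> means that the column block has ended, at the second scale it means that the
  row block has not ended, and \<open>1 + \<tau> \<le> L\<close> means that it has not begun.\<close>
lemma best_rate_eq_formulas:
  assumes "0 \<le> \<tau>" "0 \<le> \<gamma>"
  shows "best_rate \<gamma> \<tau> = min (t1_formula m1 m2 M N \<gamma> \<tau> (\<gamma> * \<tau> * log m2 m1))
                             (t2_formula m1 m2 M N \<gamma> \<tau> (\<gamma> * \<tau> * log m2 m1))"
proof -
  define a b where "a = ln (real m1)" and "b = ln (real m2)"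
  have ab: "0 < a" "0 < b" using ln_m_pos by (simp_all add: a_def b_def)
  define \<tau>2 where "\<tau>2 = \<gamma> * \<tau> * log m2 m1"
  have \<tau>2: "\<tau>2 = \<gamma> * \<tau> * a / b" by (simp add: \<tau>2_def log_def a_def b_def)
  have \<tau>2_nn: "0 \<le> \<tau>2" using assms ab by (simp add: \<tau>2)
  have L: "log m1 m2 = b / a" "log m2 m1 = a / b" by (simp_all add: log_def a_def b_def)
  have cond: "1 + (1 - \<gamma>) * \<tau> \<le> b / a \<longleftrightarrow> \<tau> \<le> b / a * (1 + \<tau>2) - 1"
  proof -
    have "b / a * (1 + \<tau>2) = b / a + \<gamma> * \<tau>" using ab by (simp add: \<tau>2 field_simps)
    then show ?thesis by (auto simp: algebra_simps)
  qed
  have "1 \<le> b / a" using log_ratio_ge_1 by (simp add: L)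
  then have y1: "1 \<le> b / a * (1 + \<tau>2)" using \<tau>2_nn mult_mono[of 1 "b / a" 1 "1 + \<tau>2"] by simp
  have 1: "carpet_rate m1 m2 M N \<tau> \<tau>2 (1 + \<tau>2) = t1_formula m1 m2 M N \<gamma> \<tau> \<tau>2"
  proof -
    have f2: "free_length \<tau>2 (1 + \<tau>2) = 1" using \<tau>2_nn by (simp add: free_length_def)
    have d: "1 + \<tau>2 \<noteq> 0" using \<tau>2_nn by simp
    show ?thesis
    proof (cases "1 + (1 - \<gamma>) * \<tau> \<le> b / a")
      case True
      then have "free_length \<tau> (b / a * (1 + \<tau>2)) = b / a * (1 + \<tau>2) - \<tau>"
        using cond y1 by (simp add: free_length_def)
      then have "carpet_rate m1 m2 M N \<tau> \<tau>2 (1 + \<tau>2)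
          = (ln M * (b / a * (1 + \<tau>2) - \<tau>) + ln N) / ((1 + \<tau>2) * b)"
        by (simp add: carpet_rate_def L f2 b_def[symmetric])
      also have "\<dots> = (1 - \<tau> * (a / b) / (1 + \<tau>2)) * (ln M / a) + ln N / b / (1 + \<tau>2)"
      proof -
        define c where "c = 1 + \<tau>2"
        have "c \<noteq> 0" using d by (simp add: c_def)
        then show ?thesis unfolding c_def[symmetric] using ab by (simp add: field_simps)
      qed
      finally show ?thesis using True by (simp add: t1_formula_def L log_def a_def b_def)
    next
      case False
      then have "free_length \<tau> (b / a * (1 + \<tau>2)) = 1" using cond y1 by (simp add: free_length_def)
      then show ?thesis using False ab d
        by (simp add: carpet_rate_def t1_formula_def L f2 b_def[symmetric])
          (simp add: log_def b_def[symmetric] divide_simps)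
    qed
  qed
  have 2: "carpet_rate m1 m2 M N \<tau> \<tau>2 ((1 + \<tau>) / (b / a)) = t2_formula m1 m2 M N \<gamma> \<tau> \<tau>2"
  proof -
    define x where "x = (1 + \<tau>) / (b / a)"
    have x: "b / a * x = 1 + \<tau>" "x = (1 + \<tau>) * a / b" using ab by (simp_all add: x_def)
    have f1: "free_length \<tau> (1 + \<tau>) = 1" using assms by (simp add: free_length_def)
    have d: "1 + \<tau> \<noteq> 0" using assms by simp
    have c1: "1 + \<tau> \<le> b / a \<longleftrightarrow> x \<le> 1" using ab by (simp add: x(2) field_simps)
    have c2: "1 + (1 - \<gamma>) * \<tau> \<le> b / a \<longleftrightarrow> x - 1 \<le> \<tau>2"
    proof -
      have "(1 + (1 - \<gamma>) * \<tau> - b / a) * (a / b) = x - 1 - \<tau>2"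
        using ab by (simp add: x(2) \<tau>2 field_simps)
      moreover have "e * (a / b) \<le> 0 \<longleftrightarrow> e \<le> 0" for e
        using ab mult_le_cancel_right_pos[of "a / b" e 0] by simp
      ultimately show ?thesis by (metis diff_le_0_iff_le)
    qed
    have r: "carpet_rate m1 m2 M N \<tau> \<tau>2 x = (ln M + ln N * free_length \<tau>2 x) / (x * b)"
      unfolding carpet_rate_def L(1) x(1) f1 b_def[symmetric] by simp
    consider "x \<le> 1" | "1 < x" "x - 1 \<le> \<tau>2" | "1 < x" "\<not> x - 1 \<le> \<tau>2" by linarith
    then show ?thesis unfolding x_def[symmetric] r
    proof cases
      case 1
      then have f: "free_length \<tau>2 x = x" using \<tau>2_nn by (simp add: free_length_def)
      have "(ln M + ln N * x) / (x * b) = ln M / a / (1 + \<tau>) + ln N / b"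
        using ab d by (simp add: x(2) divide_simps)
      then show "(ln M + ln N * free_length \<tau>2 x) / (x * b) = t2_formula m1 m2 M N \<gamma> \<tau> \<tau>2"
        using 1 c1 by (simp add: f t2_formula_def L log_def a_def b_def)
    next
      case 2
      then have f: "free_length \<tau>2 x = 1" by (simp add: free_length_def)
      have "(ln M + ln N * 1) / (x * b) = (ln M / a + ln N / a) / (1 + \<tau>)"
        using ab d by (simp add: x(2) divide_simps)
      then show "(ln M + ln N * free_length \<tau>2 x) / (x * b) = t2_formula m1 m2 M N \<gamma> \<tau> \<tau>2"
        using 2 c1 c2 by (simp add: f t2_formula_def L) (simp add: log_def a_def)
    next
      case 3
      then have f: "free_length \<tau>2 x = x - \<tau>2" by (simp add: free_length_def)
      have "x - \<tau>2 = (1 + (1 - \<gamma>) * \<tau>) * a / b" using ab by (simp add: x(2) \<tau>2 field_simps)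
      then have "(ln M + ln N * (x - \<tau>2)) / (x * b) = (ln M / a + (1 + (1 - \<gamma>) * \<tau>) * (ln N / b)) / (1 + \<tau>)"
        using ab d by (simp add: x(2) divide_simps)
      then show "(ln M + ln N * free_length \<tau>2 x) / (x * b) = t2_formula m1 m2 M N \<gamma> \<tau> \<tau>2"
        using 3 c1 c2 by (simp add: f t2_formula_def L) (simp add: log_def a_def b_def)
    qed
  qed
  show ?thesis using 1 2 by (simp add: best_rate_def \<tau>2_def L)
qed

lemma best_rate_minimal:
  assumes "0 \<le> \<tau>" "0 \<le> \<gamma>" "0 \<le> x"
  shows "best_rate \<gamma> \<tau> * (x * ln m2) \<le> ln M * free_length \<tau> (log m1 m2 * x)
    + ln N * free_length (\<gamma> * \<tau> * log m2 m1) x"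
proof -
  define L where "L = log m1 m2"
  define \<tau>2 where "\<tau>2 = \<gamma> * \<tau> * log m2 m1"
  define g where "g x = ln M * free_length \<tau> (L * x) + ln N * free_length \<tau>2 x - best_rate \<gamma> \<tau> * ln m2 * x" for x
  have L: "0 < L" using log_ratio_ge_1 by (simp add: L_def)
  have \<tau>2: "0 \<le> \<tau>2" unfolding \<tau>2_def using assms ln_m_pos by (simp add: log_def)
  have g_nn: "0 \<le> g y" if "0 < y" "best_rate \<gamma> \<tau> \<le> carpet_rate m1 m2 M N \<tau> \<tau>2 y" for y
  proof -
    have "best_rate \<gamma> \<tau> * (y * ln m2) \<le> carpet_rate m1 m2 M N \<tau> \<tau>2 y * (y * ln m2)"
      using that ln_m_pos by (intro mult_right_mono) auto
    also have "\<dots> = ln M * free_length \<tau> (L * y) + ln N * free_length \<tau>2 y"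
      using that ln_m_pos by (simp add: carpet_rate_def L_def)
    finally show ?thesis by (simp add: g_def ac_simps)
  qed
  have "0 \<le> g x"
    unfolding g_def
  proof (rule free_lengths_minimal)
    show "0 \<le> ln M * free_length \<tau> (L * (1 + \<tau>2)) + ln N * free_length \<tau>2 (1 + \<tau>2) - best_rate \<gamma> \<tau> * ln m2 * (1 + \<tau>2)"
      using g_nn[of "1 + \<tau>2"] \<tau>2 by (simp add: g_def best_rate_def \<tau>2_def)
    show "0 \<le> ln M * free_length \<tau> (L * ((1 + \<tau>) / L)) + ln N * free_length \<tau>2 ((1 + \<tau>) / L) - best_rate \<gamma> \<tau> * ln m2 * ((1 + \<tau>) / L)"
      using g_nn[of "(1 + \<tau>) / L"] assms L by (simp only: g_def best_rate_def \<tau>2_def L_def) simp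
  qed (use M_pos N_pos L \<tau>2 assms in auto)
  then show ?thesis by (simp add: g_def L_def \<tau>2_def ac_simps)
qed

lemma isCont_best_rate:
  assumes "0 \<le> T" "0 \<le> \<gamma>"
  shows "isCont (best_rate \<gamma>) T"
proof -
  have "0 \<le> \<gamma> * T * log m2 m1" using assms ln_m_pos by (simp add: log_def)
  then have "(1 + \<gamma> * T * log m2 m1) * ln m2 \<noteq> 0" using ln_m_pos by simp
  moreover have "((1 + T) / log m1 m2) * ln m2 \<noteq> 0" using assms ln_m_pos log_ratio_ge_1 by simp
  moreover have "log m1 m2 \<noteq> 0" using log_ratio_ge_1 by simp
  ultimately show ?thesis
    unfolding best_rate_def[abs_def] carpet_rate_def free_length_def
    by (intro continuous_intros)
qed

section \<open>Comparing the return radii with exact exponents\<close>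

lemma row_radius: "(m1 powr (- \<tau> * real n)) powr \<gamma> = m2 powr (- (\<gamma> * \<tau> * log m2 m1) * real n)"
  using ln_m_pos b1.base_ge_2 b2.base_ge_2 by (simp add: powr_powr powr_def log_def)

lemma inverse_power_le:
  assumes "(2::nat) \<le> m" "real p \<le> t"
  shows "real m powr (- t) \<le> 1 / real m ^ p"
proof -
  have "real m powr (- t) \<le> real m powr (- real p)" using assms by (intro powr_mono) auto
  then show ?thesis using assms by (simp add: powr_minus_divide powr_realpow)
qed

lemma inverse_power_less:
  assumes "(2::nat) \<le> m" "t < real p"
  shows "1 / real m ^ p < real m powr (- t)"
proof -
  have "real m powr (- real p) < real m powr (- t)" using assms by (intro powr_less_mono) auto
  then show ?thesis using assms by (simp add: powr_minus_divide powr_realpow)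
qed

lemma hausdorff_dim_le_best_rate:
  fixes \<gamma> \<tau> :: real
  assumes K: "is_carpet m1 m2 A K" and \<psi>: "\<And>n. 0 < \<psi> n" and \<gamma>: "0 \<le> \<gamma>"
    and \<tau>: "0 \<le> \<tau>" "\<tau> = 0 \<or> (\<forall>\<^sub>F n in sequentially. \<psi> n \<le> m1 powr (- \<tau> * real n))"
  shows "hausdorff_dim (recurrence_set m1 m2 A K \<gamma> \<psi>) \<le> ereal (best_rate \<gamma> \<tau>)"
proof -
  define \<tau>2 where "\<tau>2 = \<gamma> * \<tau> * log m2 m1"
  have \<tau>2: "0 \<le> \<tau>2" unfolding \<tau>2_def using \<gamma> \<tau> ln_m_pos by (simp add: log_def)
  have null: "r \<longlonglongrightarrow> 0" if r: "\<And>n. 0 \<le> r n" and le: "\<forall>\<^sub>F n in sequentially. r n \<le> m powr (- t * real n)"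
    and t: "0 < t" "2 \<le> (m::nat)" for r :: "nat \<Rightarrow> real" and m :: nat and t :: real
  proof (rule tendsto_sandwich[OF _ le tendsto_const])
    have "1 < real m" using t by simp
    then show "(\<lambda>n. m powr (- t * real n)) \<longlonglongrightarrow> 0" using t by real_asymp
  qed (use r in auto)
  have below: "\<forall>\<^sub>F n in sequentially. r n \<le> 1 / real m ^ nat \<lfloor>t * n\<rfloor>"
    if le: "\<forall>\<^sub>F n in sequentially. r n \<le> m powr (- t * real n)"
    and t: "0 \<le> t" "2 \<le> (m::nat)" for r :: "nat \<Rightarrow> real" and m :: nat and t :: real
    using le
  proof eventually_elim
    case (elim n)
    have "m powr (- (t * real n)) \<le> 1 / real m ^ nat \<lfloor>t * n\<rfloor>"
      by (rule inverse_power_le) (use t in auto)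
    then show ?case using elim by simp
  qed
  have c1: "\<tau> = 0 \<or> (\<psi> \<longlonglongrightarrow> 0 \<and> (\<forall>\<^sub>F n in sequentially. \<psi> n \<le> 1 / real m1 ^ nat \<lfloor>\<tau> * n\<rfloor>))"
    using \<tau> null[of \<psi> m1 \<tau>] below[of \<psi> m1 \<tau>] \<psi> m1_ge_2 by (auto simp: less_imp_le)
  have c2: "\<tau>2 = 0 \<or> ((\<lambda>n. \<psi> n powr \<gamma>) \<longlonglongrightarrow> 0 \<and>
      (\<forall>\<^sub>F n in sequentially. \<psi> n powr \<gamma> \<le> 1 / real m2 ^ nat \<lfloor>\<tau>2 * n\<rfloor>))"
  proof (cases "\<tau>2 = 0")
    case False
    then have "\<forall>\<^sub>F n in sequentially. \<psi> n \<le> m1 powr (- \<tau> * real n)" using \<tau> by (auto simp: \<tau>2_def)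
    then have le: "\<forall>\<^sub>F n in sequentially. \<psi> n powr \<gamma> \<le> m2 powr (- \<tau>2 * real n)"
    proof eventually_elim
      case (elim n)
      then have "\<psi> n powr \<gamma> \<le> (m1 powr (- \<tau> * real n)) powr \<gamma>"
        using \<psi>[of n] \<gamma> by (intro powr_mono2) (auto simp: less_imp_le)
      then show ?case unfolding row_radius \<tau>2_def .
    qed
    show ?thesis
      using null[OF _ le] below[OF le] False \<tau>2 b2.base_ge_2 by auto
  qed simp
  have "hausdorff_dim (recurrence_set m1 m2 A K \<gamma> \<psi>) \<le> ereal (carpet_rate m1 m2 M N \<tau> \<tau>2 x)" if "0 < x" for x
    by (rule hausdorff_dim_le_carpet_rate[OF K that \<tau>(1) \<tau>2 c1 c2])
  moreover have "0 < 1 + \<tau>2" "0 < (1 + \<tau>) / log m1 m2" using \<tau>2 \<tau> log_ratio_ge_1 by auto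
  ultimately show ?thesis unfolding best_rate_def \<tau>2_def[symmetric] by (simp add: min_def)
qed

text \<open>Block lengths are rounded up generously: the digits must agree strictly beyond the radius, and two digits
  are needed for the repetition of the positions 0 and 1.\<close>
lemma hausdorff_dim_ge_best_rate:
  fixes \<gamma> \<tau> :: real
  assumes K: "is_carpet m1 m2 A K" and \<gamma>: "0 \<le> \<gamma>" "\<gamma> \<le> log m1 m2"
    and \<tau>: "0 \<le> \<tau>" "\<exists>\<^sub>\<infinity>n. 0 < n \<and> m1 powr (- \<tau> * real n) \<le> \<psi> n"
  shows "ereal (best_rate \<gamma> \<tau>) \<le> hausdorff_dim (recurrence_set m1 m2 A K \<gamma> \<psi>)"
proof -
  define \<tau>2 where "\<tau>2 = \<gamma> * \<tau> * log m2 m1"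
  have \<tau>2: "0 \<le> \<tau>2" unfolding \<tau>2_def using \<gamma> \<tau> ln_m_pos by (simp add: log_def)
  have "\<gamma> * log m2 m1 \<le> 1" using \<gamma> ln_m_pos by (simp add: log_def field_simps)
  then have \<tau>2_le: "\<tau>2 \<le> \<tau>" using mult_right_mono[of "\<gamma> * log m2 m1" 1 \<tau>] \<tau> by (simp add: \<tau>2_def ac_simps)
  define S where "S = {n. 0 < n \<and> m1 powr (- \<tau> * real n) \<le> \<psi> n}"
  define P Q where "P n = nat \<lfloor>\<tau> * n\<rfloor> + 2" and "Q n = nat \<lfloor>\<tau>2 * n\<rfloor> + 2" for n :: nat
  have P: "\<tau> * n < P n" "P n \<le> \<tau> * n + 2" and Q: "\<tau>2 * n < Q n" "Q n \<le> \<tau>2 * n + 2" for n :: nat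
    unfolding P_def Q_def using \<tau> \<tau>2 by (simp_all add: of_nat_nat) linarith+
  show ?thesis
  proof (rule hausdorff_dim_recurrence_ge[OF K, where S = S and P = P and Q = Q and D = "3 * (ln M + ln N)"])
    show "\<exists>\<^sub>\<infinity>n. n \<in> S" using \<tau> by (simp add: S_def)
    show "2 \<le> Q n" "Q n \<le> P n" for n
      using \<tau>2_le by (auto simp: P_def Q_def intro!: nat_mono floor_mono mult_right_mono)
  next
    fix n assume n: "n \<in> S"
    have "1 / real m1 ^ P n < real m1 powr (- (\<tau> * n))"
      by (rule inverse_power_less) (use P m1_ge_2 in auto)
    then show "1 / real m1 ^ P n < \<psi> n" using n by (simp add: S_def)
    have "1 / real m2 ^ Q n < real m2 powr (- (\<tau>2 * n))"
      by (rule inverse_power_less) (use Q b2.base_ge_2 in auto)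
    also have "\<dots> = (m1 powr (- \<tau> * real n)) powr \<gamma>" unfolding row_radius \<tau>2_def by simp
    also have "\<dots> \<le> \<psi> n powr \<gamma>" using n \<gamma> by (intro powr_mono2) (auto simp: S_def)
    finally show "1 / real m2 ^ Q n < \<psi> n powr \<gamma>" .
  next
    fix n k :: nat assume n: "n \<in> S"
    then have n0: "0 < real n" by (simp add: S_def)
    define L where "L = log m1 m2"
    define l where "l = nat \<lfloor>L * k\<rfloor>"
    have l: "L * k - 1 \<le> l" "l \<le> L * k" unfolding l_def L_def by (rule column_level)+
    have eq: "best_rate \<gamma> \<tau> * (real k / n * ln m2) \<le> ln M * free_length \<tau> (L * (real k / n))
        + ln N * free_length \<tau>2 (real k / n)"
      unfolding L_def \<tau>2_def by (rule best_rate_minimal) (use \<tau> \<gamma> in auto)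
    have "best_rate \<gamma> \<tau> * (k * ln m2) = n * (best_rate \<gamma> \<tau> * (real k / n * ln m2))" using n0 by simp
    also have "\<dots> \<le> n * (ln M * free_length \<tau> (L * (real k / n)) + ln N * free_length \<tau>2 (real k / n))"
      using eq by (intro mult_left_mono) auto
    also have "\<dots> = ln M * (n * free_length \<tau> (L * (real k / n))) + ln N * (n * free_length \<tau>2 (real k / n))"
      by (simp add: algebra_simps)
    also have "\<dots> = ln M * (L * k - min (\<tau> * n) (max 0 (L * k - n))) + ln N * (k - min (\<tau>2 * n) (max 0 (real k - n)))"
      unfolding free_length_scale using n0 by simp
    finally have main: "best_rate \<gamma> \<tau> * (k * ln m2)
        \<le> ln M * (L * k - min (\<tau> * n) (max 0 (L * k - n))) + ln N * (k - min (\<tau>2 * n) (max 0 (real k - n)))" .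
    \<comment> \<open>Rounding the number of columns costs at most 1 digit, and rounding a block length at most 2.\<close>
    have "L * k - min (\<tau> * n) (max 0 (L * k - n)) - 3 \<le> l - min (P n) (max 0 (real l - n))"
      using l P[of n] by (auto simp: min_def max_def)
    then have "ln M * (L * k - min (\<tau> * n) (max 0 (L * k - n)) - 3) \<le> ln M * (l - min (P n) (max 0 (real l - n)))"
      using M_pos by (intro mult_left_mono) auto
    moreover have "k - min (\<tau>2 * n) (max 0 (real k - n)) - 3 \<le> k - min (Q n) (max 0 (real k - n))"
      using Q[of n] by (auto simp: min_def max_def)
    then have "ln N * (k - min (\<tau>2 * n) (max 0 (real k - n)) - 3) \<le> ln N * (k - min (Q n) (max 0 (real k - n)))"
      using N_pos by (intro mult_left_mono) auto
    ultimately show "best_rate \<gamma> \<tau> * (k * ln m2) - 3 * (ln M + ln N)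
      \<le> ln M * (real (nat \<lfloor>log m1 m2 * k\<rfloor>) - min (real (P n)) (max 0 (real (nat \<lfloor>log m1 m2 * k\<rfloor>) - real n)))
        + ln N * (real k - min (real (Q n)) (max 0 (real k - real n)))"
      using main unfolding L_def[symmetric] l_def[symmetric] by (simp add: algebra_simps)
  qed
qed

text \<open>For \<open>\<gamma> = 0\<close> the rows are unconstrained, and they alone contribute \<open>log\<^bsub>m2\<^esub> N\<close>, even if the column blocks
  have to be so long that columns contribute nothing.\<close>
lemma hausdorff_dim_ge_fibre:
  assumes K: "is_carpet m1 m2 A K" and \<psi>: "\<And>n. 0 < \<psi> n"
  shows "ereal (log m2 N) \<le> hausdorff_dim (recurrence_set m1 m2 A K 0 \<psi>)"
proof -
  have "\<exists>p\<ge>2. 1 / real m1 ^ p < \<psi> n" for n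
  proof -
    obtain p where "(1 / real m1) ^ p < \<psi> n"
      using real_arch_pow_inv[OF \<psi>[of n], of "1 / real m1"] m1_ge_2 by auto
    moreover have "(1 / real m1) ^ (p + 2) \<le> (1 / real m1) ^ p"
      using m1_ge_2 by (intro power_decreasing) auto
    ultimately have "1 / real m1 ^ (p + 2) < \<psi> n" by (simp add: power_one_over)
    then show ?thesis by (intro exI[of _ "p + 2"]) simp
  qed
  then obtain P where P: "\<And>n. 2 \<le> P n" "\<And>n. 1 / real m1 ^ P n < \<psi> n" by metis
  show ?thesis
  proof (rule hausdorff_dim_recurrence_ge[OF K, where S = UNIV and P = P and Q = "\<lambda>_. 2" and D = "2 * ln N"])
    show "1 / real m2 ^ 2 < \<psi> n powr 0" for n
      using \<psi>[of n] b2.base_ge_2 by (simp add: power2_eq_square field_simps) (metis less_1_mult less_le_trans of_nat_1 of_nat_less_iff one_less_numeral_iff semiring_norm(76) of_nat_numeral of_nat_le_iff)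
  next
    fix n k :: nat
    define l where "l = nat \<lfloor>log m1 m2 * k\<rfloor>"
    have "0 \<le> real l - min (real (P n)) (max 0 (real l - real n))" by (auto simp: min_def max_def)
    then have "0 \<le> ln M * (real l - min (real (P n)) (max 0 (real l - real n)))" using M_pos by simp
    moreover have "ln N * (real k - 2) \<le> ln N * (real k - min (real 2) (max 0 (real k - real n)))"
      using N_pos by (intro mult_left_mono) auto
    ultimately have "ln N * real k - 2 * ln N
      \<le> ln M * (real l - min (real (P n)) (max 0 (real l - real n)))
        + ln N * (real k - min (real 2) (max 0 (real k - real n)))" by (simp add: right_diff_distrib)
    moreover have "log m2 N * (k * ln m2) = ln N * real k" using ln_m_pos by (simp add: log_def)
    ultimately show "log m2 N * (k * ln m2) - 2 * ln N
      \<le> ln M * (real (nat \<lfloor>log m1 m2 * k\<rfloor>) - min (real (P n)) (max 0 (real (nat \<lfloor>log m1 m2 * k\<rfloor>) - real n)))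
        + ln N * (real k - min (real 2) (max 0 (real k - real n)))"
      unfolding l_def[symmetric] by (simp only:)
  qed (use P in auto)
qed

end

section \<open>The dimension of the recurrence set\<close>

context uniform_carpet
begin

lemma exponent_upper:
  fixes \<psi> :: "nat \<Rightarrow> real"
  assumes \<psi>: "\<And>n. 0 < \<psi> n" and t: "ereal t < liminf (\<lambda>n. ereal (- log m1 (\<psi> n) / n))"
  shows "\<forall>\<^sub>F n in sequentially. \<psi> n \<le> m1 powr (- t * real n)"
  using less_LiminfD[OF t] eventually_gt_at_top[of 0]
proof eventually_elim
  case (elim n)
  then have "log m1 (\<psi> n) \<le> - t * n" by (simp add: field_simps)
  then show ?case using \<psi>[of n] b1.base_ge_2 by (simp add: log_le_iff)
qed

lemma exponent_lower:
  fixes \<psi> :: "nat \<Rightarrow> real"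
  assumes \<psi>: "\<And>n. 0 < \<psi> n" and t: "liminf (\<lambda>n. ereal (- log m1 (\<psi> n) / n)) < ereal t"
  shows "\<exists>\<^sub>\<infinity>n. 0 < n \<and> m1 powr (- t * real n) \<le> \<psi> n"
proof -
  have "\<not> (\<forall>\<^sub>F n in sequentially. ereal t \<le> ereal (- log m1 (\<psi> n) / n))"
    using Liminf_bounded[of "ereal t" "\<lambda>n. ereal (- log m1 (\<psi> n) / n)" sequentially] t by (auto simp: not_le)
  then have "\<exists>\<^sub>\<infinity>n. \<not> ereal t \<le> ereal (- log m1 (\<psi> n) / n)"
    by (simp add: frequently_def cofinite_eq_sequentially)
  moreover have "\<forall>\<^sub>\<infinity>n. \<not> ereal t \<le> ereal (- log m1 (\<psi> n) / n) \<longrightarrow> 0 < n \<and> m1 powr (- t * real n) \<le> \<psi> n"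
    unfolding cofinite_eq_sequentially using eventually_gt_at_top[of 0]
  proof eventually_elim
    case (elim n)
    show ?case
    proof
      assume "\<not> ereal t \<le> ereal (- log m1 (\<psi> n) / n)"
      then have "- t * n \<le> log m1 (\<psi> n)" using elim by (simp add: field_simps)
      then have "m1 powr (- t * n) \<le> m1 powr (log m1 (\<psi> n))" using b1.base_ge_2 by (intro powr_mono) auto
      then show "0 < n \<and> m1 powr (- t * real n) \<le> \<psi> n"
        using elim \<psi>[of n] b1.base_ge_2 by simp
    qed
  qed
  ultimately show ?thesis by (rule frequently_rev_mp)
qed

lemma row_exponent:
  fixes \<psi> :: "nat \<Rightarrow> real"
  assumes \<psi>: "\<And>n. 0 < \<psi> n" and \<gamma>: "0 \<le> \<gamma>" and T: "liminf (\<lambda>n. ereal (- log m1 (\<psi> n) / n)) = ereal T"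
  shows "liminf (\<lambda>n. ereal (- log m2 (\<psi> n powr \<gamma>) / n)) = ereal (\<gamma> * T * log m2 m1)"
proof -
  have c: "0 \<le> \<gamma> * log m2 m1" using \<gamma> ln_m_pos by (simp add: log_def)
  have "ereal (- log m2 (\<psi> n powr \<gamma>) / n) = ereal (\<gamma> * log m2 m1) * ereal (- log m1 (\<psi> n) / n)" for n
    using ln_m_pos by (simp add: log_def ln_powr)
  then have "liminf (\<lambda>n. ereal (- log m2 (\<psi> n powr \<gamma>) / n))
      = ereal (\<gamma> * log m2 m1) * liminf (\<lambda>n. ereal (- log m1 (\<psi> n) / n))"
    by (simp only: Liminf_ereal_mult_left[OF sequentially_bot c])
  then show ?thesis unfolding T by (simp add: ac_simps)
qed

text \<open>The bounds hold for all exponents below \<open>T\<close>, respectively above \<open>T\<close>, and continuity closes the gap. For \<open>T = 0\<close>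
  there are no admissible exponents below, but exponent \<open>0\<close> itself imposes no condition.\<close>
lemma hausdorff_dim_finite_exponent:
  fixes \<psi> :: "nat \<Rightarrow> real"
  assumes K: "is_carpet m1 m2 A K" and \<psi>: "\<And>n. 0 < \<psi> n" and \<gamma>: "0 \<le> \<gamma>" "\<gamma> \<le> log m1 m2"
    and T: "liminf (\<lambda>n. ereal (- log m1 (\<psi> n) / n)) = ereal T" "0 \<le> T"
  shows "hausdorff_dim (recurrence_set m1 m2 A K \<gamma> \<psi>) = ereal (best_rate \<gamma> T)"
proof (rule antisym)
  define d where "d = hausdorff_dim (recurrence_set m1 m2 A K \<gamma> \<psi>)"
  have "((\<lambda>t. ereal (best_rate \<gamma> t)) \<longlongrightarrow> ereal (best_rate \<gamma> T)) (at T)"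
    using isCont_best_rate[OF T(2) \<gamma>(1)] unfolding isCont_def by (rule tendsto_ereal)
  then have lim: "((\<lambda>t. ereal (best_rate \<gamma> t)) \<longlongrightarrow> ereal (best_rate \<gamma> T)) (at_left T)"
    "((\<lambda>t. ereal (best_rate \<gamma> t)) \<longlongrightarrow> ereal (best_rate \<gamma> T)) (at_right T)"
    by (simp_all add: filterlim_at_split)
  show "hausdorff_dim (recurrence_set m1 m2 A K \<gamma> \<psi>) \<le> ereal (best_rate \<gamma> T)"
  proof (cases "T = 0")
    case True
    then show ?thesis using hausdorff_dim_le_best_rate[OF K \<psi> \<gamma>(1), of 0] by simp
  next
    case False
    then have "\<forall>\<^sub>F t in at_left T. t \<in> {0<..<T}" using T(2) by (intro eventually_at_left_real) auto
    then have "\<forall>\<^sub>F t in at_left T. d \<le> ereal (best_rate \<gamma> t)"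
    proof eventually_elim
      case (elim t)
      then have "ereal t < liminf (\<lambda>n. ereal (- log m1 (\<psi> n) / n))" unfolding T(1) by simp
      from exponent_upper[OF \<psi> this] elim show ?case
        unfolding d_def by (intro hausdorff_dim_le_best_rate[OF K \<psi> \<gamma>(1)]) auto
    qed
    then show ?thesis unfolding d_def[symmetric]
      by (rule tendsto_lowerbound[OF lim(1)]) simp
  qed
  have "\<forall>\<^sub>F t in at_right T. T < t" by (simp add: eventually_at_right_less)
  then have "\<forall>\<^sub>F t in at_right T. ereal (best_rate \<gamma> t) \<le> d"
  proof eventually_elim
    case (elim t)
    then show ?case unfolding d_def
      by (intro hausdorff_dim_ge_best_rate[OF K \<gamma>] exponent_lower \<psi>) (use T in auto)
  qed
  then show "ereal (best_rate \<gamma> T) \<le> hausdorff_dim (recurrence_set m1 m2 A K \<gamma> \<psi>)"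
    unfolding d_def[symmetric] by (rule tendsto_upperbound[OF lim(2)]) simp
qed

text \<open>For exponent \<open>\<infinity>\<close> the dimension is that of a fibre if \<open>\<gamma> = 0\<close> and \<open>0\<close> otherwise, so
  nonnegativity and the bound by a fibre are the matching lower bounds.\<close>
lemma best_rate_limit_le:
  assumes \<gamma>: "0 \<le> \<gamma>" and lim: "(best_rate \<gamma> \<longlongrightarrow> l) at_top"
  shows "l \<le> (if \<gamma> = 0 then log m2 N else 0)"
proof -
  define L where "L = log m1 m2"
  have L: "1 \<le> L" using log_ratio_ge_1 by (simp add: L_def)
  have c: "0 < log m2 m1" using ln_m_pos by (simp add: log_def)
  have ub: "l \<le> u" if "\<forall>\<^sub>F s in at_top. best_rate \<gamma> s \<le> f s" "(f \<longlongrightarrow> u) at_top" for f u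
    using tendsto_le[OF _ that(2) lim that(1)] by simp
  note formulas = best_rate_eq_formulas[OF _ \<gamma>]
  have big: "\<forall>\<^sub>F s in at_top. L < 1 + s \<and> 0 \<le> (s :: real)"
    by (intro eventually_conj) real_asymp+
  consider "\<gamma> = 0" | "0 < \<gamma>" "\<gamma> < 1" | "1 \<le> \<gamma>" using \<gamma> by linarith
  then show ?thesis
  proof cases
    case 1
    have "\<forall>\<^sub>F s in at_top. best_rate \<gamma> s \<le> log m1 M / (1 + s) + log m2 N"
      using big
    proof eventually_elim
      case (elim s)
      then have "t2_formula m1 m2 M N \<gamma> s (\<gamma> * s * log m2 m1) = log m1 M / (1 + s) + log m2 N"
        using 1 by (simp add: t2_formula_def L_def[symmetric] add_divide_distrib)
      then show ?case using formulas[of s] elim by simp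
    qed
    moreover have "((\<lambda>s. a / (1 + s) + b) \<longlongrightarrow> b) at_top" for a b :: real by real_asymp
    ultimately show ?thesis using ub 1 by simp
  next
    case 2
    have "filterlim (\<lambda>s::real. 1 + (1 - \<gamma>) * s) at_top at_top" using 2 by real_asymp
    then have "\<forall>\<^sub>F s in at_top. L < 1 + (1 - \<gamma>) * s" by (simp add: filterlim_at_top_dense)
    then have "\<forall>\<^sub>F s in at_top. best_rate \<gamma> s \<le> (log m2 M + log m2 N) / (1 + \<gamma> * log m2 m1 * s)"
      using big
    proof eventually_elim
      case (elim s)
      then have "t1_formula m1 m2 M N \<gamma> s (\<gamma> * s * log m2 m1) = (log m2 M + log m2 N) / (1 + \<gamma> * log m2 m1 * s)"
        by (simp add: t1_formula_def L_def[symmetric] ac_simps)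
      then show ?case using formulas[of s] elim by simp
    qed
    moreover have "((\<lambda>s. (log m2 M + log m2 N) / (1 + g * s)) \<longlongrightarrow> 0) at_top" if "0 < g" for g
      using that by real_asymp
    ultimately show ?thesis using ub 2 c by simp
  next
    case 3
    have "\<forall>\<^sub>F s in at_top. best_rate \<gamma> s \<le> (log m1 M + log m1 N) / (1 + s)"
      using big
    proof eventually_elim
      case (elim s)
      have "(1 - \<gamma>) * s \<le> 0" using 3 elim by (simp add: mult_nonpos_nonneg)
      then have "t2_formula m1 m2 M N \<gamma> s (\<gamma> * s * log m2 m1) = (log m1 M + log m1 N) / (1 + s)"
        using elim L by (simp add: t2_formula_def L_def[symmetric])
      then show ?case using formulas[of s] elim by simp
    qed
    moreover have "((\<lambda>s. (log m1 M + log m1 N) / (1 + s)) \<longlongrightarrow> 0) at_top" by real_asymp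
    ultimately show ?thesis using ub 3 by simp
  qed
qed

lemma hausdorff_dim_infinite_exponent:
  fixes \<psi> :: "nat \<Rightarrow> real"
  assumes K: "is_carpet m1 m2 A K" and \<psi>: "\<And>n. 0 < \<psi> n" and \<gamma>: "0 \<le> \<gamma>"
    and T: "liminf (\<lambda>n. ereal (- log m1 (\<psi> n) / n)) = \<infinity>"
    and lim: "(best_rate \<gamma> \<longlongrightarrow> l) at_top"
  shows "hausdorff_dim (recurrence_set m1 m2 A K \<gamma> \<psi>) = ereal l"
proof (rule antisym)
  have "\<forall>\<^sub>F t in at_top. hausdorff_dim (recurrence_set m1 m2 A K \<gamma> \<psi>) \<le> ereal (best_rate \<gamma> t)"
    using eventually_gt_at_top[of 0]
  proof eventually_elim
    case (elim t)
    have "ereal t < liminf (\<lambda>n. ereal (- log m1 (\<psi> n) / n))" unfolding T by simp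
    from exponent_upper[OF \<psi> this] elim show ?case
      by (intro hausdorff_dim_le_best_rate[OF K \<psi> \<gamma>]) auto
  qed
  then show "hausdorff_dim (recurrence_set m1 m2 A K \<gamma> \<psi>) \<le> ereal l"
    by (rule tendsto_lowerbound[OF tendsto_ereal[OF lim]]) simp
  have "ereal l \<le> ereal (if \<gamma> = 0 then log m2 N else 0)"
    using best_rate_limit_le[OF \<gamma> lim] by simp
  also have "\<dots> \<le> hausdorff_dim (recurrence_set m1 m2 A K \<gamma> \<psi>)"
    using hausdorff_dim_ge_fibre[OF K \<psi>] hausdorff_dim_nonneg by (auto simp: zero_ereal_def[symmetric])
  finally show "ereal l \<le> hausdorff_dim (recurrence_set m1 m2 A K \<gamma> \<psi>)" .
qed

lemma best_rate_gamma_1: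
  assumes "0 \<le> s"
  shows "1 + s < log m1 m2 \<Longrightarrow> best_rate 1 s
      = min ((log m1 M + log m2 N) / (1 + 1 * s * log m2 m1)) (log m1 M / (1 + s) + log m2 N)"
    and "log m1 m2 \<le> 1 + s \<Longrightarrow> best_rate 1 s
      = min ((log m1 M + log m2 N) / (1 + 1 * s * log m2 m1)) ((log m1 M + log m1 N) / (1 + s))"
proof -
  have L: "1 \<le> log m1 m2" by (rule log_ratio_ge_1)
  have "0 \<le> s * log m2 m1" using assms ln_m_pos by (simp add: log_def)
  then have "1 - s * log m2 m1 / (1 + s * log m2 m1) = 1 / (1 + s * log m2 m1)"
    by (simp add: field_simps)
  then have t1: "t1_formula m1 m2 M N 1 s (1 * s * log m2 m1) = (log m1 M + log m2 N) / (1 + 1 * s * log m2 m1)"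
    using L by (simp add: t1_formula_def add_divide_distrib)
  note formulas = best_rate_eq_formulas[OF assms, of 1, unfolded t1, simplified]
  show "1 + s < log m1 m2 \<Longrightarrow> best_rate 1 s
      = min ((log m1 M + log m2 N) / (1 + 1 * s * log m2 m1)) (log m1 M / (1 + s) + log m2 N)"
    using formulas by (simp add: t2_formula_def)
  assume le: "log m1 m2 \<le> 1 + s"
  have "t2_formula m1 m2 M N 1 s (s * log m2 m1) = (log m1 M + log m1 N) / (1 + s)"
  proof (cases "1 + s = log m1 m2")
    case True
    have "log m2 N = log m1 N / log m1 m2" using ln_m_pos by (simp add: log_def)
    then show ?thesis by (simp add: t2_formula_def True add_divide_distrib)
  next
    case False
    then show ?thesis using le L by (simp add: t2_formula_def)
  qed
  then show "best_rate 1 s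
      = min ((log m1 M + log m2 N) / (1 + 1 * s * log m2 m1)) ((log m1 M + log m1 N) / (1 + s))"
    using formulas by simp
qed

end

theorem theorem1p1:
  fixes m1 m2 M N :: nat
    and A :: "(nat \<times> nat) set"
    and K W :: "(real \<times> real) set"
    and \<psi> :: "nat \<Rightarrow> real"
    and \<gamma> :: real
    and \<tau>1 \<tau>2 :: ereal
  assumes "2 \<le> m1" and "m1 \<le> m2"
    and "A \<subseteq> {0..<m1} \<times> {0..<m2}" and "A \<noteq> {}"
    and "is_carpet m1 m2 A K"
    and "M = card {a. \<exists>b. (a, b) \<in> A}"
    and "1 \<le> N" and "\<forall>a<m1. card {b. (a, b) \<in> A} \<in> {0, N}"
    and "\<And>n. 0 < \<psi> n"
    and "0 \<le> \<gamma>" and "\<gamma> \<le> log m1 m2"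
    and "\<tau>1 = liminf (\<lambda>n. ereal (- log m1 (\<psi> n) / n))"
    and "\<tau>2 = liminf (\<lambda>n. ereal (- log m2 (\<psi> n powr \<gamma>) / n))"
    and "W = recurrence_set m1 m2 A K \<gamma> \<psi>"
    and "0 \<le> \<tau>1"
  shows "hausdorff_dim W =
           ereal (min (at_exponents m1 m2 \<gamma> (t1_formula m1 m2 M N \<gamma>) \<tau>1 \<tau>2)
                      (at_exponents m1 m2 \<gamma> (t2_formula m1 m2 M N \<gamma>) \<tau>1 \<tau>2)) \<and>
         (\<gamma> = 1 \<longrightarrow>
           (ereal (log m1 m2) > 1 + \<tau>1 \<longrightarrow>
             hausdorff_dim W = ereal (at_exponents m1 m2 \<gamma>
               (\<lambda>s1 s2. min ((log m1 M + log m2 N) / (1 + s2))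
                            (log m1 M / (1 + s1) + log m2 N)) \<tau>1 \<tau>2)) \<and>
           (ereal (log m1 m2) \<le> 1 + \<tau>1 \<longrightarrow>
             hausdorff_dim W = ereal (at_exponents m1 m2 \<gamma>
               (\<lambda>s1 s2. min ((log m1 M + log m2 N) / (1 + s2))
                            ((log m1 M + log m1 N) / (1 + s1))) \<tau>1 \<tau>2)))"
proof -
  have columns: "{a. \<exists>b. (a, b) \<in> A} = fst ` A" by force
  have column: "card {b. (a, b) \<in> A} = N" if a: "a \<in> fst ` A" for a
  proof -
    from a obtain b where b: "(a, b) \<in> A" by auto
    have "finite {b. (a, b) \<in> A}" by (rule finite_subset[of _ "{0..<m2}"]) (use assms(3) in auto)
    then have "card {b. (a, b) \<in> A} \<noteq> 0" using b by auto
    moreover have "a < m1" using assms(3) b by auto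
    ultimately show ?thesis using assms(8) by auto
  qed
  interpret uniform_carpet m1 m2 A M N
    by unfold_locales (use assms(1-4,6,7) columns column in auto)
  note K = assms(5) and \<psi> = assms(9) and \<gamma> = assms(10,11) and \<tau>1 = assms(12) and \<tau>2 = assms(13)
  show ?thesis
  proof (cases "\<tau>1 = \<infinity>")
    case False
    then obtain T where T: "\<tau>1 = ereal T" "0 \<le> T" using \<open>0 \<le> \<tau>1\<close> by (cases \<tau>1) auto
    have T2: "\<tau>2 = ereal (\<gamma> * T * log m2 m1)"
      unfolding \<tau>2 by (rule row_exponent[OF \<psi> \<gamma>(1)]) (use T \<tau>1 in simp)
    have dim: "hausdorff_dim W = ereal (best_rate \<gamma> T)"
      unfolding assms(14) by (rule hausdorff_dim_finite_exponent[OF K \<psi> \<gamma>]) (use T \<tau>1 in simp_all)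
    show ?thesis
      unfolding dim at_exponents_def T T2
      using best_rate_eq_formulas[OF T(2) \<gamma>(1)] best_rate_gamma_1[OF T(2)]
      by (auto simp: one_ereal_def)
  next
    case True
    obtain l1 l2 where l: "((\<lambda>s. t1_formula m1 m2 M N \<gamma> s (\<gamma> * s * log m2 m1)) \<longlongrightarrow> l1) at_top"
      "((\<lambda>s. t2_formula m1 m2 M N \<gamma> s (\<gamma> * s * log m2 m1)) \<longlongrightarrow> l2) at_top"
      using t1_formula_limit_exists[OF assms(1,2) \<gamma>] t2_formula_limit_exists[OF assms(1,2) \<gamma>] by blast
    have "\<forall>\<^sub>F s in at_top. min (t1_formula m1 m2 M N \<gamma> s (\<gamma> * s * log m2 m1))
        (t2_formula m1 m2 M N \<gamma> s (\<gamma> * s * log m2 m1)) = best_rate \<gamma> s"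
      using eventually_ge_at_top[of 0] by eventually_elim (simp add: best_rate_eq_formulas \<gamma>)
    with tendsto_min[OF l] have lim: "(best_rate \<gamma> \<longlongrightarrow> min l1 l2) at_top"
      by (rule Lim_transform_eventually)
    have dim: "hausdorff_dim W = ereal (min l1 l2)"
      unfolding assms(14) by (rule hausdorff_dim_infinite_exponent[OF K \<psi> \<gamma>(1) _ lim]) (use True \<tau>1 in simp)
    have Lims: "Lim at_top (\<lambda>s. t1_formula m1 m2 M N \<gamma> s (\<gamma> * s * log m2 m1)) = l1"
      "Lim at_top (\<lambda>s. t2_formula m1 m2 M N \<gamma> s (\<gamma> * s * log m2 m1)) = l2"
      using l by (auto intro: tendsto_Lim)
    have "Lim at_top (\<lambda>s. min ((log m1 M + log m2 N) / (1 + \<gamma> * s * log m2 m1))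
        ((log m1 M + log m1 N) / (1 + s))) = min l1 l2" if "\<gamma> = 1"
    proof (rule tendsto_Lim)
      have "\<forall>\<^sub>F s in at_top. best_rate \<gamma> s = min ((log m1 M + log m2 N) / (1 + \<gamma> * s * log m2 m1))
          ((log m1 M + log m1 N) / (1 + s))"
        using eventually_ge_at_top[of 0] eventually_ge_at_top[of "log m1 m2"]
        by eventually_elim (use that best_rate_gamma_1(2) in auto)
      with lim show "((\<lambda>s. min ((log m1 M + log m2 N) / (1 + \<gamma> * s * log m2 m1))
        ((log m1 M + log m1 N) / (1 + s))) \<longlongrightarrow> min l1 l2) at_top"
        by (rule Lim_transform_eventually)
    qed simp
    then show ?thesis by (simp add: dim at_exponents_def True Lims)
  qed
qed

end
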